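(* Let $\mathcal{A} = \{K_1,\dots,K_n\}$ be a toric arrangement in $(\mathbb{C}^* )^l$, where $K_i = \{z \in (\mathbb{C}^* )^l \mid \chi_i(z) = c_i\}$, and let $M(\mathcal{A}) = (\mathbb{C}^* )^l \setminus \bigcup_{i=1}^n K_i$ be its complement. For $0 \le i \le n$ let $M_i = (\mathbb{C}^* )^l \setminus (K_1 \cup \cdots \cup K_i)$, so that $M_0 = (\mathbb{C}^* )^l$. Suppose that for every $1 \le i \le n$ the map $j^* \colon H^*(M_{i-1}) \to H^*(M_{i-1} \cap K_i)$ induced by inclusion is surjective. Then the algebra $H^*(M(\mathcal{A}))$ is generated by the classes of the logarithmic $1$-forms $$\{d\log z_1, \dots, d\log z_l,\ d\log(\chi_1 - c_1), \dots, d\log(\chi_n - c_n)\}.$$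
   Context: A character of $(\mathbb{C}^* )^l$ is a homomorphism $\chi \colon (\mathbb{C}^* )^l \to \mathbb{C}^*$ given by a Laurent monomial $\chi(z_1,\dots,z_l) = z_1^{n_1}\cdots z_l^{n_l}$ with $n_1,\dots,n_l \in \mathbb{Z}$. A toric arrangement in $(\mathbb{C}^* )^l$ is a finite collection of toric hypersurfaces $K_i = \{z \in (\mathbb{C}^* )^l \mid \chi_i(z) = c_i\}$, $1\le i\le n$, where each $\chi_i$ is a character and $c_i \in \mathbb{C}^*$. Standing assumption: each $K_i$ is connected, i.e. each character $\chi_i$ is primitive (its exponents are relatively prime). $H^*(-)$ denotes de Rham cohomology with complex coefficients, viewed as a graded $\mathbb{C}$-algebra. $z_1,\dots,z_l$ are the coordinate functions on $(\mathbb{C}^* )^l$. For a nowhere vanishing holomorphic function $g$, $d\log g$ denotes the closed $1$-form $dg/g$; the forms in the claim are restricted to $M(\mathcal{A})$. *)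

theory Defs
  imports "HOL-Analysis.Analysis" "HOL-Algebra.Module"
begin

section \<open>Smooth differential forms on submanifolds of a Euclidean space\<close>

text \<open>\<open>Ck_on k U f\<close> is only meant for open \<open>U\<close>; there \<open>frechet_derivative f (at x) v\<close> is the
  directional derivative of \<open>f\<close> at \<open>x\<close> along \<open>v\<close>.\<close>

primrec Ck_on ::
  "nat \<Rightarrow> 'a::euclidean_space set \<Rightarrow> ('a \<Rightarrow> 'b::real_normed_vector) \<Rightarrow> bool" where
  "Ck_on 0 U f \<longleftrightarrow> continuous_on U f"
| "Ck_on (Suc k) U f \<longleftrightarrow>
     f differentiable_on U \<and> (\<forall>v. Ck_on k U (\<lambda>x. frechet_derivative f (at x) v))"

definition smooth_on :: "'a::euclidean_space set \<Rightarrow> ('a \<Rightarrow> 'b::real_normed_vector) \<Rightarrow> bool" where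
  "smooth_on U f \<longleftrightarrow> (\<forall>k. Ck_on k U f)"

text \<open>Velocity vectors of smooth curves in \<open>S\<close> through \<open>x\<close>: the whole space if \<open>S\<close> is open, and
  the usual tangent space if \<open>S\<close> is an embedded submanifold.\<close>

definition tangent_space :: "'a::euclidean_space set \<Rightarrow> 'a \<Rightarrow> 'a set" where
  "tangent_space S x = {v. \<exists>(\<gamma> :: real \<Rightarrow> 'a) e. e > 0 \<and> smooth_on {-e<..<e} \<gamma> \<and>
     \<gamma> ` {-e<..<e} \<subseteq> S \<and> \<gamma> 0 = x \<and> (\<gamma> has_vector_derivative v) (at 0)}"

text \<open>A complex-valued form may have components in all degrees: its value at \<open>x\<close> on a list
  of \<open>k\<close> tangent vectors is the value of its degree \<open>k\<close> component. So the type below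
  represents the direct sum of the spaces of \<open>k\<close>-forms over all \<open>k\<close>; in degrees above the
  dimension all components vanish because they are alternating.\<close>

type_synonym 'a form = "'a \<Rightarrow> 'a list \<Rightarrow> complex"

definition alt_multilinear :: "('a::real_vector list \<Rightarrow> complex) \<Rightarrow> bool" where
  "alt_multilinear a \<longleftrightarrow>
     (\<forall>us ws. linear (\<lambda>v. a (us @ v # ws))) \<and>
     (\<forall>us v vs ws. a (us @ v # vs @ v # ws) = 0)"

text \<open>Smooth forms on an open subset \<open>V\<close> of the ambient space.\<close>

definition ambient_form_on :: "'a::euclidean_space set \<Rightarrow> 'a form \<Rightarrow> bool" where
  "ambient_form_on V \<eta> \<longleftrightarrow>
     (\<forall>x\<in>V. alt_multilinear (\<eta> x)) \<and> (\<forall>vs. smooth_on V (\<lambda>x. \<eta> x vs))"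

definition ambient_deriv :: "'a::euclidean_space form \<Rightarrow> 'a form" where
  "ambient_deriv \<eta> x vs = (\<Sum>i<length vs.
     (-1) ^ i * frechet_derivative (\<lambda>y. \<eta> y (take i vs @ drop (Suc i) vs)) (at x) (vs ! i))"

text \<open>Forms on \<open>S\<close> take values on tangent vectors of \<open>S\<close> only; they are normalised to be \<open>0\<close>
  elsewhere, so that equal forms are equal as functions. Pulling a form back along the
  inclusion of \<open>S\<close> is then the following operation.\<close>

definition restrict_form :: "'a::euclidean_space set \<Rightarrow> 'a form \<Rightarrow> 'a form" where
  "restrict_form S \<omega> x vs = (if x \<in> S \<and> set vs \<subseteq> tangent_space S x then \<omega> x vs else 0)"

definition local_extension ::
  "'a::euclidean_space set \<Rightarrow> 'a form \<Rightarrow> 'a \<Rightarrow> 'a form \<Rightarrow> bool" where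
  "local_extension S \<omega> x \<eta> \<longleftrightarrow>
     (\<exists>V. open V \<and> x \<in> V \<and> ambient_form_on V \<eta> \<and>
        (\<forall>y\<in>S \<inter> V. \<forall>vs. set vs \<subseteq> tangent_space S y \<longrightarrow> \<omega> y vs = \<eta> y vs))"

text \<open>As for smooth functions on a submanifold, a form on \<open>S\<close> is smooth if it extends locally
  to a smooth form on an open subset of the ambient space. Its exterior derivative is
  computed from such local extensions, the choice of which is immaterial for a submanifold
  because the derivative commutes with pullback.\<close>

definition forms :: "'a::euclidean_space set \<Rightarrow> 'a form set" where
  "forms S = {\<omega>. restrict_form S \<omega> = \<omega> \<and> (\<forall>x\<in>S. \<exists>\<eta>. local_extension S \<omega> x \<eta>)}"

definition ext_deriv :: "'a::euclidean_space set \<Rightarrow> 'a form \<Rightarrow> 'a form" where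
  "ext_deriv S \<omega> =
     restrict_form S (\<lambda>x vs. ambient_deriv (SOME \<eta>. local_extension S \<omega> x \<eta>) x vs)"

text \<open>The wedge product as a sum over shuffles, without factorials; \<open>I\<close> is the set of positions of
  the arguments handed to the first factor.\<close>

definition shuffle_sign :: "nat \<Rightarrow> nat set \<Rightarrow> complex" where
  "shuffle_sign n I = (-1) ^ card {(i, j). i \<in> I \<and> j \<in> {..<n} - I \<and> j < i}"

definition wedge :: "'a form \<Rightarrow> 'a form \<Rightarrow> 'a form" where
  "wedge \<alpha> \<beta> x vs = (\<Sum>I\<in>Pow {..<length vs}.
     shuffle_sign (length vs) I * \<alpha> x (nths vs I) * \<beta> x (nths vs ({..<length vs} - I)))"

definition unit_form :: "'a form" where
  "unit_form x vs = (if vs = [] then 1 else 0)"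


section \<open>De Rham cohomology with complex coefficients\<close>

definition closed_forms :: "'a::euclidean_space set \<Rightarrow> 'a form set" where
  "closed_forms S = {\<omega> \<in> forms S. ext_deriv S \<omega> = (\<lambda>x vs. 0)}"

definition exact_forms :: "'a::euclidean_space set \<Rightarrow> 'a form set" where
  "exact_forms S = ext_deriv S ` forms S"

definition de_rham_class :: "'a::euclidean_space set \<Rightarrow> 'a form \<Rightarrow> 'a form set" where
  "de_rham_class S \<omega> = {\<omega>' \<in> closed_forms S. (\<lambda>x vs. \<omega>' x vs - \<omega> x vs) \<in> exact_forms S}"

text \<open>The algebra \<open>H\<^sup>*(S)\<close>, the direct sum of all \<open>H\<^sup>k(S)\<close>. The operations are those induced by
  representatives: each union below is over sets that coincide.\<close>

definition de_rham_algebra ::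
  "'a::euclidean_space set \<Rightarrow> (complex, 'a form set) module" where
  "de_rham_algebra S =
     \<lparr>carrier = de_rham_class S ` closed_forms S,
      mult = (\<lambda>A B. \<Union>\<alpha>\<in>A. \<Union>\<beta>\<in>B. de_rham_class S (wedge \<alpha> \<beta>)),
      one = de_rham_class S (restrict_form S unit_form),
      zero = de_rham_class S (\<lambda>x vs. 0),
      add = (\<lambda>A B. \<Union>\<alpha>\<in>A. \<Union>\<beta>\<in>B. de_rham_class S (\<lambda>x vs. \<alpha> x vs + \<beta> x vs)),
      smult = (\<lambda>a A. \<Union>\<alpha>\<in>A. de_rham_class S (\<lambda>x vs. a * \<alpha> x vs))\<rparr>"

text \<open>The map \<open>H\<^sup>*(S) \<rightarrow> H\<^sup>*(T)\<close> induced by the inclusion of \<open>T\<close> in \<open>S\<close>.\<close>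

definition inclusion_pullback ::
  "'a::euclidean_space set \<Rightarrow> 'a form set \<Rightarrow> 'a form set" where
  "inclusion_pullback T A = (\<Union>\<omega>\<in>A. de_rham_class T (restrict_form T \<omega>))"

text \<open>Unital subalgebras over the complex numbers. The library's subalgebra locale has its
  scalars inside the algebra, which does not fit the zero algebra \<open>H\<^sup>*({})\<close>.\<close>

definition unital_subalgebra :: "(complex, 'b) module \<Rightarrow> 'b set \<Rightarrow> bool" where
  "unital_subalgebra H B \<longleftrightarrow>
     B \<subseteq> carrier H \<and> \<one>\<^bsub>H\<^esub> \<in> B \<and> \<zero>\<^bsub>H\<^esub> \<in> B \<and>
     (\<forall>u\<in>B. \<forall>v\<in>B. u \<oplus>\<^bsub>H\<^esub> v \<in> B \<and> u \<otimes>\<^bsub>H\<^esub> v \<in> B) \<and>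
     (\<forall>a. \<forall>u\<in>B. a \<odot>\<^bsub>H\<^esub> u \<in> B)"

definition generates_algebra :: "(complex, 'b) module \<Rightarrow> 'b set \<Rightarrow> bool" where
  "generates_algebra H G \<longleftrightarrow>
     G \<subseteq> carrier H \<and> unital_subalgebra H hull G = carrier H"


section \<open>Toric arrangements\<close>

definition torus :: "(complex ^ 'l::finite) set" where
  "torus = {z. \<forall>j. z $ j \<noteq> 0}"

definition character :: "int ^ 'l::finite \<Rightarrow> complex ^ 'l \<Rightarrow> complex" where
  "character m z = (\<Prod>j\<in>UNIV. (z $ j) powi (m $ j))"

definition primitive :: "int ^ 'l::finite \<Rightarrow> bool" where
  "primitive m \<longleftrightarrow> Gcd (range (\<lambda>j. m $ j)) = 1"

definition hypersurface :: "int ^ 'l::finite \<Rightarrow> complex \<Rightarrow> (complex ^ 'l) set" where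
  "hypersurface m c = {z \<in> torus. character m z = c}"

text \<open>The arrangement of the hypersurfaces \<open>\<chi>\<^sub>i = c\<^sub>i\<close> for \<open>1 \<le> i \<le> n\<close>, where \<open>\<chi>\<^sub>i\<close> has exponent
  vector \<open>m i\<close>.\<close>

definition toric_arrangement ::
  "nat \<Rightarrow> (nat \<Rightarrow> int ^ 'l::finite) \<Rightarrow> (nat \<Rightarrow> complex) \<Rightarrow> bool" where
  "toric_arrangement n m c \<longleftrightarrow> (\<forall>i\<in>{1..n}. primitive (m i) \<and> c i \<noteq> 0)"

definition complement ::
  "(nat \<Rightarrow> int ^ 'l::finite) \<Rightarrow> (nat \<Rightarrow> complex) \<Rightarrow> nat \<Rightarrow> (complex ^ 'l) set" where
  "complement m c i = torus - (\<Union>k\<in>{1..i}. hypersurface (m k) (c k))"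

definition dlog ::
  "'a::euclidean_space set \<Rightarrow> ('a \<Rightarrow> complex) \<Rightarrow> 'a form" where
  "dlog M g = restrict_form M (\<lambda>x vs.
     if length vs = 1 then frechet_derivative g (at x) (vs ! 0) / g x else 0)"

end

theory Submission
  imports Defs "HOL-Computational_Algebra.Polynomial"
begin

text \<open>The proof adds one hypersurface at a time. A closed form on the complement of
  \<open>K = {f = 0}\<close> in \<open>X\<close> is, near \<open>K\<close>, cohomologous to \<open>C + d log f \<and> B\<close> with \<open>B\<close> and \<open>C\<close> closed
  across \<open>K\<close>; here \<open>B\<close> is the residue, obtained by integration over the circles around \<open>K\<close>.
  Surjectivity of the restriction to \<open>K\<close> allows \<open>B\<close> to be replaced by a closed form on all of \<open>X\<close>,
  and cutting off the primitive by a bump function shows that the rest of the form extends to a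
  closed form on \<open>X\<close>, up to an exact form. So the cohomology of \<open>X - K\<close> is generated by \<open>d log f\<close>
  and the cohomology of \<open>X\<close>.

  No tubular neighbourhood theorem is needed: if \<open>\<chi>\<close> is primitive, Bezout gives a one-parameter
  subgroup \<open>\<lambda>\<close> with \<open>\<chi>(\<lambda>(s)) = s\<close>, and \<open>(z, w) \<mapsto> \<lambda>((c + w) / \<chi>(z)) z\<close> moves \<open>z\<close> along its
  \<open>\<lambda>\<close>-orbit to the point where \<open>\<chi> - c\<close> equals \<open>w\<close>. The torus itself is treated in the same way, as the
  complement of the coordinate hyperplanes in affine space, starting from the Poincare lemma.\<close>

section \<open>Smooth functions\<close>

text \<open>All analysis takes place on open sets, where a form is the same as its ambient
  components. Forms mix degrees, so identities are proved by splitting off the first argument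
  (Cartan's formula) rather than by counting degrees. The hypersurface is not open, and its
  submanifold structure is never established. A form on it is studied through its pullback along the
  retraction \<open>proj\<close> of the tube, whose derivative only produces vectors tangent to the
  hypersurface. Surjectivity enters because the residue \<open>B\<close> lives in the tube only,
  whereas the term \<open>d log f\<close> wedge \<open>B\<close> has to be subtracted on the whole
  complement. Integrating over circles produces the angular form, the imaginary part of
  \<open>df / f\<close>, and not \<open>df / f\<close> itself. The two differ by
  \<open>d ln |f|\<close> up to the factor \<open>\<i>\<close>; since \<open>B\<close> is closed,
  the resulting error is the exact form \<open>d (ln |f| B)\<close>. Its primitive is singular along
  the hypersurface, which does no harm because primitives are only asked for on the punctured
  tube.\<close>

lemma frechet_derivative_cong_open:
  assumes "open S" "x \<in> S" "\<And>y. y \<in> S \<Longrightarrow> f y = g y"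
  shows "frechet_derivative f (at x) = frechet_derivative g (at x)"
proof -
  have "(f has_derivative f') (at x) \<longleftrightarrow> (g has_derivative f') (at x)" for f'
    using assms has_derivative_transform_within_open[of f f' x UNIV S g]
      has_derivative_transform_within_open[of g f' x UNIV S f] by auto
  then show ?thesis
    unfolding frechet_derivative_def by simp
qed

lemma Ck_on_cong:
  assumes "open U" "\<And>x. x \<in> U \<Longrightarrow> f x = g x"
  shows "Ck_on k U f \<longleftrightarrow> Ck_on k U g"
  using assms(2)
proof (induction k arbitrary: f g)
  case 0
  then show ?case by (auto intro: continuous_on_cong)
next
  case (Suc k)
  have "f differentiable_on U \<longleftrightarrow> g differentiable_on U"
    using has_derivative_transform[of _ U f g] has_derivative_transform[of _ U g f] Suc.prems
    unfolding differentiable_on_def differentiable_def by metis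
  moreover have "Ck_on k U (\<lambda>x. frechet_derivative f (at x) v) \<longleftrightarrow>
      Ck_on k U (\<lambda>x. frechet_derivative g (at x) v)" for v
    using frechet_derivative_cong_open[OF assms(1) _ Suc.prems] by (intro Suc.IH) auto
  ultimately show ?case by simp
qed

lemma Ck_on_SucI:
  assumes "open U" "\<And>x. x \<in> U \<Longrightarrow> (f has_derivative f' x) (at x)"
    "\<And>v. Ck_on k U (\<lambda>x. f' x v)"
  shows "Ck_on (Suc k) U f"
proof -
  have "f differentiable_on U"
    using assms(2) by (meson differentiable_at_imp_differentiable_on differentiable_def)
  moreover have "Ck_on k U (\<lambda>x. frechet_derivative f (at x) v)" for v
    using assms(3)[of v] Ck_on_cong[OF assms(1), of "\<lambda>x. f' x v" "\<lambda>x. frechet_derivative f (at x) v" k]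
      frechet_derivative_at[OF assms(2)] by metis
  ultimately show ?thesis by simp
qed

lemma Ck_on_SucD:
  assumes "open U" "Ck_on (Suc k) U f" "x \<in> U"
  shows "(f has_derivative frechet_derivative f (at x)) (at x)"
  using assms by (simp add: differentiable_on_eq_differentiable_at frechet_derivative_works)

lemma Ck_on_pred: "Ck_on (Suc k) U f \<Longrightarrow> Ck_on k U f"
  by (induction k arbitrary: f) (auto intro: differentiable_imp_continuous_on)

lemma Ck_on_subset: "Ck_on k U f \<Longrightarrow> V \<subseteq> U \<Longrightarrow> Ck_on k V f"
  by (induction k arbitrary: f) (auto intro: continuous_on_subset differentiable_on_subset)

lemma Ck_on_local:
  assumes "open U" "\<And>x. x \<in> U \<Longrightarrow> \<exists>V. open V \<and> x \<in> V \<and> Ck_on k V f"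
  shows "Ck_on k U f"
  using assms(2)
proof (induction k arbitrary: f)
  case 0
  then show ?case
    by (simp add: continuous_on_eq_continuous_at assms(1)) (metis continuous_on_eq_continuous_at)
next
  case (Suc k)
  have "f differentiable (at x)" if "x \<in> U" for x
    using Suc.prems[OF that] by (auto simp: differentiable_on_eq_differentiable_at)
  then have "f differentiable_on U"
    by (simp add: differentiable_at_imp_differentiable_on)
  moreover have "Ck_on k U (\<lambda>x. frechet_derivative f (at x) v)" for v
    using Suc.prems by (intro Suc.IH) fastforce
  ultimately show ?case by simp
qed

lemma Ck_on_const: "open U \<Longrightarrow> Ck_on k U (\<lambda>x. c)"
proof (induction k arbitrary: c)
  case (Suc k)
  show ?case by (rule Ck_on_SucI[where f' = "\<lambda>x v. 0"]) (use Suc in auto)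
qed auto

lemma Ck_on_bounded_linear:
  assumes "open U" "bounded_linear L" "Ck_on k U f"
  shows "Ck_on k U (\<lambda>x. L (f x))"
  using assms(3)
proof (induction k arbitrary: f)
  case 0
  then show ?case using assms(2) by (simp add: bounded_linear.continuous_on)
next
  case (Suc k)
  show ?case
  proof (rule Ck_on_SucI[OF assms(1)])
    show "((\<lambda>x. L (f x)) has_derivative (\<lambda>v. L (frechet_derivative f (at x) v))) (at x)" if "x \<in> U" for x
      using bounded_linear.has_derivative[OF assms(2) Ck_on_SucD[OF assms(1) Suc.prems that]] .
    show "Ck_on k U (\<lambda>x. L (frechet_derivative f (at x) v))" for v
      using Suc by simp
  qed
qed

lemma Ck_on_ident: "open U \<Longrightarrow> Ck_on k U (\<lambda>x. x)"
proof (cases k)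
  case (Suc k)
  assume "open U"
  then show ?thesis
    unfolding Suc by (intro Ck_on_SucI[where f' = "\<lambda>x v. v"] Ck_on_const has_derivative_ident)
qed auto

lemma Ck_on_add:
  assumes "open U" "Ck_on k U f" "Ck_on k U g"
  shows "Ck_on k U (\<lambda>x. f x + g x)"
  using assms(2,3)
proof (induction k arbitrary: f g)
  case 0
  then show ?case by (simp add: continuous_on_add)
next
  case (Suc k)
  show ?case
  proof (rule Ck_on_SucI[OF assms(1)])
    show "((\<lambda>x. f x + g x) has_derivative
        (\<lambda>v. frechet_derivative f (at x) v + frechet_derivative g (at x) v)) (at x)" if "x \<in> U" for x
      using has_derivative_add[OF Ck_on_SucD[OF assms(1) Suc.prems(1) that] Ck_on_SucD[OF assms(1) Suc.prems(2) that]] .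
    show "Ck_on k U (\<lambda>x. frechet_derivative f (at x) v + frechet_derivative g (at x) v)" for v
      using Suc by simp
  qed
qed

lemma Ck_on_sum:
  assumes "open U" "finite I" "\<And>i. i \<in> I \<Longrightarrow> Ck_on k U (f i)"
  shows "Ck_on k U (\<lambda>x. \<Sum>i\<in>I. f i x)"
  using assms(2,3) by (induction I rule: finite_induct) (auto intro: Ck_on_add Ck_on_const assms(1))

lemma (in bounded_bilinear) Ck_on:
  assumes "open U" "Ck_on k U f" "Ck_on k U g"
  shows "Ck_on k U (\<lambda>x. prod (f x) (g x))"
  using assms(2,3)
proof (induction k arbitrary: f g)
  case 0
  then show ?case by (simp add: continuous_on)
next
  case (Suc k)
  have "Ck_on k U (\<lambda>x. prod (f x) (frechet_derivative g (at x) v) + prod (frechet_derivative f (at x) v) (g x))" for v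
    using Suc.prems by (intro Ck_on_add Suc.IH assms(1)) (auto intro: Ck_on_pred)
  moreover have "((\<lambda>x. prod (f x) (g x)) has_derivative
      (\<lambda>v. prod (f x) (frechet_derivative g (at x) v) + prod (frechet_derivative f (at x) v) (g x))) (at x)"
    if "x \<in> U" for x
    using FDERIV[OF Ck_on_SucD[OF assms(1) Suc.prems(1) that] Ck_on_SucD[OF assms(1) Suc.prems(2) that]] .
  ultimately show ?case
    by (rule Ck_on_SucI[OF assms(1), rotated])
qed

lemma Ck_on_compose:
  fixes h :: "'a::euclidean_space \<Rightarrow> 'b::euclidean_space"
    and f :: "'b \<Rightarrow> 'c::real_normed_vector"
  assumes "open U" "open V" "h ` U \<subseteq> V" "Ck_on k U h" "Ck_on k V f"
  shows "Ck_on k U (\<lambda>x. f (h x))"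
  using assms(4,5)
proof (induction k arbitrary: f)
  case 0
  then show ?case using assms(3) by (auto intro: continuous_on_compose2)
next
  case (Suc k)
  \<comment> \<open>Expanding the inner derivative in the basis turns the chain rule into a sum of
    products with fixed directions, and only for fixed directions does the induction hypothesis
    apply to the derivative of \<open>f\<close>.\<close>
  let ?D = "\<lambda>x v. \<Sum>b\<in>Basis. (frechet_derivative h (at x) v \<bullet> b) *\<^sub>R frechet_derivative f (at (h x)) b"
  show ?case
  proof (rule Ck_on_SucI[OF assms(1), where f' = ?D])
    fix x assume x: "x \<in> U"
    then have hx: "h x \<in> V" using assms(3) by auto
    have dh: "(h has_derivative frechet_derivative h (at x)) (at x)"
      using Ck_on_SucD[OF assms(1) Suc.prems(1) x] .
    have df: "(f has_derivative frechet_derivative f (at (h x))) (at (h x))"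
      using Ck_on_SucD[OF assms(2) Suc.prems(2) hx] .
    have lin: "linear (frechet_derivative f (at (h x)))"
      using df by (rule has_derivative_linear)
    have eq: "frechet_derivative f (at (h x)) w = (\<Sum>b\<in>Basis. (w \<bullet> b) *\<^sub>R frechet_derivative f (at (h x)) b)" for w
      using linear_sum[OF lin, of "\<lambda>b. (w \<bullet> b) *\<^sub>R b" Basis]
      by (simp add: euclidean_representation linear_scale[OF lin])
    show "((\<lambda>x. f (h x)) has_derivative ?D x) (at x)"
      by (rule has_derivative_eq_rhs[OF has_derivative_compose[OF dh df] ext[OF eq]])
  next
    fix v
    have "Ck_on k U (\<lambda>x. frechet_derivative f (at (h x)) b)" for b
      using Suc.IH[OF Ck_on_pred[OF Suc.prems(1)], of "\<lambda>y. frechet_derivative f (at y) b"] Suc.prems(2) by simp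
    moreover have "Ck_on k U (\<lambda>x. frechet_derivative h (at x) v \<bullet> b)" for b
      using Suc.prems by (intro Ck_on_bounded_linear[OF assms(1) bounded_linear_inner_left]) auto
    ultimately show "Ck_on k U (\<lambda>x. ?D x v)"
      by (intro Ck_on_sum bounded_bilinear.Ck_on[OF bounded_bilinear_scaleR] assms(1)) auto
  qed
qed

lemma Ck_on_inverse:
  fixes f :: "'a::euclidean_space \<Rightarrow> 'b::real_normed_field"
  assumes "open U" "\<And>x. x \<in> U \<Longrightarrow> f x \<noteq> 0" "Ck_on k U f"
  shows "Ck_on k U (\<lambda>x. inverse (f x))"
  using assms(3)
proof (induction k)
  case 0
  then show ?case using assms(2) by (auto intro!: continuous_intros)
next
  case (Suc k)
  have i: "Ck_on k U (\<lambda>x. inverse (f x))"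
    using Suc Ck_on_pred by blast
  have "bounded_linear (\<lambda>y::'b. - y)" by (simp add: bounded_linear_minus)
  with i Suc.prems have "Ck_on k U (\<lambda>x. - (inverse (f x) * frechet_derivative f (at x) v * inverse (f x)))" for v
    by (intro Ck_on_bounded_linear[where L = uminus] bounded_bilinear.Ck_on[OF bounded_bilinear_mult] assms(1)) auto
  moreover have "((\<lambda>x. inverse (f x)) has_derivative
      (\<lambda>v. - (inverse (f x) * frechet_derivative f (at x) v * inverse (f x)))) (at x)" if "x \<in> U" for x
    using Deriv.has_derivative_inverse[OF assms(2)[OF that] Ck_on_SucD[OF assms(1) Suc.prems that]] .
  ultimately show ?case
    by (rule Ck_on_SucI[OF assms(1), rotated])
qed

text \<open>The regularity of \<open>g1\<close> may use that of \<open>g\<close> one order lower, so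
  a derivative that refers back to \<open>g\<close> is allowed: \<open>exp\<close> takes
  \<open>g1 = g\<close>, while \<open>ln\<close> takes for \<open>g1\<close> the reciprocal of
  \<open>f\<close>.\<close>

lemma Ck_on_field_chain:
  fixes f g :: "'a::euclidean_space \<Rightarrow> 'b::real_normed_field"
  assumes "open U" "continuous_on U g"
    "\<And>x f'. x \<in> U \<Longrightarrow> (f has_derivative f') (at x) \<Longrightarrow> (g has_derivative (\<lambda>v. g1 x * f' v)) (at x)"
    "\<And>k. Ck_on k U f \<Longrightarrow> Ck_on k U g \<Longrightarrow> Ck_on k U g1"
    "Ck_on k U f"
  shows "Ck_on k U g"
  using assms(5)
proof (induction k)
  case (Suc k)
  have "Ck_on k U g1" using Suc assms(4) Ck_on_pred by blast
  then have "Ck_on k U (\<lambda>x. g1 x * frechet_derivative f (at x) v)" for v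
    using Suc.prems by (intro bounded_bilinear.Ck_on[OF bounded_bilinear_mult] assms(1)) auto
  moreover have "(g has_derivative (\<lambda>v. g1 x * frechet_derivative f (at x) v)) (at x)" if "x \<in> U" for x
    using assms(3)[OF that Ck_on_SucD[OF assms(1) Suc.prems that]] .
  ultimately show ?case
    by (rule Ck_on_SucI[OF assms(1), rotated])
qed (use assms in auto)

section \<open>Closure properties of smooth functions\<close>

named_theorems smooth_intros

lemma smooth_on_cong:
  assumes "open U" "\<And>x. x \<in> U \<Longrightarrow> f x = g x"
  shows "smooth_on U f \<longleftrightarrow> smooth_on U g"
  using Ck_on_cong[OF assms] by (simp add: smooth_on_def)

lemma smooth_on_subset: "smooth_on U f \<Longrightarrow> V \<subseteq> U \<Longrightarrow> smooth_on V f"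
  unfolding smooth_on_def by (blast intro: Ck_on_subset)

lemma smooth_on_local:
  assumes "open U" "\<And>x. x \<in> U \<Longrightarrow> \<exists>V. open V \<and> x \<in> V \<and> smooth_on V f"
  shows "smooth_on U f"
  unfolding smooth_on_def using assms(2)
  by (intro allI Ck_on_local[OF assms(1)]) (metis smooth_on_def)

lemma smooth_on_has_derivative:
  assumes "open U" "smooth_on U f" "x \<in> U"
  shows "(f has_derivative frechet_derivative f (at x)) (at x)"
  using assms Ck_on_SucD unfolding smooth_on_def by blast

lemma smooth_on_differentiable:
  "open U \<Longrightarrow> smooth_on U f \<Longrightarrow> x \<in> U \<Longrightarrow> f differentiable (at x)"
  using smooth_on_has_derivative differentiable_def by blast

lemma smooth_on_continuous: "smooth_on U f \<Longrightarrow> continuous_on U f"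
  unfolding smooth_on_def by (metis Ck_on.simps(1))

lemma smooth_on_frechet_derivative [smooth_intros]:
  "smooth_on U f \<Longrightarrow> smooth_on U (\<lambda>x. frechet_derivative f (at x) v)"
  unfolding smooth_on_def by (metis Ck_on.simps(2))

text \<open>A class of differentiable functions closed under directional derivatives consists of
  smooth functions, by induction on the order. This suits families given by a formula, such as
  parametric integrals or polynomials times a flat exponential.\<close>

lemma smooth_on_coinduct:
  assumes "open U" "P f"
    "\<And>f. P f \<Longrightarrow> \<exists>f'. (\<forall>x\<in>U. (f has_derivative f' x) (at x)) \<and> (\<forall>v. P (\<lambda>x. f' x v))"
  shows "smooth_on U f"
proof -
  have "Ck_on k U f" for k
    using assms(2)
  proof (induction k arbitrary: f)
    case 0
    with assms(3)[OF 0] show ?case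
      using assms(1) by (auto simp: continuous_on_eq_continuous_at intro: has_derivative_continuous)
  next
    case (Suc k)
    with assms(3)[OF Suc.prems] show ?case
      by (blast intro: Ck_on_SucI[OF assms(1)])
  qed
  then show ?thesis by (simp add: smooth_on_def)
qed

lemma smooth_on_const [smooth_intros]: "open U \<Longrightarrow> smooth_on U (\<lambda>x. c)"
  by (simp add: smooth_on_def Ck_on_const)

lemma smooth_on_ident [smooth_intros]: "open U \<Longrightarrow> smooth_on U (\<lambda>x. x)"
  by (simp add: smooth_on_def Ck_on_ident)

lemma smooth_on_bounded_linear:
  "bounded_linear L \<Longrightarrow> open U \<Longrightarrow> smooth_on U f \<Longrightarrow> smooth_on U (\<lambda>x. L (f x))"
  by (simp add: smooth_on_def Ck_on_bounded_linear)

lemma smooth_on_add [smooth_intros]: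
  "open U \<Longrightarrow> smooth_on U f \<Longrightarrow> smooth_on U g \<Longrightarrow> smooth_on U (\<lambda>x. f x + g x)"
  by (simp add: smooth_on_def Ck_on_add)

lemma smooth_on_sum [smooth_intros]:
  "open U \<Longrightarrow> finite I \<Longrightarrow> (\<And>i. i \<in> I \<Longrightarrow> smooth_on U (f i)) \<Longrightarrow> smooth_on U (\<lambda>x. \<Sum>i\<in>I. f i x)"
  by (simp add: smooth_on_def Ck_on_sum)

lemma (in bounded_bilinear) smooth_on:
  "open U \<Longrightarrow> smooth_on U f \<Longrightarrow> smooth_on U g \<Longrightarrow> smooth_on U (\<lambda>x. prod (f x) (g x))"
  by (simp add: smooth_on_def Ck_on)

lemmas smooth_on_mult [smooth_intros] = bounded_bilinear.smooth_on[OF bounded_bilinear_mult]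
lemmas smooth_on_scaleR [smooth_intros] = bounded_bilinear.smooth_on[OF bounded_bilinear_scaleR]
lemmas smooth_on_inner [smooth_intros] = bounded_bilinear.smooth_on[OF bounded_bilinear_inner]
lemmas smooth_on_minus [smooth_intros] =
  smooth_on_bounded_linear[OF bounded_linear_minus[OF bounded_linear_ident]]
lemmas smooth_on_of_real [smooth_intros] = smooth_on_bounded_linear[OF bounded_linear_of_real]
lemmas smooth_on_Re [smooth_intros] = smooth_on_bounded_linear[OF bounded_linear_Re]
lemmas smooth_on_Im [smooth_intros] = smooth_on_bounded_linear[OF bounded_linear_Im]
lemmas smooth_on_fst [smooth_intros] = smooth_on_bounded_linear[OF bounded_linear_fst]
lemmas smooth_on_snd [smooth_intros] = smooth_on_bounded_linear[OF bounded_linear_snd]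
lemmas smooth_on_vec_nth [smooth_intros] = smooth_on_bounded_linear[OF bounded_linear_vec_nth]

lemma smooth_on_diff [smooth_intros]:
  "open U \<Longrightarrow> smooth_on U f \<Longrightarrow> smooth_on U g \<Longrightarrow> smooth_on U (\<lambda>x. f x - g x)"
  using smooth_on_add[of U f "\<lambda>x. - g x"] smooth_on_minus[of U g] by simp

lemma smooth_on_Pair [smooth_intros]:
  assumes "open U" "smooth_on U f" "smooth_on U g"
  shows "smooth_on U (\<lambda>x. (f x, g x))"
proof -
  have "smooth_on U (\<lambda>x. (f x, 0) + (0, g x))"
    by (intro smooth_on_add smooth_on_bounded_linear[where L = "\<lambda>y. (y, 0)"]
        smooth_on_bounded_linear[where L = "\<lambda>y. (0, y)"] assms
        bounded_linear_Pair bounded_linear_ident bounded_linear_zero)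
  then show ?thesis by simp
qed

lemma smooth_on_compose:
  fixes h :: "'a::euclidean_space \<Rightarrow> 'b::euclidean_space"
  shows "open U \<Longrightarrow> open V \<Longrightarrow> h ` U \<subseteq> V \<Longrightarrow> smooth_on U h \<Longrightarrow> smooth_on V f \<Longrightarrow>
    smooth_on U (\<lambda>x. f (h x))"
  unfolding smooth_on_def using Ck_on_compose by blast

lemma smooth_on_prod [smooth_intros]:
  fixes f :: "'i \<Rightarrow> 'a::euclidean_space \<Rightarrow> 'b::real_normed_field"
  assumes "open U" "finite I" "\<And>i. i \<in> I \<Longrightarrow> smooth_on U (f i)"
  shows "smooth_on U (\<lambda>x. \<Prod>i\<in>I. f i x)"
  using assms(2,3) by (induction I rule: finite_induct) (simp_all add: smooth_on_const smooth_on_mult assms(1))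

lemma smooth_on_power [smooth_intros]:
  fixes f :: "'a::euclidean_space \<Rightarrow> 'b::real_normed_field"
  shows "open U \<Longrightarrow> smooth_on U f \<Longrightarrow> smooth_on U (\<lambda>x. f x ^ n)"
  by (induction n) (simp_all add: smooth_on_const smooth_on_mult)

lemma smooth_on_inverse [smooth_intros]:
  fixes f :: "'a::euclidean_space \<Rightarrow> 'b::real_normed_field"
  shows "open U \<Longrightarrow> (\<And>x. x \<in> U \<Longrightarrow> f x \<noteq> 0) \<Longrightarrow> smooth_on U f \<Longrightarrow> smooth_on U (\<lambda>x. inverse (f x))"
  by (simp add: smooth_on_def Ck_on_inverse)

lemma smooth_on_divide [smooth_intros]:
  fixes f g :: "'a::euclidean_space \<Rightarrow> 'b::real_normed_field"
  shows "open U \<Longrightarrow> (\<And>x. x \<in> U \<Longrightarrow> g x \<noteq> 0) \<Longrightarrow> smooth_on U f \<Longrightarrow> smooth_on U g \<Longrightarrow>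
    smooth_on U (\<lambda>x. f x / g x)"
  unfolding divide_inverse by (intro smooth_on_mult smooth_on_inverse)

lemma smooth_on_powi [smooth_intros]:
  fixes f :: "'a::euclidean_space \<Rightarrow> 'b::real_normed_field"
  shows "open U \<Longrightarrow> (\<And>x. x \<in> U \<Longrightarrow> f x \<noteq> 0) \<Longrightarrow> smooth_on U f \<Longrightarrow> smooth_on U (\<lambda>x. f x powi n)"
  by (cases "n \<ge> 0") (simp_all add: power_int_def smooth_on_power smooth_on_inverse)

lemma smooth_on_exp [smooth_intros]:
  fixes f :: "'a::euclidean_space \<Rightarrow> 'b::{banach,real_normed_field}"
  assumes "open U" "smooth_on U f"
  shows "smooth_on U (\<lambda>x. exp (f x))"
proof -
  have "continuous_on U (\<lambda>x. exp (f x))"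
    using smooth_on_continuous[OF assms(2)] by (intro continuous_intros)
  moreover have "((\<lambda>x. exp (f x)) has_derivative (\<lambda>v. exp (f x) * f' v)) (at x)"
    if "(f has_derivative f') (at x)" for x f'
    using has_derivative_compose[OF that DERIV_exp[unfolded has_field_derivative_def]] .
  ultimately show ?thesis
    using Ck_on_field_chain[OF assms(1), of "\<lambda>x. exp (f x)" f "\<lambda>x. exp (f x)"] assms(2)
    unfolding smooth_on_def by blast
qed

lemma smooth_on_ln [smooth_intros]:
  fixes f :: "'a::euclidean_space \<Rightarrow> real"
  assumes "open U" "\<And>x. x \<in> U \<Longrightarrow> 0 < f x" "smooth_on U f"
  shows "smooth_on U (\<lambda>x. ln (f x))"
proof -
  have "continuous_on U (\<lambda>x. ln (f x))"
    using smooth_on_continuous[OF assms(3)] assms(2) by (intro continuous_intros) (auto dest: less_imp_neq[symmetric])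
  moreover have "((\<lambda>x. ln (f x)) has_derivative (\<lambda>v. inverse (f x) * f' v)) (at x)"
    if "x \<in> U" "(f has_derivative f') (at x)" for x f'
    using that assms(2) by (auto intro!: derivative_eq_intros)
  moreover have "Ck_on k U (\<lambda>x. inverse (f x))" for k
    using smooth_on_inverse[OF assms(1) _ assms(3)] assms(2) unfolding smooth_on_def by force
  ultimately show ?thesis
    using Ck_on_field_chain[OF assms(1), of "\<lambda>x. ln (f x)" f "\<lambda>x. inverse (f x)"] assms(3)
    unfolding smooth_on_def by blast
qed

lemma smooth_on_vec_lambda [smooth_intros]:
  fixes f :: "'i::finite \<Rightarrow> 'a::euclidean_space \<Rightarrow> complex"
  assumes "open U" "\<And>i. smooth_on U (f i)"
  shows "smooth_on U (\<lambda>x. \<chi> i. f i x)"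
proof -
  have "(\<chi> i. f i x) = (\<Sum>i\<in>UNIV. axis i (f i x))" for x
    by (simp add: vec_eq_iff axis_def)
  moreover have "bounded_linear (axis i :: complex \<Rightarrow> complex ^ 'i)" for i
    by (intro linear_conv_bounded_linear[THEN iffD1] linearI) (auto simp: axis_def vec_eq_iff)
  ultimately show ?thesis
    by (simp add: smooth_on_sum smooth_on_bounded_linear assms)
qed

lemma smooth_on_cis [smooth_intros]:
  "open U \<Longrightarrow> smooth_on U f \<Longrightarrow> smooth_on U (\<lambda>x. cis (f x))"
  unfolding cis_conv_exp by (intro smooth_intros)

lemma frechet_derivative_bounded_linear:
  assumes "bounded_linear L" "f differentiable (at x)"
  shows "frechet_derivative (\<lambda>x. L (f x)) (at x) v = L (frechet_derivative f (at x) v)"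
  using bounded_linear.has_derivative[OF assms(1) assms(2)[unfolded frechet_derivative_works]]
  by (simp add: frechet_derivative_at[symmetric])

lemma frechet_derivative_linear:
  "f differentiable (at x) \<Longrightarrow> linear (frechet_derivative f (at x))"
  by (simp add: linear_frechet_derivative)

lemma frechet_derivative_eqI: "(f has_derivative f') (at x) \<Longrightarrow> frechet_derivative f (at x) v = f' v"
  by (simp add: frechet_derivative_at[symmetric])

lemma frechet_derivative_add:
  assumes "f differentiable (at x)" "g differentiable (at x)"
  shows "frechet_derivative (\<lambda>x. f x + g x) (at x) v =
    frechet_derivative f (at x) v + frechet_derivative g (at x) v"
  by (intro frechet_derivative_eqI has_derivative_add)
     (use assms in \<open>simp_all add: frechet_derivative_works\<close>)

lemma frechet_derivative_cmult:
  fixes c :: complex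
  assumes "f differentiable (at x)"
  shows "frechet_derivative (\<lambda>x. c * f x) (at x) v = c * frechet_derivative f (at x) v"
  by (intro frechet_derivative_bounded_linear assms bounded_linear_mult_right)

lemma frechet_derivative_mult:
  fixes f g :: "'a::real_normed_vector \<Rightarrow> 'b::real_normed_algebra"
  assumes "f differentiable (at x)" "g differentiable (at x)"
  shows "frechet_derivative (\<lambda>x. f x * g x) (at x) v =
    f x * frechet_derivative g (at x) v + frechet_derivative f (at x) v * g x"
  by (intro frechet_derivative_eqI has_derivative_mult)
     (use assms in \<open>simp_all add: frechet_derivative_works\<close>)

lemma frechet_derivative_sum:
  assumes "\<And>i. i \<in> I \<Longrightarrow> f i differentiable (at x)"
  shows "frechet_derivative (\<lambda>x. \<Sum>i\<in>I. f i x) (at x) v = (\<Sum>i\<in>I. frechet_derivative (f i) (at x) v)"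
  by (intro frechet_derivative_eqI has_derivative_sum)
     (use assms in \<open>simp_all add: frechet_derivative_works\<close>)

text \<open>The left side is symmetric in \<open>u\<close> and \<open>v\<close> while the right side
  is not; this is what forces mixed derivatives to agree. The mean value theorem is applied to the
  difference along \<open>v\<close> as a function of the step along \<open>u\<close>, and then to
  the \<open>u\<close>-derivative along \<open>v\<close>.\<close>

lemma second_difference_mean_value:
  fixes f :: "'a::euclidean_space \<Rightarrow> real"
  assumes S: "open S" "smooth_on S f" and s: "0 < s"
    and box: "\<And>a b. 0 \<le> a \<Longrightarrow> a \<le> s \<Longrightarrow> 0 \<le> b \<Longrightarrow> b \<le> s \<Longrightarrow> x + a *\<^sub>R u + b *\<^sub>R v \<in> S"
  shows "\<exists>a b. 0 < a \<and> a < s \<and> 0 < b \<and> b < s \<and>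
    f (x + s *\<^sub>R u + s *\<^sub>R v) - f (x + s *\<^sub>R u) - f (x + s *\<^sub>R v) + f x =
    s * s * frechet_derivative (\<lambda>y. frechet_derivative f (at y) u) (at (x + a *\<^sub>R u + b *\<^sub>R v)) v"
proof -
  let ?u = "\<lambda>y. frechet_derivative f (at y) u"
  have D: "((\<lambda>a. g (p + a *\<^sub>R w)) has_real_derivative frechet_derivative g (at (p + a *\<^sub>R w)) w) (at a)"
    if "smooth_on S g" "p + a *\<^sub>R w \<in> S" for g :: "'a \<Rightarrow> real" and p w a
  proof -
    have "((\<lambda>a. p + a *\<^sub>R w) has_derivative (\<lambda>h. h *\<^sub>R w)) (at a)"
      by (auto intro!: derivative_eq_intros)
    from has_derivative_compose[OF this smooth_on_has_derivative[OF S(1) that]]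
    show ?thesis
      unfolding has_field_derivative_def
      using linear_scale[OF frechet_derivative_linear[OF smooth_on_differentiable[OF S(1) that]]]
      by (elim has_derivative_eq_rhs) (simp add: fun_eq_iff mult.commute)
  qed
  let ?g = "\<lambda>a. f ((x + s *\<^sub>R v) + a *\<^sub>R u) - f (x + a *\<^sub>R u)"
  have "\<exists>a. 0 < a \<and> a < s \<and> ?g s - ?g 0 = (s - 0) * (?u ((x + s *\<^sub>R v) + a *\<^sub>R u) - ?u (x + a *\<^sub>R u))"
  proof (rule MVT2[OF s])
    fix a assume a: "0 \<le> a" "a \<le> s"
    have "x + s *\<^sub>R v + a *\<^sub>R u \<in> S" "x + a *\<^sub>R u \<in> S"
      using box[of a s] box[of a 0] a s by (auto simp: algebra_simps)
    then show "(?g has_real_derivative ?u ((x + s *\<^sub>R v) + a *\<^sub>R u) - ?u (x + a *\<^sub>R u)) (at a)"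
      by (intro DERIV_diff D S(2))
  qed
  then obtain a where a: "0 < a" "a < s"
    "?g s - ?g 0 = s * (?u ((x + s *\<^sub>R v) + a *\<^sub>R u) - ?u (x + a *\<^sub>R u))" by auto
  have "\<exists>b. 0 < b \<and> b < s \<and> ?u ((x + a *\<^sub>R u) + s *\<^sub>R v) - ?u ((x + a *\<^sub>R u) + 0 *\<^sub>R v) =
     (s - 0) * frechet_derivative ?u (at ((x + a *\<^sub>R u) + b *\<^sub>R v)) v"
    by (rule MVT2[OF s]) (use a box in \<open>intro D smooth_on_frechet_derivative S(2); auto\<close>)
  then obtain b where b: "0 < b" "b < s" "?u ((x + a *\<^sub>R u) + s *\<^sub>R v) - ?u (x + a *\<^sub>R u) =
     s * frechet_derivative ?u (at ((x + a *\<^sub>R u) + b *\<^sub>R v)) v" by auto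
  have "(x + s *\<^sub>R v) + c *\<^sub>R u = (x + c *\<^sub>R u) + s *\<^sub>R v" for c by (simp add: algebra_simps)
  with a b show ?thesis
    by (intro exI[of _ a] exI[of _ b]) (simp add: algebra_simps)
qed

lemma second_derivative_symmetric_real:
  fixes f :: "'a::euclidean_space \<Rightarrow> real"
  assumes S: "open S" "smooth_on S f" "x \<in> S"
  shows "frechet_derivative (\<lambda>y. frechet_derivative f (at y) u) (at x) v =
    frechet_derivative (\<lambda>y. frechet_derivative f (at y) v) (at x) u"
proof (rule ccontr)
  let ?F = "\<lambda>u v y. frechet_derivative (\<lambda>y. frechet_derivative f (at y) u) (at y) v"
  assume neq: "?F u v x \<noteq> ?F v u x"
  define e where "e = \<bar>?F u v x - ?F v u x\<bar> / 2"
  have e: "e > 0" using neq by (simp add: e_def)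
  have "isCont (?F u v) x" "isCont (?F v u) x"
    using S by (auto intro!: continuous_on_interior smooth_on_continuous[of S] smooth_on_frechet_derivative
        simp: interior_open)
  with e obtain d1 d2 where d: "0 < d1" "0 < d2"
    "\<And>y. dist y x < d1 \<Longrightarrow> dist (?F u v y) (?F u v x) < e"
    "\<And>y. dist y x < d2 \<Longrightarrow> dist (?F v u y) (?F v u x) < e"
    unfolding continuous_at_eps_delta by metis
  obtain d3 where d3: "0 < d3" "ball x d3 \<subseteq> S"
    using S openE by blast
  define d where "d = min d1 (min d2 d3)"
  have d0: "0 < d" using d d3 by (simp add: d_def)
  \<comment> \<open>Steps of at most \<open>s\<close> along \<open>u\<close> and \<open>v\<close>
    stay within distance \<open>d\<close> of \<open>x\<close>. The summand \<open>1\<close> avoids a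
    division by zero when both vectors vanish.\<close>
  define s where "s = d / (2 * (norm u + norm v + 1))"
  have n: "0 < norm u + norm v + 1" by (simp add: add_nonneg_pos)
  have s: "0 < s" using d0 n by (simp add: s_def)
  have sm: "s * (norm u + norm v) < d"
  proof -
    have "s * (norm u + norm v) \<le> s * (norm u + norm v + 1)" using s by simp
    also have "\<dots> = d / 2" using n by (simp add: s_def field_simps)
    finally show ?thesis using d0 by simp
  qed
  have near: "dist (x + a *\<^sub>R u + b *\<^sub>R v) x < d"
    if "0 \<le> a" "a \<le> s" "0 \<le> b" "b \<le> s" for a b
  proof -
    have "dist (x + a *\<^sub>R u + b *\<^sub>R v) x = norm (a *\<^sub>R u + b *\<^sub>R v)"
      by (simp add: dist_norm algebra_simps)
    also have "\<dots> \<le> a * norm u + b * norm v"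
      using norm_triangle_ineq[of "a *\<^sub>R u" "b *\<^sub>R v"] that by simp
    also have "\<dots> \<le> s * norm u + s * norm v"
      using that by (intro add_mono mult_right_mono) auto
    finally show ?thesis using sm by (simp add: distrib_left)
  qed
  have box: "x + a *\<^sub>R u + b *\<^sub>R v \<in> S"
    if "0 \<le> a" "a \<le> s" "0 \<le> b" "b \<le> s" for a b
    using near[OF that] d3(2) by (auto simp: d_def dist_commute)
  have box': "x + a *\<^sub>R v + b *\<^sub>R u \<in> S"
    if "0 \<le> a" "a \<le> s" "0 \<le> b" "b \<le> s" for a b
    using box[of b a] that by (simp add: ac_simps)
  obtain a b where ab: "0 < a" "a < s" "0 < b" "b < s"
    "f (x + s *\<^sub>R u + s *\<^sub>R v) - f (x + s *\<^sub>R u) - f (x + s *\<^sub>R v) + f x = s * s * ?F u v (x + a *\<^sub>R u + b *\<^sub>R v)"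
    using second_difference_mean_value[OF S(1,2) s box] by blast
  obtain a' b' where ab': "0 < a'" "a' < s" "0 < b'" "b' < s"
    "f (x + s *\<^sub>R v + s *\<^sub>R u) - f (x + s *\<^sub>R v) - f (x + s *\<^sub>R u) + f x = s * s * ?F v u (x + a' *\<^sub>R v + b' *\<^sub>R u)"
    using second_difference_mean_value[OF S(1,2) s box'] by blast
  \<comment> \<open>One second difference, evaluated in both orders. Each mixed derivative is within
    \<open>e\<close> of its value at \<open>x\<close>, and \<open>e\<close> is half of the supposed
    gap.\<close>
  have "s * s * ?F u v (x + a *\<^sub>R u + b *\<^sub>R v) = s * s * ?F v u (x + a' *\<^sub>R v + b' *\<^sub>R u)"
    unfolding ab(5)[symmetric] ab'(5)[symmetric] by (simp add: algebra_simps)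
  then have eq: "?F u v (x + a *\<^sub>R u + b *\<^sub>R v) = ?F v u (x + b' *\<^sub>R u + a' *\<^sub>R v)"
    using s by (simp add: algebra_simps)
  have "dist (?F u v (x + a *\<^sub>R u + b *\<^sub>R v)) (?F u v x) < e"
    using near[of a b] ab by (intro d) (auto simp: d_def)
  moreover have "dist (?F v u (x + b' *\<^sub>R u + a' *\<^sub>R v)) (?F v u x) < e"
    using near[of b' a'] ab' by (intro d) (auto simp: d_def)
  ultimately have "\<bar>?F u v x - ?F v u x\<bar> < 2 * e"
    unfolding eq dist_real_def by arith
  then show False by (simp add: e_def)
qed

lemma second_derivative_symmetric:
  fixes f :: "'a::euclidean_space \<Rightarrow> 'b::euclidean_space"
  assumes S: "open S" "smooth_on S f" "x \<in> S"
  shows "frechet_derivative (\<lambda>y. frechet_derivative f (at y) u) (at x) v =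
    frechet_derivative (\<lambda>y. frechet_derivative f (at y) v) (at x) u"
proof (rule euclidean_eqI)
  fix b :: 'b assume "b \<in> Basis"
  have I: "bounded_linear (\<lambda>y. y \<bullet> b)" by (rule bounded_linear_inner_left)
  let ?g = "\<lambda>y. f y \<bullet> b"
  have D: "frechet_derivative (\<lambda>y. frechet_derivative f (at y) u) (at x) v \<bullet> b =
      frechet_derivative (\<lambda>y. frechet_derivative ?g (at y) u) (at x) v" for u v
  proof -
    have "frechet_derivative (\<lambda>y. frechet_derivative ?g (at y) u) (at x) =
        frechet_derivative (\<lambda>y. frechet_derivative f (at y) u \<bullet> b) (at x)"
      using S by (intro frechet_derivative_cong_open[OF S(1,3)] frechet_derivative_bounded_linear I
          smooth_on_differentiable)
    then show ?thesis
      using frechet_derivative_bounded_linear[OF I smooth_on_differentiable[OF S(1)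
          smooth_on_frechet_derivative[OF S(2)] S(3)]] by simp
  qed
  show "frechet_derivative (\<lambda>y. frechet_derivative f (at y) u) (at x) v \<bullet> b =
      frechet_derivative (\<lambda>y. frechet_derivative f (at y) v) (at x) u \<bullet> b"
    unfolding D using S by (intro second_derivative_symmetric_real[OF S(1) _ S(3)])
      (auto intro: smooth_on_bounded_linear I)
qed

section \<open>Exterior calculus on open sets\<close>

text \<open>Adjacent repetitions suffice: expanding at \<open>v + w\<close> in both slots gives the
  sign change under adjacent swaps, and swaps bring two distant equal arguments together.\<close>

lemma alt_multilinearI:
  assumes lin: "\<And>us ws. linear (\<lambda>v. a (us @ v # ws))"
    and alt: "\<And>us v ws. a (us @ v # v # ws) = 0"
  shows "alt_multilinear a"
proof -
  have swap: "a (us @ v # w # ws) = - a (us @ w # v # ws)" for us v w ws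
  proof -
    have 1: "a (us @ (x + y) # ws) = a (us @ x # ws) + a (us @ y # ws)" for us x y ws
      using linear_add[OF lin[of us ws]] by simp
    have 2: "a (us @ z # (x + y) # ws) = a (us @ z # x # ws) + a (us @ z # y # ws)" for us x y z ws
      using 1[of "us @ [z]" x y ws] by simp
    have "a (us @ v # w # ws) + a (us @ w # v # ws) = a (us @ (v + w) # (v + w) # ws)"
      by (simp only: 1 2) (simp add: alt)
    then show ?thesis
      by (simp add: alt eq_neg_iff_add_eq_0)
  qed
  have "a (us @ v # vs @ v # ws) = 0" for us v vs ws
  proof (induction vs arbitrary: us)
    case (Cons x vs)
    show ?case
      using swap[of us v x "vs @ v # ws"] Cons[of "us @ [x]"] by simp
  qed (simp add: alt)
  with lin show ?thesis by (simp add: alt_multilinear_def)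
qed

lemma alt_multilinear_linear: "alt_multilinear a \<Longrightarrow> linear (\<lambda>v. a (us @ v # ws))"
  by (simp add: alt_multilinear_def)

lemma alt_multilinear_repeat: "alt_multilinear a \<Longrightarrow> a (us @ v # v # ws) = 0"
  unfolding alt_multilinear_def by (metis append_Nil)

lemma alt_multilinear_linear_hd: "alt_multilinear a \<Longrightarrow> linear (\<lambda>v. a (v # ws))"
  using alt_multilinear_linear[of a "[]"] by simp

lemma alt_multilinear_repeat_hd: "alt_multilinear a \<Longrightarrow> a (v # v # ws) = 0"
  using alt_multilinear_repeat[of a "[]"] by simp

lemma alt_multilinear_contract: "alt_multilinear a \<Longrightarrow> alt_multilinear (\<lambda>vs. a (v # vs))"
  using alt_multilinear_linear[of a "v # us" for us] alt_multilinear_repeat[of a "v # us" for us]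
  by (intro alt_multilinearI) simp_all

lemma alt_multilinear_swap_hd:
  assumes "alt_multilinear a"
  shows "a (v # w # ws) = - a (w # v # ws)"
proof -
  have 1: "a ((x + y) # ws) = a (x # ws) + a (y # ws)" for x y ws
    using linear_add[OF alt_multilinear_linear_hd[OF assms]] .
  have 2: "a (z # (x + y) # ws) = a (z # x # ws) + a (z # y # ws)" for x y z ws
    using linear_add[OF alt_multilinear_linear_hd[OF alt_multilinear_contract[OF assms]]] .
  have "a (v # w # ws) + a (w # v # ws) = a ((v + w) # (v + w) # ws)"
    by (simp only: 1 2) (simp add: alt_multilinear_repeat_hd[OF assms])
  then show ?thesis
    by (simp add: alt_multilinear_repeat_hd[OF assms] eq_neg_iff_add_eq_0)
qed

lemma alt_multilinear_map:
  assumes "alt_multilinear a" "linear L"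
  shows "alt_multilinear (\<lambda>vs. a (map L vs))"
  unfolding alt_multilinear_def
proof (intro conjI allI)
  fix us ws
  show "linear (\<lambda>v. a (map L (us @ v # ws)))"
    using linear_compose[OF assms(2) alt_multilinear_linear[OF assms(1), of "map L us" "map L ws"]]
    by (simp add: o_def)
qed (use assms(1) in \<open>simp add: alt_multilinear_def\<close>)

text \<open>The interior product with the constant vector field \<open>v\<close>.\<close>

definition contract :: "'a \<Rightarrow> 'a form \<Rightarrow> 'a form" where
  "contract v \<eta> = (\<lambda>x vs. \<eta> x (v # vs))"

text \<open>The degree involution. A form may mix degrees, so the sign in the graded Leibniz rule is
  not one scalar and has to act on each component.\<close>

definition parity :: "'a form \<Rightarrow> 'a form" where
  "parity \<eta> = (\<lambda>x vs. (-1) ^ length vs * \<eta> x vs)"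

text \<open>The Lie derivative along the constant vector field \<open>v\<close>.\<close>

definition dir_deriv :: "'a::euclidean_space \<Rightarrow> 'a form \<Rightarrow> 'a form" where
  "dir_deriv v \<eta> = (\<lambda>x vs. frechet_derivative (\<lambda>y. \<eta> y vs) (at x) v)"

section \<open>The wedge product, by recursion on the first argument\<close>

lemma wedge_Nil: "wedge \<alpha> \<beta> x [] = \<alpha> x [] * \<beta> x []"
  by (simp add: wedge_def shuffle_sign_def)

lemma Pow_lessThan_Suc:
  "Pow {..<Suc n} = (\<lambda>J. Suc ` J) ` Pow {..<n} \<union> (\<lambda>J. insert 0 (Suc ` J)) ` Pow {..<n}"
proof -
  have "Pow (Suc ` {..<n}) = (\<lambda>J. Suc ` J) ` Pow {..<n}"
    by (auto simp: subset_image_iff)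
  then show ?thesis
    by (simp only: lessThan_Suc_eq_insert_0 Pow_insert image_image)
qed

lemma shuffle_sign_insert_0:
  assumes "J \<subseteq> {..<n}"
  shows "shuffle_sign (Suc n) (insert 0 (Suc ` J)) = shuffle_sign n J"
proof -
  have "(i, j) \<in> {(i, j). i \<in> insert 0 (Suc ` J) \<and> j \<in> {..<Suc n} - insert 0 (Suc ` J) \<and> j < i} \<longleftrightarrow>
    (i, j) \<in> map_prod Suc Suc ` {(i, j). i \<in> J \<and> j \<in> {..<n} - J \<and> j < i}" for i j
    by (cases i; cases j) (auto simp: image_iff)
  then have "{(i, j). i \<in> insert 0 (Suc ` J) \<and> j \<in> {..<Suc n} - insert 0 (Suc ` J) \<and> j < i} =
    map_prod Suc Suc ` {(i, j). i \<in> J \<and> j \<in> {..<n} - J \<and> j < i}"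
    by (simp only: set_eq_iff split_paired_All simp_thms)
  moreover have "inj (map_prod Suc Suc)" by (simp add: prod.inj_map)
  ultimately show ?thesis
    by (simp add: shuffle_sign_def card_image inj_on_subset)
qed

text \<open>Position \<open>0\<close> goes to the second factor and lies below every position of the
  first, which creates \<open>card J\<close> new inversions.\<close>

lemma shuffle_sign_Suc_image:
  assumes "J \<subseteq> {..<n}"
  shows "shuffle_sign (Suc n) (Suc ` J) = (-1) ^ card J * shuffle_sign n J"
proof -
  let ?A = "{(i, j). i \<in> J \<and> j \<in> {..<n} - J \<and> j < i}"
  have fin: "finite J" using assms finite_subset by blast
  have "(i, j) \<in> {(i, j). i \<in> Suc ` J \<and> j \<in> {..<Suc n} - Suc ` J \<and> j < i} \<longleftrightarrow>
    (i, j) \<in> (\<lambda>i. (Suc i, 0)) ` J \<union> map_prod Suc Suc ` ?A" for i j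
    by (cases i; cases j) (auto simp: image_iff)
  then have "{(i, j). i \<in> Suc ` J \<and> j \<in> {..<Suc n} - Suc ` J \<and> j < i} =
    (\<lambda>i. (Suc i, 0)) ` J \<union> map_prod Suc Suc ` ?A"
    by (simp only: set_eq_iff split_paired_All simp_thms)
  moreover have "finite ?A"
    by (rule finite_subset[of _ "J \<times> {..<n}"]) (use fin in auto)
  moreover have "inj (map_prod Suc Suc)" by (simp add: prod.inj_map)
  ultimately have "card {(i, j). i \<in> Suc ` J \<and> j \<in> {..<Suc n} - Suc ` J \<and> j < i} = card J + card ?A"
    using fin by (simp add: card_Un_disjoint card_image inj_on_def disjoint_iff image_iff)
  then show ?thesis
    by (simp add: shuffle_sign_def power_add)
qed

lemma nths_Cons_Suc_image: "nths (v # vs) (Suc ` J) = nths vs J"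
  by (simp add: nths_Cons image_iff)

lemma nths_Cons_insert_0: "nths (v # vs) (insert 0 (Suc ` J)) = v # nths vs J"
  by (simp add: nths_Cons image_iff)

text \<open>The interior product is an antiderivation: shuffles are split by the factor that
  receives the first argument. Later inductions on argument lists use this recursion in place of the
  sum over subsets.\<close>

lemma wedge_Cons:
  "wedge \<alpha> \<beta> x (v # vs) = wedge (contract v \<alpha>) \<beta> x vs + wedge (parity \<alpha>) (contract v \<beta>) x vs"
proof -
  let ?n = "length vs"
  let ?F = "\<lambda>I. shuffle_sign (Suc ?n) I * \<alpha> x (nths (v # vs) I) * \<beta> x (nths (v # vs) ({..<Suc ?n} - I))"
  have c1: "{..<Suc ?n} - Suc ` J = insert 0 (Suc ` ({..<?n} - J))" for J
    by (auto simp: lessThan_Suc_eq_insert_0)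
  have c2: "{..<Suc ?n} - insert 0 (Suc ` J) = Suc ` ({..<?n} - J)" for J
    by (auto simp: lessThan_Suc_eq_insert_0)
  have i1: "inj_on (\<lambda>J. Suc ` J) (Pow {..<?n})"
    by (auto simp: inj_on_def inj_image_eq_iff)
  have i2: "inj_on (\<lambda>J. insert 0 (Suc ` J)) (Pow {..<?n})"
    by (intro inj_onI) (metis inj_Suc inj_image_eq_iff insert_ident nat.distinct(1) imageE)
  have "wedge \<alpha> \<beta> x (v # vs) = (\<Sum>I\<in>Pow {..<Suc ?n}. ?F I)"
    by (simp add: wedge_def)
  also have "\<dots> = (\<Sum>I\<in>(\<lambda>J. Suc ` J) ` Pow {..<?n}. ?F I) + (\<Sum>I\<in>(\<lambda>J. insert 0 (Suc ` J)) ` Pow {..<?n}. ?F I)"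
    unfolding Pow_lessThan_Suc by (intro sum.union_disjoint) auto
  also have "(\<Sum>I\<in>(\<lambda>J. insert 0 (Suc ` J)) ` Pow {..<?n}. ?F I) = wedge (contract v \<alpha>) \<beta> x vs"
    unfolding sum.reindex[OF i2] wedge_def o_def
    by (intro sum.cong refl)
       (simp add: c2 nths_Cons_insert_0 nths_Cons_Suc_image shuffle_sign_insert_0 contract_def)
  also have "(\<Sum>I\<in>(\<lambda>J. Suc ` J) ` Pow {..<?n}. ?F I) = wedge (parity \<alpha>) (contract v \<beta>) x vs"
    unfolding sum.reindex[OF i1] wedge_def o_def
  proof (intro sum.cong refl)
    fix J assume J: "J \<in> Pow {..<?n}"
    then have "length (nths vs J) = card J"
      by (auto simp: length_nths intro!: arg_cong[of _ _ card])
    with J show "?F (Suc ` J) = shuffle_sign ?n J * parity \<alpha> x (nths vs J) * contract v \<beta> x (nths vs ({..<?n} - J))"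
      by (simp add: c1 nths_Cons_insert_0 nths_Cons_Suc_image shuffle_sign_Suc_image contract_def parity_def)
  qed
  finally show ?thesis by (simp add: add.commute)
qed

lemma wedge_cong:
  "\<alpha> x = \<alpha>' x \<Longrightarrow> \<beta> x = \<beta>' x \<Longrightarrow> wedge \<alpha> \<beta> x vs = wedge \<alpha>' \<beta>' x vs"
  by (simp add: wedge_def)

lemma wedge_add_left:
  "wedge (\<lambda>x vs. \<alpha> x vs + \<alpha>' x vs) \<beta> x vs = wedge \<alpha> \<beta> x vs + wedge \<alpha>' \<beta> x vs"
  by (simp add: wedge_def algebra_simps sum.distrib)

lemma wedge_add_right:
  "wedge \<alpha> (\<lambda>x vs. \<beta> x vs + \<beta>' x vs) x vs = wedge \<alpha> \<beta> x vs + wedge \<alpha> \<beta>' x vs"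
  by (simp add: wedge_def algebra_simps sum.distrib)

lemma wedge_scale_left: "wedge (\<lambda>x vs. c x * \<alpha> x vs) \<beta> x vs = c x * wedge \<alpha> \<beta> x vs"
  by (simp add: wedge_def sum_distrib_left algebra_simps)

lemma wedge_scale_right: "wedge \<alpha> (\<lambda>x vs. c x * \<beta> x vs) x vs = c x * wedge \<alpha> \<beta> x vs"
  by (simp add: wedge_def sum_distrib_left algebra_simps)

lemma wedge_minus_left: "wedge (\<lambda>x vs. - \<alpha> x vs) \<beta> x vs = - wedge \<alpha> \<beta> x vs"
  using wedge_scale_left[of "\<lambda>x. -1"] by simp

lemma wedge_zero_left: "wedge (\<lambda>x vs. 0) \<beta> x vs = 0"
  by (simp add: wedge_def)

lemma wedge_zero_right: "wedge \<alpha> (\<lambda>x vs. 0) x vs = 0"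
  by (simp add: wedge_def)

lemma parity_parity: "parity (parity \<eta>) = \<eta>"
proof -
  have "(-1::complex) ^ n * (-1) ^ n = 1" for n
    by (simp flip: power_mult_distrib)
  then show ?thesis
    by (simp add: parity_def fun_eq_iff flip: mult.assoc)
qed

lemma contract_parity: "contract v (parity \<eta>) = (\<lambda>x vs. (-1) * parity (contract v \<eta>) x vs)"
  by (simp add: contract_def parity_def)

lemma alt_multilinear_parity: "alt_multilinear (\<eta> x) \<Longrightarrow> alt_multilinear (parity \<eta> x)"
proof (rule alt_multilinearI)
  assume a: "alt_multilinear (\<eta> x)"
  have m: "linear (\<lambda>z::complex. c * z)" for c
    by (simp add: bounded_linear.linear bounded_linear_mult_right)
  show "linear (\<lambda>v. parity \<eta> x (us @ v # ws))" for us ws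
    using linear_compose[OF alt_multilinear_linear[OF a] m[of "- ((-1) ^ (length us + length ws))"]] by (simp add: parity_def o_def)
  show "parity \<eta> x (us @ v # v # ws) = 0" for us v ws
    using alt_multilinear_repeat[OF a] by (simp add: parity_def)
qed

lemma wedge_linear:
  assumes "alt_multilinear (\<alpha> x)" "alt_multilinear (\<beta> x)"
  shows "linear (\<lambda>v. wedge \<alpha> \<beta> x (us @ v # ws))"
  using assms
proof (induction us arbitrary: \<alpha> \<beta>)
  case Nil
  have a: "contract (v + w) \<eta> x = (\<lambda>vs. contract v \<eta> x vs + contract w \<eta> x vs)"
      "contract (c *\<^sub>R v) \<eta> x = (\<lambda>vs. of_real c * contract v \<eta> x vs)"
    if "alt_multilinear (\<eta> x)" for v w c and \<eta> :: "'a form"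
    using linear_add[OF alt_multilinear_linear_hd[OF that]] linear_scale[OF alt_multilinear_linear_hd[OF that]]
    by (auto simp: contract_def fun_eq_iff scaleR_conv_of_real)
  show ?case
  proof (rule linearI)
    fix v w
    have "wedge (contract (v + w) \<alpha>) \<beta> x ws = wedge (contract v \<alpha>) \<beta> x ws + wedge (contract w \<alpha>) \<beta> x ws"
      "wedge (parity \<alpha>) (contract (v + w) \<beta>) x ws = wedge (parity \<alpha>) (contract v \<beta>) x ws + wedge (parity \<alpha>) (contract w \<beta>) x ws"
      unfolding wedge_add_left[symmetric] wedge_add_right[symmetric]
      by (rule wedge_cong; simp add: a Nil)+
    then show "wedge \<alpha> \<beta> x ([] @ (v + w) # ws) = wedge \<alpha> \<beta> x ([] @ v # ws) + wedge \<alpha> \<beta> x ([] @ w # ws)"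
      by (simp add: wedge_Cons)
  next
    fix c v
    have "wedge (contract (c *\<^sub>R v) \<alpha>) \<beta> x ws = of_real c * wedge (contract v \<alpha>) \<beta> x ws"
      unfolding wedge_scale_left[of "\<lambda>x. of_real c", symmetric] by (rule wedge_cong; simp add: a Nil)
    moreover have
      "wedge (parity \<alpha>) (contract (c *\<^sub>R v) \<beta>) x ws = of_real c * wedge (parity \<alpha>) (contract v \<beta>) x ws"
      unfolding wedge_scale_right[of _ "\<lambda>x. of_real c", symmetric] by (rule wedge_cong; simp add: a Nil)
    ultimately show "wedge \<alpha> \<beta> x ([] @ (c *\<^sub>R v) # ws) = c *\<^sub>R wedge \<alpha> \<beta> x ([] @ v # ws)"
      by (simp add: wedge_Cons scaleR_conv_of_real algebra_simps)
  qed
next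
  case (Cons u us)
  then show ?case
    by (auto simp: wedge_Cons contract_def intro!: linear_compose_add Cons.IH[unfolded contract_def]
        alt_multilinear_contract alt_multilinear_parity)
qed

lemma wedge_repeat:
  assumes "alt_multilinear (\<alpha> x)" "alt_multilinear (\<beta> x)"
  shows "wedge \<alpha> \<beta> x (us @ v # v # ws) = 0"
  using assms
proof (induction us arbitrary: \<alpha> \<beta>)
  case Nil
  \<comment> \<open>Contracting twice with \<open>v\<close> leaves four terms. The two pure ones
    repeat \<open>v\<close> inside one factor; the two mixed ones cancel because
    \<open>parity\<close> anticommutes with \<open>contract\<close>.\<close>
  have z: "contract v (contract v \<eta>) x = (\<lambda>vs. 0)" if "alt_multilinear (\<eta> x)" for \<eta> :: "'a form"
    using alt_multilinear_repeat_hd[OF that] by (simp add: contract_def)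
  have "wedge (contract v (contract v \<alpha>)) \<beta> x ws = wedge (\<lambda>x vs. 0) \<beta> x ws"
    "wedge \<alpha> (contract v (contract v \<beta>)) x ws = wedge \<alpha> (\<lambda>x vs. 0) x ws"
    by (rule wedge_cong; simp add: z Nil)+
  then show ?case
    by (simp add: wedge_Cons wedge_zero_left wedge_zero_right contract_parity parity_parity wedge_minus_left)
next
  case (Cons u us)
  then show ?case
    by (simp add: wedge_Cons contract_def alt_multilinear_contract alt_multilinear_parity)
qed

lemma alt_multilinear_wedge:
  "alt_multilinear (\<alpha> x) \<Longrightarrow> alt_multilinear (\<beta> x) \<Longrightarrow> alt_multilinear (wedge \<alpha> \<beta> x)"
  by (rule alt_multilinearI) (simp_all add: wedge_linear wedge_repeat)

section \<open>The exterior derivative on open sets\<close>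

lemma ambient_deriv_Nil [simp]: "ambient_deriv \<eta> x [] = 0"
  by (simp add: ambient_deriv_def)

text \<open>Cartan's formula for a constant field. It is the recursion behind the proofs that
  \<open>d\<close> preserves forms, squares to zero and obeys the Leibniz rule.\<close>

lemma ambient_deriv_Cons:
  "ambient_deriv \<eta> x (v # vs) = dir_deriv v \<eta> x vs - ambient_deriv (contract v \<eta>) x vs"
  by (simp add: ambient_deriv_def dir_deriv_def contract_def sum.lessThan_Suc_shift sum_negf del: sum.lessThan_Suc)

lemma ambient_deriv_cong:
  assumes "open S" "x \<in> S" "\<And>y. y \<in> S \<Longrightarrow> \<eta> y = \<zeta> y"
  shows "ambient_deriv \<eta> x = ambient_deriv \<zeta> x"
proof -
  have "frechet_derivative (\<lambda>y. \<eta> y us) (at x) = frechet_derivative (\<lambda>y. \<zeta> y us) (at x)" for us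
    using assms by (intro frechet_derivative_cong_open[OF assms(1,2)]) simp
  then show ?thesis by (simp add: ambient_deriv_def fun_eq_iff)
qed

lemma ambient_form_on_alt: "ambient_form_on S \<eta> \<Longrightarrow> x \<in> S \<Longrightarrow> alt_multilinear (\<eta> x)"
  by (simp add: ambient_form_on_def)

lemma ambient_form_on_smooth: "ambient_form_on S \<eta> \<Longrightarrow> smooth_on S (\<lambda>x. \<eta> x vs)"
  by (simp add: ambient_form_on_def)

lemma ambient_form_on_differentiable:
  "open S \<Longrightarrow> ambient_form_on S \<eta> \<Longrightarrow> x \<in> S \<Longrightarrow> (\<lambda>x. \<eta> x vs) differentiable (at x)"
  using smooth_on_differentiable ambient_form_on_smooth by blast

lemma ambient_form_on_cong:
  assumes "open S" "ambient_form_on S \<eta>" "\<And>x. x \<in> S \<Longrightarrow> \<zeta> x = \<eta> x"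
  shows "ambient_form_on S \<zeta>"
  unfolding ambient_form_on_def
proof (intro conjI ballI allI)
  show "smooth_on S (\<lambda>x. \<zeta> x vs)" for vs
    using smooth_on_cong[OF assms(1), of "\<lambda>x. \<zeta> x vs" "\<lambda>x. \<eta> x vs"] assms(2,3)
    by (simp add: ambient_form_on_def)
qed (use assms(2,3) in \<open>simp add: ambient_form_on_def\<close>)

lemma ambient_form_on_subset: "ambient_form_on S \<eta> \<Longrightarrow> T \<subseteq> S \<Longrightarrow> ambient_form_on T \<eta>"
  unfolding ambient_form_on_def using smooth_on_subset by blast

lemma ambient_form_on_local:
  assumes "open S" "\<And>x. x \<in> S \<Longrightarrow> \<exists>V. open V \<and> x \<in> V \<and> ambient_form_on V \<eta>"
  shows "ambient_form_on S \<eta>"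
  unfolding ambient_form_on_def
proof (intro conjI ballI allI)
  show "alt_multilinear (\<eta> x)" if "x \<in> S" for x
    using assms(2)[OF that] ambient_form_on_alt by blast
  show "smooth_on S (\<lambda>x. \<eta> x vs)" for vs
    using assms(2) ambient_form_on_smooth by (intro smooth_on_local[OF assms(1)]) blast
qed

lemma ambient_form_on_zero: "open S \<Longrightarrow> ambient_form_on S (\<lambda>x vs. 0)"
  by (simp add: ambient_form_on_def alt_multilinear_def smooth_on_const linear_iff)

lemma ambient_form_on_add:
  "open S \<Longrightarrow> ambient_form_on S \<eta> \<Longrightarrow> ambient_form_on S \<zeta> \<Longrightarrow> ambient_form_on S (\<lambda>x vs. \<eta> x vs + \<zeta> x vs)"
  by (simp add: ambient_form_on_def alt_multilinear_def smooth_on_add linear_compose_add)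

lemma ambient_form_on_mult:
  fixes w :: "'a::euclidean_space \<Rightarrow> complex"
  assumes "open S" "smooth_on S w" "ambient_form_on S \<eta>"
  shows "ambient_form_on S (\<lambda>x vs. w x * \<eta> x vs)"
  unfolding ambient_form_on_def
proof (intro conjI ballI allI)
  have m: "linear (\<lambda>z::complex. c * z)" for c
    by (simp add: bounded_linear.linear bounded_linear_mult_right)
  show "alt_multilinear (\<lambda>vs. w x * \<eta> x vs)" if "x \<in> S" for x
  proof (rule alt_multilinearI)
    show "linear (\<lambda>v. w x * \<eta> x (us @ v # ws))" for us ws
      using linear_compose[OF alt_multilinear_linear[OF ambient_form_on_alt[OF assms(3) that]] m[of "w x"]]
      by (simp add: o_def)
  qed (use alt_multilinear_repeat[OF ambient_form_on_alt[OF assms(3) that]] in simp)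
qed (use assms in \<open>auto simp: ambient_form_on_def intro!: smooth_on_mult\<close>)

lemma ambient_form_on_scale:
  "open S \<Longrightarrow> ambient_form_on S \<eta> \<Longrightarrow> ambient_form_on S (\<lambda>x vs. c * \<eta> x vs)"
  using ambient_form_on_mult[of S "\<lambda>x. c"] by (simp add: smooth_on_const)

lemma ambient_form_on_diff:
  "open S \<Longrightarrow> ambient_form_on S \<eta> \<Longrightarrow> ambient_form_on S \<zeta> \<Longrightarrow> ambient_form_on S (\<lambda>x vs. \<eta> x vs - \<zeta> x vs)"
  using ambient_form_on_add[of S \<eta> "\<lambda>x vs. -1 * \<zeta> x vs"] ambient_form_on_scale[of S \<zeta> "-1"] by simp

lemma ambient_form_on_contract: "ambient_form_on S \<eta> \<Longrightarrow> ambient_form_on S (contract v \<eta>)"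
  by (simp add: ambient_form_on_def contract_def alt_multilinear_contract)

lemma ambient_form_on_parity: "open S \<Longrightarrow> ambient_form_on S \<eta> \<Longrightarrow> ambient_form_on S (parity \<eta>)"
  unfolding ambient_form_on_def
  by (auto simp: alt_multilinear_parity) (simp add: parity_def smooth_on_mult smooth_on_const)

lemma ambient_form_on_wedge:
  assumes "open S" "ambient_form_on S \<alpha>" "ambient_form_on S \<beta>"
  shows "ambient_form_on S (wedge \<alpha> \<beta>)"
  unfolding ambient_form_on_def
proof (intro conjI ballI allI)
  show "smooth_on S (\<lambda>x. wedge \<alpha> \<beta> x vs)" for vs
    unfolding wedge_def using assms
    by (intro smooth_on_sum smooth_on_mult smooth_on_const ambient_form_on_smooth) auto
qed (use assms in \<open>auto intro: alt_multilinear_wedge ambient_form_on_alt\<close>)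

lemma ambient_form_on_dir_deriv:
  assumes S: "open S" and \<eta>: "ambient_form_on S \<eta>"
  shows "ambient_form_on S (dir_deriv v \<eta>)"
  unfolding ambient_form_on_def
proof (intro conjI ballI allI)
  fix x assume x: "x \<in> S"
  note d = ambient_form_on_differentiable[OF S \<eta> x]
  show "alt_multilinear (dir_deriv v \<eta> x)"
  proof (rule alt_multilinearI)
    fix us ws
    show "linear (\<lambda>w. dir_deriv v \<eta> x (us @ w # ws))"
    proof (rule linearI)
      fix a b
      have "frechet_derivative (\<lambda>y. \<eta> y (us @ (a + b) # ws)) (at x) =
          frechet_derivative (\<lambda>y. \<eta> y (us @ a # ws) + \<eta> y (us @ b # ws)) (at x)"
        using linear_add[OF alt_multilinear_linear[OF ambient_form_on_alt[OF \<eta>]]]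
        by (intro frechet_derivative_cong_open[OF S x])
      then show "dir_deriv v \<eta> x (us @ (a + b) # ws) = dir_deriv v \<eta> x (us @ a # ws) + dir_deriv v \<eta> x (us @ b # ws)"
        by (simp add: dir_deriv_def frechet_derivative_add d)
    next
      fix c a
      have "frechet_derivative (\<lambda>y. \<eta> y (us @ (c *\<^sub>R a) # ws)) (at x) =
          frechet_derivative (\<lambda>y. c *\<^sub>R \<eta> y (us @ a # ws)) (at x)"
        using linear_scale[OF alt_multilinear_linear[OF ambient_form_on_alt[OF \<eta>]]]
        by (intro frechet_derivative_cong_open[OF S x])
      then show "dir_deriv v \<eta> x (us @ (c *\<^sub>R a) # ws) = c *\<^sub>R dir_deriv v \<eta> x (us @ a # ws)"
        unfolding dir_deriv_def using frechet_derivative_bounded_linear[OF bounded_linear_scaleR_right d]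
        by simp
    qed
  next
    fix us w ws
    have "frechet_derivative (\<lambda>y. \<eta> y (us @ w # w # ws)) (at x) = frechet_derivative (\<lambda>y. 0) (at x)"
      using alt_multilinear_repeat[OF ambient_form_on_alt[OF \<eta>]]
      by (intro frechet_derivative_cong_open[OF S x])
    then show "dir_deriv v \<eta> x (us @ w # w # ws) = 0"
      by (simp add: dir_deriv_def)
  qed
next
  show "smooth_on S (\<lambda>x. dir_deriv v \<eta> x vs)" for vs
    unfolding dir_deriv_def by (intro smooth_on_frechet_derivative ambient_form_on_smooth \<eta>)
qed

lemma ambient_deriv_add:
  assumes "open S" "ambient_form_on S \<eta>" "ambient_form_on S \<zeta>" "x \<in> S"
  shows "ambient_deriv (\<lambda>x vs. \<eta> x vs + \<zeta> x vs) x vs = ambient_deriv \<eta> x vs + ambient_deriv \<zeta> x vs"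
  using ambient_form_on_differentiable[OF assms(1)] assms(2-4)
  by (simp add: ambient_deriv_def frechet_derivative_add distrib_left sum.distrib)

lemma ambient_deriv_scale:
  assumes "open S" "ambient_form_on S \<eta>" "x \<in> S"
  shows "ambient_deriv (\<lambda>x vs. c * \<eta> x vs) x vs = c * ambient_deriv \<eta> x vs"
  using ambient_form_on_differentiable[OF assms]
  by (simp add: ambient_deriv_def frechet_derivative_cmult sum_distrib_left mult.left_commute)

lemma ambient_deriv_diff:
  assumes "open S" "ambient_form_on S \<eta>" "ambient_form_on S \<zeta>" "x \<in> S"
  shows "ambient_deriv (\<lambda>x vs. \<eta> x vs - \<zeta> x vs) x vs = ambient_deriv \<eta> x vs - ambient_deriv \<zeta> x vs"
  using ambient_deriv_add[OF assms(1,2) ambient_form_on_scale[OF assms(1,3)] assms(4), of "-1"]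
    ambient_deriv_scale[OF assms(1,3,4), of "-1"] by simp

lemma ambient_deriv_parity:
  assumes "open S" "ambient_form_on S \<eta>" "x \<in> S"
  shows "ambient_deriv (parity \<eta>) x vs = - parity (ambient_deriv \<eta>) x vs"
proof -
  have p: "(-1) ^ (length vs - Suc 0) = (- ((-1) ^ length vs) :: complex)" if "i < length vs" for i
    using that by (cases vs) auto
  have "ambient_deriv (parity \<eta>) x vs = (\<Sum>i<length vs. (-1) ^ i * ((-1) ^ (length vs - Suc 0) *
      frechet_derivative (\<lambda>y. \<eta> y (take i vs @ drop (Suc i) vs)) (at x) (vs ! i)))"
    using ambient_form_on_differentiable[OF assms]
    by (auto simp: ambient_deriv_def parity_def frechet_derivative_cmult min_def intro!: sum.cong)
  then show ?thesis
    by (simp add: p sum_negf) (simp add: ambient_deriv_def parity_def sum_distrib_left mult.left_commute)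
qed

lemma ambient_form_on_ambient_deriv:
  assumes S: "open S" and \<eta>: "ambient_form_on S \<eta>"
  shows "ambient_form_on S (ambient_deriv \<eta>)"
  unfolding ambient_form_on_def
proof (intro conjI ballI allI)
  fix x assume x: "x \<in> S"
  have lin: "linear (\<lambda>v. ambient_deriv \<eta> x (us @ v # ws))" for us ws
    using \<eta>
  proof (induction us arbitrary: \<eta>)
    case Nil
    have "ambient_deriv (contract (a + b) \<eta>) x ws =
        ambient_deriv (contract a \<eta>) x ws + ambient_deriv (contract b \<eta>) x ws" for a b
      unfolding ambient_deriv_add[OF S ambient_form_on_contract[OF Nil] ambient_form_on_contract[OF Nil] x, symmetric]
      using linear_add[OF alt_multilinear_linear_hd[OF ambient_form_on_alt[OF Nil]]]
      by (intro fun_cong[OF ambient_deriv_cong[OF S x]]) (simp add: contract_def)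
    moreover have "ambient_deriv (contract (c *\<^sub>R a) \<eta>) x ws = c *\<^sub>R ambient_deriv (contract a \<eta>) x ws" for c a
      unfolding scaleR_conv_of_real ambient_deriv_scale[OF S ambient_form_on_contract[OF Nil] x, symmetric]
      using linear_scale[OF alt_multilinear_linear_hd[OF ambient_form_on_alt[OF Nil]]]
      by (intro fun_cong[OF ambient_deriv_cong[OF S x]]) (simp add: contract_def scaleR_conv_of_real)
    ultimately have "linear (\<lambda>v. ambient_deriv (contract v \<eta>) x ws)"
      by (rule linearI)
    moreover have "linear (\<lambda>v. dir_deriv v \<eta> x ws)"
      unfolding dir_deriv_def
      by (intro frechet_derivative_linear ambient_form_on_differentiable[OF S Nil x])
    ultimately show ?case
      by (simp add: ambient_deriv_Cons linear_compose_sub)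
  next
    case (Cons u us)
    show ?case
      using linear_compose_sub[OF
          alt_multilinear_linear[OF ambient_form_on_alt[OF ambient_form_on_dir_deriv[OF S Cons.prems] x]]
          Cons.IH[OF ambient_form_on_contract[OF Cons.prems]]]
      by (simp add: ambient_deriv_Cons)
  qed
  have alt: "ambient_deriv \<eta> x (us @ v # v # ws) = 0" for us v ws
    using \<eta>
  proof (induction us arbitrary: \<eta>)
    case Nil
    have "ambient_deriv (contract v (contract v \<eta>)) x ws = ambient_deriv (\<lambda>x vs. 0) x ws"
      using alt_multilinear_repeat_hd[OF ambient_form_on_alt[OF Nil]]
      by (intro fun_cong[OF ambient_deriv_cong[OF S x]]) (simp add: contract_def)
    moreover have "ambient_deriv (\<lambda>x vs. 0 :: complex) x ws = 0" by (simp add: ambient_deriv_def)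
    ultimately show ?case
      by (simp add: ambient_deriv_Cons dir_deriv_def contract_def)
  next
    case (Cons u us)
    then show ?case
      using alt_multilinear_repeat[OF ambient_form_on_alt[OF ambient_form_on_dir_deriv[OF S Cons.prems] x]]
      by (simp add: ambient_deriv_Cons ambient_form_on_contract)
  qed
  show "alt_multilinear (ambient_deriv \<eta> x)"
    using lin alt by (rule alt_multilinearI)
next
  show "smooth_on S (\<lambda>x. ambient_deriv \<eta> x vs)" for vs
    unfolding ambient_deriv_def using assms
    by (intro smooth_on_sum smooth_on_mult smooth_on_const smooth_on_frechet_derivative ambient_form_on_smooth) auto
qed

text \<open>The analytic input to \<open>d d = 0\<close>: second derivatives are symmetric.\<close>

lemma dir_deriv_ambient_deriv:
  assumes S: "open S" and \<eta>: "ambient_form_on S \<eta>" and x: "x \<in> S"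
  shows "dir_deriv v (ambient_deriv \<eta>) x vs = ambient_deriv (dir_deriv v \<eta>) x vs"
proof -
  have d: "(\<lambda>y. frechet_derivative (\<lambda>y. \<eta> y us) (at y) u) differentiable (at x)" for us u
    by (intro smooth_on_differentiable[OF S _ x] smooth_on_frechet_derivative ambient_form_on_smooth \<eta>)
  show ?thesis
    unfolding dir_deriv_def ambient_deriv_def
    using second_derivative_symmetric[OF S ambient_form_on_smooth[OF \<eta>] x]
    by (simp add: frechet_derivative_sum frechet_derivative_cmult d)
qed

text \<open>By Cartan's formula, contracting \<open>d d \<eta>\<close> with \<open>v\<close> gives
  the commutator of the Lie derivative with \<open>d\<close>, which vanishes, plus
  \<open>d d\<close> of the contracted form, evaluated on one argument less.\<close>

theorem ambient_deriv_ambient_deriv: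
  assumes S: "open S" and "ambient_form_on S \<eta>" and x: "x \<in> S"
  shows "ambient_deriv (ambient_deriv \<eta>) x vs = 0"
  using assms(2)
proof (induction vs arbitrary: \<eta>)
  case (Cons v vs)
  note \<eta> = Cons.prems
  have "ambient_deriv (contract v (ambient_deriv \<eta>)) x vs =
      ambient_deriv (\<lambda>x vs. dir_deriv v \<eta> x vs - ambient_deriv (contract v \<eta>) x vs) x vs"
    by (intro fun_cong[OF ambient_deriv_cong[OF S x]]) (simp add: contract_def[of v "ambient_deriv \<eta>"] ambient_deriv_Cons)
  also have "\<dots> = ambient_deriv (dir_deriv v \<eta>) x vs"
    using Cons.IH[OF ambient_form_on_contract[OF \<eta>]]
    by (simp add: ambient_deriv_diff[OF S _ _ x] ambient_form_on_dir_deriv ambient_form_on_ambient_deriv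
        ambient_form_on_contract S \<eta>)
  finally show ?case
    by (simp add: ambient_deriv_Cons[of "ambient_deriv \<eta>"] dir_deriv_ambient_deriv[OF S \<eta> x])
qed simp

lemma dir_deriv_wedge:
  assumes S: "open S" and "ambient_form_on S \<alpha>" "ambient_form_on S \<beta>" and x: "x \<in> S"
  shows "dir_deriv v (wedge \<alpha> \<beta>) x vs = wedge (dir_deriv v \<alpha>) \<beta> x vs + wedge \<alpha> (dir_deriv v \<beta>) x vs"
proof -
  note d = ambient_form_on_differentiable[OF S _ x]
  have "frechet_derivative (\<lambda>x. c * \<alpha> x us * \<beta> x ws) (at x) v =
      c * frechet_derivative (\<lambda>x. \<alpha> x us) (at x) v * \<beta> x ws + c * \<alpha> x us * frechet_derivative (\<lambda>x. \<beta> x ws) (at x) v"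
    for c us ws
    using d[OF assms(2), of us] d[OF assms(3), of ws]
    by (simp add: mult.assoc frechet_derivative_cmult frechet_derivative_mult algebra_simps)
  moreover have "(\<lambda>x. c * \<alpha> x us * \<beta> x ws) differentiable (at x)" for c us ws
    using d[OF assms(2), of us] d[OF assms(3), of ws] by (intro derivative_intros) auto
  ultimately show ?thesis
    by (simp add: dir_deriv_def wedge_def frechet_derivative_sum sum.distrib)
qed

text \<open>Cartan's formula reduces both sides to the rule for the contracted factors; the signs
  match because \<open>parity\<close> anticommutes with \<open>d\<close> and with
  contraction.\<close>

theorem ambient_deriv_wedge:
  assumes S: "open S" and "ambient_form_on S \<alpha>" "ambient_form_on S \<beta>" and x: "x \<in> S"
  shows "ambient_deriv (wedge \<alpha> \<beta>) x vs =
    wedge (ambient_deriv \<alpha>) \<beta> x vs + wedge (parity \<alpha>) (ambient_deriv \<beta>) x vs"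
  using assms(2,3)
proof (induction vs arbitrary: \<alpha> \<beta>)
  case Nil
  show ?case by (simp add: wedge_Nil)
next
  case (Cons v vs)
  note \<alpha> = Cons.prems(1) and \<beta> = Cons.prems(2)
  note forms = ambient_form_on_contract ambient_form_on_parity ambient_form_on_wedge S \<alpha> \<beta>
  have "ambient_deriv (wedge \<alpha> \<beta>) x (v # vs) = wedge (dir_deriv v \<alpha>) \<beta> x vs + wedge \<alpha> (dir_deriv v \<beta>) x vs
      - ambient_deriv (\<lambda>x vs. wedge (contract v \<alpha>) \<beta> x vs + wedge (parity \<alpha>) (contract v \<beta>) x vs) x vs"
    by (simp add: ambient_deriv_Cons contract_def[of v "wedge \<alpha> \<beta>"] wedge_Cons dir_deriv_wedge[OF S \<alpha> \<beta> x])
  also have "\<dots> = wedge (dir_deriv v \<alpha>) \<beta> x vs + wedge \<alpha> (dir_deriv v \<beta>) x vs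
      - (wedge (ambient_deriv (contract v \<alpha>)) \<beta> x vs + wedge (parity (contract v \<alpha>)) (ambient_deriv \<beta>) x vs
      + (wedge (ambient_deriv (parity \<alpha>)) (contract v \<beta>) x vs + wedge \<alpha> (ambient_deriv (contract v \<beta>)) x vs))"
    by (simp add: ambient_deriv_add[OF S _ _ x] forms Cons.IH parity_parity)
  also have "wedge (ambient_deriv (parity \<alpha>)) (contract v \<beta>) x vs = - wedge (parity (ambient_deriv \<alpha>)) (contract v \<beta>) x vs"
    unfolding wedge_minus_left[symmetric]
    by (rule wedge_cong) (simp_all add: fun_eq_iff ambient_deriv_parity[OF S \<alpha> x])
  also have "wedge (dir_deriv v \<alpha>) \<beta> x vs = wedge (contract v (ambient_deriv \<alpha>)) \<beta> x vs + wedge (ambient_deriv (contract v \<alpha>)) \<beta> x vs"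
    unfolding wedge_add_left[symmetric]
    by (rule wedge_cong) (simp_all add: fun_eq_iff contract_def[of v "ambient_deriv \<alpha>"] ambient_deriv_Cons)
  also have "wedge \<alpha> (dir_deriv v \<beta>) x vs = wedge \<alpha> (contract v (ambient_deriv \<beta>)) x vs + wedge \<alpha> (ambient_deriv (contract v \<beta>)) x vs"
    unfolding wedge_add_right[symmetric]
    by (rule wedge_cong) (simp_all add: fun_eq_iff contract_def[of v "ambient_deriv \<beta>"] ambient_deriv_Cons)
  finally show ?case
    by (simp add: wedge_Cons parity_parity contract_parity wedge_minus_left)
qed

lemma wedge_zero_form:
  assumes "\<And>us. us \<noteq> [] \<Longrightarrow> \<alpha> x us = 0"
  shows "wedge \<alpha> \<beta> x vs = \<alpha> x [] * \<beta> x vs"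
proof (induction vs arbitrary: \<beta>)
  case (Cons v vs)
  have "wedge (contract v \<alpha>) \<beta> x vs = wedge (\<lambda>x vs. 0) \<beta> x vs"
    by (rule wedge_cong) (simp_all add: contract_def assms)
  moreover have "wedge (parity \<alpha>) (contract v \<beta>) x vs = wedge \<alpha> (contract v \<beta>) x vs"
    by (rule wedge_cong) (auto simp: parity_def fun_eq_iff intro: assms)
  ultimately show ?case
    using Cons[of "contract v \<beta>"] by (simp add: wedge_Cons wedge_zero_left) (simp add: contract_def)
qed (simp add: wedge_Nil)

lemma wedge_one_form:
  assumes "\<And>us. length us \<noteq> 1 \<Longrightarrow> \<kappa> x us = 0"
  shows "wedge \<kappa> \<beta> x vs = (\<Sum>i<length vs. (-1) ^ i * (\<kappa> x [vs ! i] * \<beta> x (take i vs @ drop (Suc i) vs)))"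
proof (induction vs arbitrary: \<beta>)
  case Nil
  then show ?case by (simp add: wedge_Nil assms)
next
  case (Cons v vs)
  have "wedge (contract v \<kappa>) \<beta> x vs = \<kappa> x [v] * \<beta> x vs"
    by (subst wedge_zero_form) (auto simp: contract_def intro: assms)
  moreover have "wedge (parity \<kappa>) (contract v \<beta>) x vs = wedge (\<lambda>x vs. - \<kappa> x vs) (contract v \<beta>) x vs"
  proof (rule wedge_cong)
    show "parity \<kappa> x = (\<lambda>us. - \<kappa> x us)"
    proof
      show "parity \<kappa> x us = - \<kappa> x us" for us
        by (cases "length us = 1") (simp_all add: parity_def assms)
    qed
  qed simp
  ultimately show ?case
    using Cons[of "contract v \<beta>"]
    by (simp add: wedge_Cons wedge_minus_left sum.lessThan_Suc_shift sum_negf del: sum.lessThan_Suc)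
       (simp add: contract_def)
qed

section \<open>Functions, differentials and logarithmic forms\<close>

definition zero_form :: "('a \<Rightarrow> complex) \<Rightarrow> 'a form" where
  "zero_form f = (\<lambda>x vs. if vs = [] then f x else 0)"

definition differential :: "('a::euclidean_space \<Rightarrow> complex) \<Rightarrow> 'a form" where
  "differential f = (\<lambda>x vs. if length vs = 1 then frechet_derivative f (at x) (vs ! 0) else 0)"

lemma ambient_form_on_zero_form: "open S \<Longrightarrow> smooth_on S f \<Longrightarrow> ambient_form_on S (zero_form f)"
  unfolding ambient_form_on_def
proof (intro conjI ballI allI)
  fix vs assume "open S" "smooth_on S f"
  then show "smooth_on S (\<lambda>x. zero_form f x vs)"
    by (cases "vs = []") (simp_all add: zero_form_def smooth_on_const)
qed (simp add: zero_form_def alt_multilinear_def linear_iff)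

lemma ambient_deriv_zero_form: "ambient_deriv (zero_form f) = differential f"
proof (intro ext)
  fix x and vs :: "'a list"
  consider "vs = []" | v where "vs = [v]" | "1 < length vs"
    by (cases vs; cases "tl vs") auto
  then show "ambient_deriv (zero_form f) x vs = differential f x vs"
  proof cases
    case 3
    have "zero_form f y (take i vs @ drop (Suc i) vs) = 0" if "i < length vs" for i y
      using 3 that by (auto simp: zero_form_def)
    with 3 show ?thesis by (simp add: ambient_deriv_def differential_def)
  qed (auto simp: ambient_deriv_def zero_form_def differential_def)
qed

lemma ambient_form_on_differential: "open S \<Longrightarrow> smooth_on S f \<Longrightarrow> ambient_form_on S (differential f)"
  using ambient_form_on_ambient_deriv[OF _ ambient_form_on_zero_form] by (simp add: ambient_deriv_zero_form)

lemma ambient_deriv_differential: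
  "open S \<Longrightarrow> smooth_on S f \<Longrightarrow> x \<in> S \<Longrightarrow> ambient_deriv (differential f) x vs = 0"
  using ambient_deriv_ambient_deriv[OF _ ambient_form_on_zero_form] by (simp add: ambient_deriv_zero_form)

lemma ambient_deriv_mult:
  assumes S: "open S" and w: "smooth_on S w" and \<eta>: "ambient_form_on S \<eta>" and x: "x \<in> S"
  shows "ambient_deriv (\<lambda>x vs. w x * \<eta> x vs) x vs = wedge (differential w) \<eta> x vs + w x * ambient_deriv \<eta> x vs"
proof -
  have e: "wedge (zero_form w) \<zeta> y us = w y * \<zeta> y us" for \<zeta> y us
    by (subst wedge_zero_form) (auto simp: zero_form_def)
  have "wedge (zero_form w) \<eta> = (\<lambda>x vs. w x * \<eta> x vs)"
    by (simp add: e fun_eq_iff)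
  moreover have "parity (zero_form w) = zero_form w"
    by (auto simp: parity_def zero_form_def fun_eq_iff)
  ultimately show ?thesis
    using ambient_deriv_wedge[OF S ambient_form_on_zero_form[OF S w] \<eta> x]
    by (simp add: e ambient_deriv_zero_form)
qed


text \<open>The form \<open>d log f\<close> without the normalisation outside a set that
  \<open>dlog\<close> carries, so that one form serves on every open set where \<open>f\<close> has
  no zero.\<close>

definition log_form :: "('a::euclidean_space \<Rightarrow> complex) \<Rightarrow> 'a form" where
  "log_form f = (\<lambda>x vs. inverse (f x) * differential f x vs)"

lemma ambient_form_on_log_form:
  "open S \<Longrightarrow> smooth_on S f \<Longrightarrow> (\<And>x. x \<in> S \<Longrightarrow> f x \<noteq> 0) \<Longrightarrow> ambient_form_on S (log_form f)"
  unfolding log_form_def by (intro ambient_form_on_mult ambient_form_on_differential smooth_on_inverse)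

lemma differential_length: "length us \<noteq> 1 \<Longrightarrow> differential f x us = 0"
  by (simp add: differential_def)

lemma wedge_differential_self: "wedge (differential f) (differential f) x vs = 0"
proof -
  consider "length vs \<noteq> 2" | u v where "vs = [u, v]"
    by (cases vs; cases "tl vs"; cases "tl (tl vs)") auto
  then show ?thesis
    by cases (subst wedge_one_form; auto simp: differential_def lessThan_Suc eval_nat_numeral intro!: sum.neutral)+
qed

lemma ambient_deriv_log_form:
  assumes S: "open S" and f: "smooth_on S f" "\<And>x. x \<in> S \<Longrightarrow> f x \<noteq> 0" and x: "x \<in> S"
  shows "ambient_deriv (log_form f) x vs = 0"
proof -
  have "frechet_derivative (\<lambda>x. inverse (f x)) (at x) v = - (inverse (f x) * inverse (f x)) * frechet_derivative f (at x) v" for v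
    using Deriv.has_derivative_inverse[OF f(2)[OF x] smooth_on_has_derivative[OF S f(1) x]]
    by (simp add: frechet_derivative_eqI mult_ac)
  \<comment> \<open>A wedge product depends only on the values at \<open>x\<close>, so the
    coefficient may be frozen there; what remains is a multiple of \<open>df\<close> wedge
    \<open>df\<close>.\<close>
  then have "wedge (differential (\<lambda>x. inverse (f x))) (differential f) x vs =
      wedge (\<lambda>y vs. - (inverse (f x) * inverse (f x)) * differential f y vs) (differential f) x vs"
    by (intro wedge_cong) (auto simp: differential_def fun_eq_iff)
  also have "\<dots> = 0"
    by (simp only: wedge_scale_left[of "\<lambda>y. - (inverse (f x) * inverse (f x))"] wedge_differential_self mult_zero_right)
  finally show ?thesis
    unfolding log_form_def
    by (simp add: ambient_deriv_mult[OF S smooth_on_inverse[OF S f(2,1)] ambient_form_on_differential[OF S f(1)] x]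
        ambient_deriv_differential[OF S f(1) x])
qed

section \<open>Pullback and homotopy\<close>

definition pullback :: "('a::euclidean_space \<Rightarrow> 'b::euclidean_space) \<Rightarrow> 'b form \<Rightarrow> 'a form" where
  "pullback h \<eta> = (\<lambda>x vs. \<eta> (h x) (map (frechet_derivative h (at x)) vs))"

lemma alt_multilinear_expand_hd:
  fixes a :: "'b::euclidean_space list \<Rightarrow> complex"
  assumes "alt_multilinear a"
  shows "a (w # ws) = (\<Sum>b\<in>Basis. of_real (w \<bullet> b) * a (b # ws))"
proof -
  note lin = alt_multilinear_linear_hd[OF assms, of ws]
  show ?thesis
    using linear_sum[OF lin, of "\<lambda>b. (w \<bullet> b) *\<^sub>R b" Basis]
    by (simp add: euclidean_representation linear_scale[OF lin] scaleR_conv_of_real)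
qed

text \<open>The vector arguments vary with the point too. Expanding the first one in the basis
  leaves forms contracted with constant vectors, which have one argument less.\<close>

lemma smooth_on_form_eval:
  fixes h :: "'a::euclidean_space \<Rightarrow> 'b::euclidean_space"
  assumes U: "open U" and V: "open V" and h: "h ` U \<subseteq> V" "smooth_on U h"
    and \<eta>: "ambient_form_on V \<eta>" and Ws: "\<And>W. W \<in> set Ws \<Longrightarrow> smooth_on U W"
  shows "smooth_on U (\<lambda>x. \<eta> (h x) (map (\<lambda>W. W x) Ws))"
  using \<eta> Ws
proof (induction Ws arbitrary: \<eta>)
  case Nil
  show ?case
    using smooth_on_compose[OF U V h ambient_form_on_smooth[OF Nil(1)]] by simp
next
  case (Cons W Ws)
  have "smooth_on U (\<lambda>x. \<Sum>b\<in>Basis. of_real (W x \<bullet> b) * contract b \<eta> (h x) (map (\<lambda>W. W x) Ws))"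
    using Cons.prems
    by (intro smooth_on_sum smooth_on_mult smooth_on_of_real smooth_on_inner smooth_on_const
        Cons.IH ambient_form_on_contract U) auto
  moreover have "\<eta> (h x) (map (\<lambda>W. W x) (W # Ws)) =
      (\<Sum>b\<in>Basis. of_real (W x \<bullet> b) * contract b \<eta> (h x) (map (\<lambda>W. W x) Ws))" if "x \<in> U" for x
    using alt_multilinear_expand_hd[OF ambient_form_on_alt[OF Cons.prems(1)], of "h x"] h(1) that
    by (auto simp: contract_def)
  ultimately show ?case
    using smooth_on_cong[OF U] by (metis (no_types, lifting))
qed

lemma ambient_form_on_pullback:
  assumes U: "open U" and V: "open V" and h: "h ` U \<subseteq> V" "smooth_on U h" and \<eta>: "ambient_form_on V \<eta>"
  shows "ambient_form_on U (pullback h \<eta>)"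
  unfolding ambient_form_on_def pullback_def
proof (intro conjI ballI allI)
  show "alt_multilinear (\<lambda>vs. \<eta> (h x) (map (frechet_derivative h (at x)) vs))" if "x \<in> U" for x
    using that h by (intro alt_multilinear_map ambient_form_on_alt[OF \<eta>] frechet_derivative_linear
        smooth_on_differentiable[OF U]) auto
  show "smooth_on U (\<lambda>x. \<eta> (h x) (map (frechet_derivative h (at x)) vs))" for vs
  proof -
    have "smooth_on U W" if "W \<in> set (map (\<lambda>v x. frechet_derivative h (at x) v) vs)" for W
      using that by (auto intro: smooth_on_frechet_derivative h(2))
    from smooth_on_form_eval[OF U V h \<eta>, of "map (\<lambda>v x. frechet_derivative h (at x) v) vs", OF this] show ?thesis by (simp add: o_def)
  qed
qed

text \<open>The sum over all positions \<open>j\<close> of the value of \<open>a\<close> on the first components with the \<open>j\<close>-th entry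
  exchanged for the \<open>j\<close>-th second component: what the product rule yields for the arguments of \<open>a\<close>.\<close>

fun replace_sum :: "('b list \<Rightarrow> complex) \<Rightarrow> ('b \<times> 'b) list \<Rightarrow> complex" where
  "replace_sum a [] = 0"
| "replace_sum a ((w, d) # ps) = a (d # map fst ps) + replace_sum (\<lambda>vs. a (w # vs)) ps"

lemma replace_sum_sum:
  "replace_sum (\<lambda>vs. \<Sum>b\<in>B. c b * a b vs) ps = (\<Sum>b\<in>B. c b * replace_sum (a b) ps)"
proof (induction ps arbitrary: a)
  case (Cons p ps)
  then show ?case
    by (cases p) (simp add: distrib_left sum.distrib)
qed simp

text \<open>The product rule, by the same basis expansion of the first argument: one term
  differentiates the coefficients along \<open>h\<close>, and each further term differentiates a
  single argument.\<close>

lemma has_derivative_form_eval: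
  fixes h :: "'a::euclidean_space \<Rightarrow> 'b::euclidean_space"
  assumes U: "open U" and V: "open V" and h: "h ` U \<subseteq> V" "smooth_on U h"
    and \<eta>: "ambient_form_on V \<eta>" and Ws: "\<And>W. W \<in> set Ws \<Longrightarrow> smooth_on U W" and x: "x \<in> U"
  shows "((\<lambda>y. \<eta> (h y) (map (\<lambda>W. W y) Ws)) has_derivative
    (\<lambda>u. dir_deriv (frechet_derivative h (at x) u) \<eta> (h x) (map (\<lambda>W. W x) Ws) +
      replace_sum (\<eta> (h x)) (map (\<lambda>W. (W x, frechet_derivative W (at x) u)) Ws))) (at x)"
  using \<eta> Ws
proof (induction Ws arbitrary: \<eta>)
  case Nil
  have hx: "h x \<in> V" using h x by auto
  show ?case
    using has_derivative_compose[OF smooth_on_has_derivative[OF U h(2) x]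
        smooth_on_has_derivative[OF V ambient_form_on_smooth[OF Nil(1)] hx]]
    by (simp add: dir_deriv_def)
next
  case (Cons W Ws)
  note \<eta> = Cons.prems(1)
  have hx: "h x \<in> V" using h x by auto
  let ?D = "\<lambda>\<eta> u. dir_deriv (frechet_derivative h (at x) u) \<eta> (h x) (map (\<lambda>W. W x) Ws)"
  let ?ps = "\<lambda>u. map (\<lambda>W. (W x, frechet_derivative W (at x) u)) Ws"
  let ?W' = "\<lambda>u. frechet_derivative W (at x) u"
  have dW: "(W has_derivative ?W') (at x)"
    using Cons.prems(2) by (intro smooth_on_has_derivative[OF U _ x]) auto
  have d: "((\<lambda>y. \<Sum>b\<in>Basis. of_real (W y \<bullet> b) * contract b \<eta> (h y) (map (\<lambda>W. W y) Ws)) has_derivative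
    (\<lambda>u. \<Sum>b\<in>Basis. of_real (W x \<bullet> b) * (?D (contract b \<eta>) u + replace_sum (contract b \<eta> (h x)) (?ps u)) +
      of_real (?W' u \<bullet> b) * contract b \<eta> (h x) (map (\<lambda>W. W x) Ws))) (at x)"
    using Cons.prems
    by (intro has_derivative_sum has_derivative_mult bounded_linear.has_derivative[OF bounded_linear_of_real]
        bounded_linear.has_derivative[OF bounded_linear_inner_left] dW Cons.IH ambient_form_on_contract) auto
  have eq: "\<eta> (h y) (map (\<lambda>W. W y) (W # Ws)) =
      (\<Sum>b\<in>Basis. of_real (W y \<bullet> b) * contract b \<eta> (h y) (map (\<lambda>W. W y) Ws))" if "y \<in> U" for y
    using alt_multilinear_expand_hd[OF ambient_form_on_alt[OF \<eta>], of "h y"] h(1) that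
    by (auto simp: contract_def)
  have e1: "dir_deriv w \<eta> (h x) (W x # us) = (\<Sum>b\<in>Basis. of_real (W x \<bullet> b) * dir_deriv w (contract b \<eta>) (h x) us)" for w us
    unfolding dir_deriv_def contract_def
    by (rule alt_multilinear_expand_hd[OF ambient_form_on_alt[OF ambient_form_on_dir_deriv[OF V \<eta>] hx], unfolded dir_deriv_def])
  have e2: "\<eta> (h x) (w # us) = (\<Sum>b\<in>Basis. of_real (w \<bullet> b) * contract b \<eta> (h x) us)" for w us
    unfolding contract_def by (rule alt_multilinear_expand_hd[OF ambient_form_on_alt[OF \<eta> hx]])
  have fst: "map fst (?ps u) = map (\<lambda>W. W x) Ws" for u by (simp add: o_def)
  have "dir_deriv (frechet_derivative h (at x) u) \<eta> (h x) (map (\<lambda>W. W x) (W # Ws)) +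
      replace_sum (\<eta> (h x)) (map (\<lambda>W. (W x, frechet_derivative W (at x) u)) (W # Ws)) =
    (\<Sum>b\<in>Basis. of_real (W x \<bullet> b) * (?D (contract b \<eta>) u + replace_sum (contract b \<eta> (h x)) (?ps u)) +
      of_real (?W' u \<bullet> b) * contract b \<eta> (h x) (map (\<lambda>W. W x) Ws))" for u
    by (simp add: fst e1 e2 replace_sum_sum sum.distrib distrib_left del: map_map)
  then show ?case
    using has_derivative_transform_within_open[OF d U x] eq by simp
qed

text \<open>Moving the exchanged entry from position \<open>i\<close> to the front costs
  \<open>i\<close> transpositions.\<close>

lemma replace_sum_omit:
  assumes "alt_multilinear a"
  shows "replace_sum a (map (\<lambda>u. (L u, b u)) vs) =
    (\<Sum>i<length vs. (-1) ^ i * a (b (vs ! i) # map L (take i vs @ drop (Suc i) vs)))"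
  using assms
proof (induction vs arbitrary: a)
  case (Cons v vs)
  have "replace_sum (\<lambda>us. a (L v # us)) (map (\<lambda>u. (L u, b u)) vs) =
    (\<Sum>i<length vs. (-1) ^ i * a (L v # b (vs ! i) # map L (take i vs @ drop (Suc i) vs)))"
    using Cons.IH[OF alt_multilinear_contract[OF Cons.prems]] .
  then show ?case
    by (simp add: alt_multilinear_swap_hd[OF Cons.prems, of "L v"] sum.lessThan_Suc_shift sum_negf o_def
        del: sum.lessThan_Suc)
qed simp

text \<open>With \<open>B\<close> the second derivative of a map, these are the terms that could
  keep \<open>d\<close> from commuting with pullback. They cancel in pairs: exchanging the two
  arguments fed to \<open>B\<close> preserves its value and flips the sign.\<close>

lemma replace_sum_symmetric_cancel:
  assumes "alt_multilinear a" and sym: "\<And>u v. B u v = B v u"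
  shows "(\<Sum>i<length vs. (-1) ^ i * replace_sum a (map (\<lambda>u. (L u, B (vs ! i) u)) (take i vs @ drop (Suc i) vs))) = 0"
  using assms(1)
proof (induction vs arbitrary: a)
  case (Cons v vs)
  have fst: "map fst (map (\<lambda>u. (L u, c u)) us) = map L us" for c :: "'b \<Rightarrow> 'a" and us
    by simp
  show ?case
    using Cons.IH[OF alt_multilinear_contract[OF Cons.prems]]
    by (simp add: sum.lessThan_Suc_shift replace_sum_omit[OF Cons.prems] sum_negf sum_subtractf distrib_left
        sum.distrib sym[of _ v] o_def del: sum.lessThan_Suc)
qed simp

theorem ambient_deriv_pullback:
  fixes h :: "'a::euclidean_space \<Rightarrow> 'b::euclidean_space"
  assumes U: "open U" and V: "open V" and h: "h ` U \<subseteq> V" "smooth_on U h"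
    and \<eta>: "ambient_form_on V \<eta>" and x: "x \<in> U"
  shows "ambient_deriv (pullback h \<eta>) x vs = pullback h (ambient_deriv \<eta>) x vs"
proof -
  let ?h = "frechet_derivative h (at x)"
  define B where "B = (\<lambda>v u. frechet_derivative (\<lambda>y. frechet_derivative h (at y) u) (at x) v)"
  have sym: "B u v = B v u" for u v
    unfolding B_def by (rule second_derivative_symmetric[OF U h(2) x])
  have hx: "h x \<in> V" using h x by auto
  have "frechet_derivative (\<lambda>y. pullback h \<eta> y us) (at x) v =
    dir_deriv (?h v) \<eta> (h x) (map ?h us) + replace_sum (\<eta> (h x)) (map (\<lambda>u. (?h u, B v u)) us)" for us v
    unfolding pullback_def B_def
  proof (rule frechet_derivative_eqI)
    have "smooth_on U W" if "W \<in> set (map (\<lambda>v x. frechet_derivative h (at x) v) us)" for W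
      using that by (auto intro: smooth_on_frechet_derivative h(2))
    from has_derivative_form_eval[OF U V h \<eta> _ x, of "map (\<lambda>v x. frechet_derivative h (at x) v) us", OF this]
    show "((\<lambda>y. \<eta> (h y) (map (frechet_derivative h (at y)) us)) has_derivative
        (\<lambda>v. dir_deriv (?h v) \<eta> (h x) (map ?h us) +
          replace_sum (\<eta> (h x)) (map (\<lambda>u. (?h u, frechet_derivative (\<lambda>y. frechet_derivative h (at y) u) (at x) v)) us))) (at x)"
      by (simp add: o_def)
  qed
  then have "ambient_deriv (pullback h \<eta>) x vs =
    (\<Sum>i<length vs. (-1) ^ i * dir_deriv (?h (vs ! i)) \<eta> (h x) (map ?h (take i vs @ drop (Suc i) vs))) +
    (\<Sum>i<length vs. (-1) ^ i * replace_sum (\<eta> (h x)) (map (\<lambda>u. (?h u, B (vs ! i) u)) (take i vs @ drop (Suc i) vs)))"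
    by (simp add: ambient_deriv_def distrib_left sum.distrib)
  also have "(\<Sum>i<length vs. (-1) ^ i * replace_sum (\<eta> (h x)) (map (\<lambda>u. (?h u, B (vs ! i) u)) (take i vs @ drop (Suc i) vs))) = 0"
    by (rule replace_sum_symmetric_cancel[OF ambient_form_on_alt[OF \<eta> hx] sym])
  also have "(\<Sum>i<length vs. (-1) ^ i * dir_deriv (?h (vs ! i)) \<eta> (h x) (map ?h (take i vs @ drop (Suc i) vs))) =
      pullback h (ambient_deriv \<eta>) x vs"
    by (auto simp: pullback_def ambient_deriv_def dir_deriv_def take_map drop_map intro!: sum.cong)
  finally show ?thesis by simp
qed

lemma pullback_ident: "pullback (\<lambda>x. x) \<eta> = \<eta>"
  by (simp add: pullback_def)

lemma pullback_cong:
  assumes "open U" "x \<in> U" "\<And>y. y \<in> U \<Longrightarrow> g y = h y"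
  shows "pullback g \<eta> x vs = pullback h \<eta> x vs"
  using frechet_derivative_cong_open[OF assms] assms by (simp add: pullback_def)

section \<open>Differentiation under the integral and integration along a fibre\<close>

lemma integrable_slice:
  fixes G :: "real \<times> 'a::euclidean_space \<Rightarrow> complex"
  assumes "{a..b} \<times> U \<subseteq> D" "smooth_on D G" "x \<in> U"
  shows "(\<lambda>t. G (t, x)) integrable_on {a..b}"
  using assms by (intro integrable_continuous_interval continuous_on_compose2[OF smooth_on_continuous[of D G]])
    (auto intro!: continuous_intros)

lemma has_derivative_parametric_integral:
  fixes G :: "real \<times> 'a::euclidean_space \<Rightarrow> complex"
  assumes D: "open D" "{a..b} \<times> U \<subseteq> D" and U: "open U" and G: "smooth_on D G" and x: "x \<in> U"
  shows "((\<lambda>x. integral {a..b} (\<lambda>t. G (t, x))) has_derivative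
    (\<lambda>v. integral {a..b} (\<lambda>t. frechet_derivative G (at (t, x)) (0, v)))) (at x)"
proof -
  obtain r where r: "0 < r" "ball x r \<subseteq> U" using U x openE by blast
  \<comment> \<open>The Leibniz rule wants the derivative as a continuous family of bounded linear
    maps. Continuity is known for fixed directions, so the map is assembled from its values on the
    basis.\<close>
  define G' where "G' = (\<lambda>y t. \<Sum>b\<in>(Basis :: 'a set).
    blinfun_compose (blinfun_scaleR_left (frechet_derivative G (at (t, y)) (0, b))) (blinfun_inner_left b))"
  have G'_apply: "blinfun_apply (G' y t) v = frechet_derivative G (at (t, y)) (0, v)" if "y \<in> U" "t \<in> {a..b}" for y t v
  proof -
    have "linear (frechet_derivative G (at (t, y)))"
      using that D by (intro frechet_derivative_linear smooth_on_differentiable[OF D(1) G]) auto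
    then have lin: "linear (\<lambda>v. frechet_derivative G (at (t, y)) (0, v))"
      using linear_compose[of "Pair 0" "frechet_derivative G (at (t, y))"] by (simp add: o_def linear_iff)
    have "blinfun_apply (G' y t) v = (\<Sum>b\<in>Basis. (v \<bullet> b) *\<^sub>R frechet_derivative G (at (t, y)) (0, b))"
      by (simp add: G'_def blinfun.sum_left)
    then show ?thesis
      using linear_sum[OF lin, of "\<lambda>b. (v \<bullet> b) *\<^sub>R b" Basis]
      by (simp add: euclidean_representation linear_scale[OF lin])
  qed
  have cont: "continuous_on (U \<times> {a..b}) (\<lambda>(y, t). G' y t)"
  proof -
    have "continuous_on (U \<times> {a..b}) (\<lambda>p. frechet_derivative G (at (snd p, fst p)) (0, c))" for c
    proof (rule continuous_on_compose2[OF smooth_on_continuous[OF smooth_on_frechet_derivative[OF G, of "(0, c)"]]])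
      show "continuous_on (U \<times> {a..b}) (\<lambda>p. (snd p, fst p))"
        by (intro continuous_intros)
    qed (use D in auto)
    then show ?thesis
      unfolding G'_def case_prod_beta
      by (intro continuous_on_sum bounded_bilinear.continuous_on[OF bounded_bilinear_blinfun_compose]
          bounded_linear.continuous_on[OF bounded_linear_blinfun_scaleR_left] continuous_on_const)
  qed
  have L: "((\<lambda>x. integral (cbox a b) (\<lambda>t. G (t, x))) has_derivative blinfun_apply (integral (cbox a b) (G' x))) (at x within ball x r)"
  proof (rule leibniz_rule)
    fix y t assume yt: "y \<in> ball x r" "t \<in> cbox a b"
    then have yt': "y \<in> U" "t \<in> {a..b}" using r by auto
    have "((\<lambda>y. (t, y)) has_derivative (\<lambda>v. (0, v))) (at y within ball x r)"
      by (auto intro!: derivative_eq_intros)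
    moreover have "(G has_derivative frechet_derivative G (at (t, y))) (at (t, y))"
      using yt' D by (intro smooth_on_has_derivative[OF D(1) G]) auto
    ultimately have "((\<lambda>y. G (t, y)) has_derivative (\<lambda>v. frechet_derivative G (at (t, y)) (0, v))) (at y within ball x r)"
      by (rule has_derivative_compose)
    then show "((\<lambda>y. G (t, y)) has_derivative blinfun_apply (G' y t)) (at y within ball x r)"
      by (rule has_derivative_eq_rhs) (simp add: G'_apply[OF yt'] fun_eq_iff)
  next
    fix y assume "y \<in> ball x r"
    then have "y \<in> U" using r by auto
    then show "(\<lambda>t. G (t, y)) integrable_on cbox a b"
      using integrable_slice[OF D(2) G] by simp
  next
    show "continuous_on (ball x r \<times> cbox a b) (\<lambda>(x, t). G' x t)"
      by (rule continuous_on_subset[OF cont]) (use r in auto)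
  qed (use r in auto)
  have A: "blinfun_apply (integral (cbox a b) (G' x)) v = integral {a..b} (\<lambda>t. frechet_derivative G (at (t, x)) (0, v))" for v
  proof -
    have "continuous_on {a..b} (G' x)"
      using continuous_on_compose2[OF cont, of "{a..b}" "\<lambda>t. (x, t)"] x
        continuous_on_Pair[OF continuous_on_const continuous_on_id, of "{a..b}" x] by auto
    then have "G' x integrable_on cbox a b" by (simp add: integrable_continuous_interval)
    then show ?thesis
      unfolding blinfun_apply_integral[OF \<open>G' x integrable_on cbox a b\<close>]
      by (simp only: cbox_interval) (intro integral_cong G'_apply x)
  qed
  have W: "at x within ball x r = at x"
    using r by (intro at_within_open) auto
  have "integral (cbox a b) f = integral {a..b} f" for f :: "real \<Rightarrow> complex"
    by simp
  with has_derivative_eq_rhs[OF L[unfolded W] ext[OF A]] show ?thesis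
    by (simp only:)
qed

lemma smooth_on_parametric_integral:
  fixes G :: "real \<times> 'a::euclidean_space \<Rightarrow> complex"
  assumes D: "open D" "{a..b} \<times> U \<subseteq> D" and U: "open U" and G: "smooth_on D G"
  shows "smooth_on U (\<lambda>x. integral {a..b} (\<lambda>t. G (t, x)))"
proof (rule smooth_on_coinduct[OF U, where P = "\<lambda>f. \<exists>G. smooth_on D G \<and> f = (\<lambda>x. integral {a..b} (\<lambda>t. G (t, x)))"])
  fix f :: "'a \<Rightarrow> complex" assume "\<exists>G. smooth_on D G \<and> f = (\<lambda>x. integral {a..b} (\<lambda>t. G (t, x)))"
  then obtain G where G: "smooth_on D G" "f = (\<lambda>x. integral {a..b} (\<lambda>t. G (t, x)))" by blast
  show "\<exists>f'. (\<forall>x\<in>U. (f has_derivative f' x) (at x)) \<and>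
      (\<forall>v. \<exists>G. smooth_on D G \<and> (\<lambda>x. f' x v) = (\<lambda>x. integral {a..b} (\<lambda>t. G (t, x))))"
    using has_derivative_parametric_integral[OF D U G(1)] smooth_on_frechet_derivative[OF G(1)]
    unfolding G(2)
    by (intro exI[of _ "\<lambda>x v. integral {a..b} (\<lambda>t. frechet_derivative G (at (t, x)) (0, v))"]) blast
qed (use G in blast)

lemma integral_form:
  fixes G :: "real \<times> 'a::euclidean_space \<Rightarrow> 'a list \<Rightarrow> complex"
  assumes D: "open D" "{a..b} \<times> U \<subseteq> D" and U: "open U"
    and G: "\<And>vs. smooth_on D (\<lambda>p. G p vs)" "\<And>p. p \<in> D \<Longrightarrow> alt_multilinear (G p)"
  shows "ambient_form_on U (\<lambda>x vs. integral {a..b} (\<lambda>t. G (t, x) vs))" (is ?form)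
    and "x \<in> U \<Longrightarrow> ambient_deriv (\<lambda>x vs. integral {a..b} (\<lambda>t. G (t, x) vs)) x vs =
      integral {a..b} (\<lambda>t. \<Sum>i<length vs. (-1) ^ i *
        frechet_derivative (\<lambda>p. G p (take i vs @ drop (Suc i) vs)) (at (t, x)) (0, vs ! i))"
proof -
  show ?form
    unfolding ambient_form_on_def
  proof (intro conjI ballI allI)
    fix x assume x: "x \<in> U"
    have i: "(\<lambda>t. G (t, x) vs) integrable_on {a..b}" for vs
      using integrable_slice[OF D(2) G(1) x] .
    have alt: "alt_multilinear (G (t, x))" if "t \<in> {a..b}" for t
      using D(2) x that by (intro G(2)) auto
    show "alt_multilinear (\<lambda>vs. integral {a..b} (\<lambda>t. G (t, x) vs))"
    proof (rule alt_multilinearI, rule linearI)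
      show "integral {a..b} (\<lambda>t. G (t, x) (us @ (v + w) # ws)) =
        integral {a..b} (\<lambda>t. G (t, x) (us @ v # ws)) + integral {a..b} (\<lambda>t. G (t, x) (us @ w # ws))" for us v w ws
        unfolding integral_add[OF i i, symmetric]
        using linear_add[OF alt_multilinear_linear[OF alt]] by (intro integral_cong) simp
      show "integral {a..b} (\<lambda>t. G (t, x) (us @ (c *\<^sub>R v) # ws)) =
        c *\<^sub>R integral {a..b} (\<lambda>t. G (t, x) (us @ v # ws))" for us c v ws
        unfolding integral_cmul[symmetric]
        using linear_scale[OF alt_multilinear_linear[OF alt]] by (intro integral_cong) simp
      show "integral {a..b} (\<lambda>t. G (t, x) (us @ v # v # ws)) = 0" for us v ws
      proof -
        have "integral {a..b} (\<lambda>t. G (t, x) (us @ v # v # ws)) = integral {a..b} (\<lambda>t. 0)"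
          using alt_multilinear_repeat[OF alt] by (intro integral_cong) simp
        then show ?thesis by simp
      qed
    qed
  qed (rule smooth_on_parametric_integral[OF D U G(1)])
next
  assume x: "x \<in> U"
  have i: "(\<lambda>t. frechet_derivative (\<lambda>p. G p us) (at (t, x)) w) integrable_on {a..b}" for us w
    using integrable_slice[OF D(2) smooth_on_frechet_derivative[OF G(1)] x] .
  have "frechet_derivative (\<lambda>x. integral {a..b} (\<lambda>t. G (t, x) us)) (at x) v =
      integral {a..b} (\<lambda>t. frechet_derivative (\<lambda>p. G p us) (at (t, x)) (0, v))" for us v
    by (rule frechet_derivative_eqI[OF has_derivative_parametric_integral[OF D U G(1) x]])
  then show "ambient_deriv (\<lambda>x vs. integral {a..b} (\<lambda>t. G (t, x) vs)) x vs =
      integral {a..b} (\<lambda>t. \<Sum>i<length vs. (-1) ^ i *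
        frechet_derivative (\<lambda>p. G p (take i vs @ drop (Suc i) vs)) (at (t, x)) (0, vs ! i))"
    by (simp add: ambient_deriv_def integral_sum i integrable_on_mult_right)
qed

text \<open>Lifting the arguments by \<open>Pair 0\<close> selects the part of
  \<open>\<Omega>\<close> without \<open>dt\<close>; the integral \<open>fiber_integral\<close>
  selects the part with \<open>dt\<close>, with that factor placed first.\<close>

definition fiber_average :: "real \<Rightarrow> real \<Rightarrow> (real \<times> 'a::euclidean_space) form \<Rightarrow> 'a form" where
  "fiber_average a b \<Omega> = (\<lambda>x vs. integral {a..b} (\<lambda>t. \<Omega> (t, x) (map (Pair 0) vs)))"

definition fiber_integral :: "real \<Rightarrow> real \<Rightarrow> (real \<times> 'a::euclidean_space) form \<Rightarrow> 'a form" where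
  "fiber_integral a b \<Omega> = fiber_average a b (contract (1, 0) \<Omega>)"

lemma linear_Pair_0: "linear (Pair 0)"
  by (simp add: linear_iff)

lemma
  assumes D: "open D" "{a..b} \<times> U \<subseteq> D" and U: "open U" and \<Omega>: "ambient_form_on D \<Omega>"
  shows ambient_form_on_fiber_average: "ambient_form_on U (fiber_average a b \<Omega>)"
    and ambient_deriv_fiber_average:
      "x \<in> U \<Longrightarrow> ambient_deriv (fiber_average a b \<Omega>) x vs = fiber_average a b (ambient_deriv \<Omega>) x vs"
proof -
  have 1: "smooth_on D (\<lambda>p. \<Omega> p (map (Pair 0) vs))" for vs
    by (rule ambient_form_on_smooth[OF \<Omega>])
  have 2: "alt_multilinear (\<lambda>vs. \<Omega> p (map (Pair 0) vs))" if "p \<in> D" for p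
    by (rule alt_multilinear_map[OF ambient_form_on_alt[OF \<Omega> that] linear_Pair_0])
  show "ambient_form_on U (fiber_average a b \<Omega>)"
    unfolding fiber_average_def
    by (rule integral_form(1)[where G = "\<lambda>p vs. \<Omega> p (map (Pair 0) vs)", OF D U 1 2])
  show "ambient_deriv (fiber_average a b \<Omega>) x vs = fiber_average a b (ambient_deriv \<Omega>) x vs" if "x \<in> U"
  proof -
    have "ambient_deriv (fiber_average a b \<Omega>) x vs = integral {a..b} (\<lambda>t. \<Sum>i<length vs. (-1) ^ i *
        frechet_derivative (\<lambda>p. \<Omega> p (map (Pair 0) (take i vs @ drop (Suc i) vs))) (at (t, x)) (0, vs ! i))"
      unfolding fiber_average_def
      by (rule integral_form(2)[where G = "\<lambda>p vs. \<Omega> p (map (Pair 0) vs)", OF D U 1 2 that])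
    then show ?thesis
      by (simp add: fiber_average_def ambient_deriv_def take_map drop_map)
  qed
qed

text \<open>Cartan's formula for the field \<open>(1, 0)\<close> along the fibre: its Lie derivative
  is the \<open>t\<close>-derivative, which integrates to the two boundary terms.\<close>

lemma
  assumes D: "open D" "{a..b} \<times> U \<subseteq> D" and U: "open U" and \<Omega>: "ambient_form_on D \<Omega>"
  shows ambient_form_on_fiber_integral: "ambient_form_on U (fiber_integral a b \<Omega>)"
    and ambient_deriv_fiber_integral:
      "x \<in> U \<Longrightarrow> a \<le> b \<Longrightarrow> ambient_deriv (fiber_integral a b \<Omega>) x vs =
        \<Omega> (b, x) (map (Pair 0) vs) - \<Omega> (a, x) (map (Pair 0) vs) - fiber_integral a b (ambient_deriv \<Omega>) x vs"
proof -
  note c = ambient_form_on_contract[OF \<Omega>]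
  show "ambient_form_on U (fiber_integral a b \<Omega>)"
    unfolding fiber_integral_def by (rule ambient_form_on_fiber_average[OF D U c])
  assume x: "x \<in> U" and ab: "a \<le> b"
  let ?us = "map (Pair 0) vs"
  have tx: "(t, x) \<in> D" if "t \<in> {a..b}" for t using D(2) x that by auto
  have "ambient_deriv (fiber_integral a b \<Omega>) x vs = integral {a..b} (\<lambda>t. ambient_deriv (contract (1, 0) \<Omega>) (t, x) ?us)"
    unfolding fiber_integral_def ambient_deriv_fiber_average[OF D U c x] by (simp add: fiber_average_def)
  also have "\<dots> = integral {a..b} (\<lambda>t. dir_deriv (1, 0) \<Omega> (t, x) ?us - ambient_deriv \<Omega> (t, x) ((1, 0) # ?us))"
    by (simp add: ambient_deriv_Cons)
  also have "\<dots> = integral {a..b} (\<lambda>t. dir_deriv (1, 0) \<Omega> (t, x) ?us)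
      - integral {a..b} (\<lambda>t. ambient_deriv \<Omega> (t, x) ((1, 0) # ?us))"
    by (intro integral_diff integrable_slice[OF D(2) ambient_form_on_smooth x]
        ambient_form_on_dir_deriv ambient_form_on_ambient_deriv D(1) \<Omega>)
  also have "integral {a..b} (\<lambda>t. dir_deriv (1, 0) \<Omega> (t, x) ?us) = \<Omega> (b, x) ?us - \<Omega> (a, x) ?us"
  proof (intro integral_unique fundamental_theorem_of_calculus ab)
    fix t assume t: "t \<in> {a..b}"
    have lin: "linear (frechet_derivative (\<lambda>p. \<Omega> p ?us) (at (t, x)))"
      using frechet_derivative_linear[OF ambient_form_on_differentiable[OF D(1) \<Omega> tx[OF t]]] .
    have "((\<lambda>t. (t, x)) has_derivative (\<lambda>s. (s, 0))) (at t within {a..b})"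
      by (auto intro!: derivative_eq_intros)
    from has_derivative_compose[OF this smooth_on_has_derivative[OF D(1) ambient_form_on_smooth[OF \<Omega>] tx[OF t]]]
    have "((\<lambda>t. \<Omega> (t, x) ?us) has_derivative (\<lambda>s. frechet_derivative (\<lambda>p. \<Omega> p ?us) (at (t, x)) (s, 0))) (at t within {a..b})" .
    moreover have "frechet_derivative (\<lambda>p. \<Omega> p ?us) (at (t, x)) (s, 0) = s *\<^sub>R dir_deriv (1, 0) \<Omega> (t, x) ?us" for s
      using linear_scale[OF lin, of s "(1, 0)"] by (simp add: dir_deriv_def)
    ultimately show "((\<lambda>t. \<Omega> (t, x) ?us) has_vector_derivative dir_deriv (1, 0) \<Omega> (t, x) ?us) (at t within {a..b})"
      by (simp add: has_vector_derivative_def)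
  qed
  finally show "ambient_deriv (fiber_integral a b \<Omega>) x vs =
      \<Omega> (b, x) ?us - \<Omega> (a, x) ?us - fiber_integral a b (ambient_deriv \<Omega>) x vs"
    by (simp add: fiber_integral_def fiber_average_def contract_def)
qed

lemma frechet_derivative_slice:
  assumes "H differentiable (at (t, x))"
  shows "frechet_derivative (\<lambda>x. H (t, x)) (at x) v = frechet_derivative H (at (t, x)) (0, v)"
proof (rule frechet_derivative_eqI)
  have "((\<lambda>y. (t, y)) has_derivative (\<lambda>v. (0, v))) (at x)"
    by (auto intro!: derivative_eq_intros)
  then show "((\<lambda>x. H (t, x)) has_derivative (\<lambda>v. frechet_derivative H (at (t, x)) (0, v))) (at x)"
    using assms by (intro has_derivative_compose[of "Pair t" _ x UNIV H]) (auto simp: frechet_derivative_works)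
qed

lemma pullback_slice:
  assumes "H differentiable (at (t, x))"
  shows "pullback H \<omega> (t, x) (map (Pair 0) vs) = pullback (\<lambda>x. H (t, x)) \<omega> x vs"
proof -
  have "frechet_derivative (\<lambda>x. H (t, x)) (at x) = (\<lambda>v. frechet_derivative H (at (t, x)) (0, v))"
    by (intro ext frechet_derivative_slice assms)
  then show ?thesis by (simp add: pullback_def o_def)
qed

text \<open>In contrast to membership in \<open>closed_forms\<close>, the values outside
  \<open>S\<close> are left free, so a form passes between open sets without being restricted each
  time.\<close>

definition closed_on :: "'a::euclidean_space set \<Rightarrow> 'a form \<Rightarrow> bool" where
  "closed_on S \<omega> \<longleftrightarrow> ambient_form_on S \<omega> \<and> (\<forall>x\<in>S. \<forall>vs. ambient_deriv \<omega> x vs = 0)"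

lemma closed_onD:
  "closed_on S \<omega> \<Longrightarrow> ambient_form_on S \<omega>"
  "closed_on S \<omega> \<Longrightarrow> x \<in> S \<Longrightarrow> ambient_deriv \<omega> x vs = 0"
  by (auto simp: closed_on_def)

lemma closed_on_subset: "closed_on S \<omega> \<Longrightarrow> T \<subseteq> S \<Longrightarrow> closed_on T \<omega>"
  unfolding closed_on_def using ambient_form_on_subset by blast

lemma closed_on_cong:
  assumes "open S" "closed_on S \<eta>" "\<And>x. x \<in> S \<Longrightarrow> \<zeta> x = \<eta> x"
  shows "closed_on S \<zeta>"
  unfolding closed_on_def
  using assms ambient_form_on_cong[OF assms(1) _ assms(3)] ambient_deriv_cong[OF assms(1) _ assms(3)]
  by (simp add: closed_on_def)

lemma closed_on_add:
  "open S \<Longrightarrow> closed_on S \<eta> \<Longrightarrow> closed_on S \<zeta> \<Longrightarrow> closed_on S (\<lambda>x vs. \<eta> x vs + \<zeta> x vs)"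
  by (simp add: closed_on_def ambient_form_on_add ambient_deriv_add)

lemma closed_on_scale: "open S \<Longrightarrow> closed_on S \<eta> \<Longrightarrow> closed_on S (\<lambda>x vs. c * \<eta> x vs)"
  by (simp add: closed_on_def ambient_form_on_scale ambient_deriv_scale)

lemma closed_on_diff:
  "open S \<Longrightarrow> closed_on S \<eta> \<Longrightarrow> closed_on S \<zeta> \<Longrightarrow> closed_on S (\<lambda>x vs. \<eta> x vs - \<zeta> x vs)"
  by (simp add: closed_on_def ambient_form_on_diff ambient_deriv_diff)

lemma closed_on_ambient_deriv: "open S \<Longrightarrow> ambient_form_on S \<eta> \<Longrightarrow> closed_on S (ambient_deriv \<eta>)"
  by (simp add: closed_on_def ambient_form_on_ambient_deriv ambient_deriv_ambient_deriv)

lemma closed_on_wedge: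
  assumes "open S" "closed_on S \<alpha>" "closed_on S \<beta>"
  shows "closed_on S (wedge \<alpha> \<beta>)"
proof -
  have "wedge (ambient_deriv \<alpha>) \<beta> x vs = wedge (\<lambda>x vs. 0) \<beta> x vs"
    "wedge (parity \<alpha>) (ambient_deriv \<beta>) x vs = wedge (parity \<alpha>) (\<lambda>x vs. 0) x vs" if "x \<in> S" for x vs
    using assms(2,3) that by (auto simp: closed_on_def fun_eq_iff intro!: wedge_cong)
  with assms show ?thesis
    by (simp add: closed_on_def ambient_form_on_wedge ambient_deriv_wedge wedge_zero_left wedge_zero_right)
qed

lemma closed_on_pullback:
  assumes "open U" "open V" "h ` U \<subseteq> V" "smooth_on U h" "closed_on V \<eta>"
  shows "closed_on U (pullback h \<eta>)"
  unfolding closed_on_def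
proof (intro conjI ballI allI)
  show "ambient_deriv (pullback h \<eta>) x vs = 0" if "x \<in> U" for x vs
    using assms that ambient_deriv_pullback[OF assms(1-4) closed_onD(1)[OF assms(5)] that]
    by (auto simp: pullback_def closed_onD)
qed (use assms in \<open>auto intro: ambient_form_on_pullback closed_onD\<close>)

text \<open>The primitive is the fibre integral of the pulled back form. The map \<open>H\<close>
  lives on an open \<open>D\<close> because time derivatives are two-sided at the end points as
  well.\<close>

theorem homotopy_formula:
  fixes H :: "real \<times> 'a::euclidean_space \<Rightarrow> 'b::euclidean_space"
  assumes D: "open D" "{0..1} \<times> U \<subseteq> D" and U: "open U" and V: "open V"
    and H: "H ` D \<subseteq> V" "smooth_on D H" and \<omega>: "closed_on V \<omega>"
  obtains \<tau> where "ambient_form_on U \<tau>"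
    "\<And>x vs. x \<in> U \<Longrightarrow> pullback (\<lambda>x. H (1, x)) \<omega> x vs - pullback (\<lambda>x. H (0, x)) \<omega> x vs = ambient_deriv \<tau> x vs"
proof
  note p = closed_on_pullback[OF D(1) V H \<omega>]
  show "ambient_form_on U (fiber_integral 0 1 (pullback H \<omega>))"
    by (rule ambient_form_on_fiber_integral[OF D U closed_onD(1)[OF p]])
  fix x vs assume x: "x \<in> U"
  then have d: "(t, x) \<in> D" if "t \<in> {0..1}" for t using D(2) that by auto
  then have "fiber_integral 0 1 (ambient_deriv (pullback H \<omega>)) x vs = integral {0..1::real} (\<lambda>t. 0)"
    unfolding fiber_integral_def fiber_average_def contract_def
    by (intro integral_cong closed_onD(2)[OF p]) auto
  then have "fiber_integral 0 1 (ambient_deriv (pullback H \<omega>)) x vs = 0" by simp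
  moreover have "pullback H \<omega> (t, x) (map (Pair 0) vs) = pullback (\<lambda>x. H (t, x)) \<omega> x vs" if "t \<in> {0..1}" for t
    by (rule pullback_slice[OF smooth_on_differentiable[OF D(1) H(2) d[OF that]]])
  ultimately show "pullback (\<lambda>x. H (1, x)) \<omega> x vs - pullback (\<lambda>x. H (0, x)) \<omega> x vs =
      ambient_deriv (fiber_integral 0 1 (pullback H \<omega>)) x vs"
    by (simp add: ambient_deriv_fiber_integral[OF D U closed_onD(1)[OF p] x])
qed

section \<open>A flat function and smooth moduli\<close>

lemma open_positive_set:
  fixes g :: "'a::topological_space \<Rightarrow> real"
  assumes "open S" "continuous_on S g"
  shows "open {x \<in> S. 0 < g x}"
proof -
  have "open (S \<inter> g -` {0<..})"
    using assms by (intro continuous_open_preimage) auto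
  moreover have "S \<inter> g -` {0<..} = {x \<in> S. 0 < g x}" by auto
  ultimately show ?thesis by simp
qed

definition flat_exp :: "real \<Rightarrow> real" where
  "flat_exp t = (if t \<le> 0 then 0 else exp (- inverse t))"

lemma poly_times_exp_tendsto_0: "((\<lambda>s. poly p s * exp (- s :: real)) \<longlongrightarrow> 0) at_top"
proof -
  have "((\<lambda>s. \<Sum>i\<le>degree p. coeff p i * (s ^ i / exp s)) \<longlongrightarrow> (\<Sum>i\<le>degree p. coeff p i * 0)) at_top"
    by (intro tendsto_sum tendsto_mult tendsto_const tendsto_power_div_exp_0)
  then show ?thesis
    by (simp add: poly_altdef sum_distrib_right exp_minus divide_inverse mult.assoc)
qed

text \<open>With \<open>s = 1/t\<close>, differentiation sends \<open>p(s) e^(-s)\<close> to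
  \<open>s^2 (p(s) - p'(s)) e^(-s)\<close>, so the family is closed under differentiation; at
  \<open>0\<close> the exponential beats every polynomial.\<close>

lemma flat_poly_has_real_derivative:
  fixes p :: "real poly"
  defines "q \<equiv> [:0, 0, 1:] * (p - pderiv p)"
  shows "((\<lambda>t. if t \<le> 0 then 0 else poly p (inverse t) * exp (- inverse t)) has_real_derivative
    (if t \<le> 0 then 0 else poly q (inverse t) * exp (- inverse t))) (at t)"
    (is "(?f has_real_derivative _) _")
proof -
  consider "t < 0" | "t = 0" | "t > 0" by linarith
  then show ?thesis
  proof cases
    case 1
    have "((\<lambda>t. 0) has_real_derivative 0) (at t)" by simp
    then have "(?f has_real_derivative 0) (at t)"
      by (rule has_field_derivative_transform_within_open[of _ _ _ "{..<0}"]) (use 1 in auto)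
    with 1 show ?thesis by simp
  next
    case 3
    have "((\<lambda>t. poly p (inverse t) * exp (- inverse t)) has_real_derivative
        poly q (inverse t) * exp (- inverse t)) (at t)"
      using 3 unfolding q_def
      by (auto intro!: derivative_eq_intros simp: algebra_simps power2_eq_square)
    then have "(?f has_real_derivative poly q (inverse t) * exp (- inverse t)) (at t)"
      by (rule has_field_derivative_transform_within_open[of _ _ _ "{0<..}"]) (use 3 in auto)
    with 3 show ?thesis by simp
  next
    case 2
    \<comment> \<open>Dividing by \<open>h\<close> multiplies the polynomial by its own variable
      \<open>1/h\<close>, so the difference quotient at \<open>0\<close> is of the same shape
      again.\<close>
    have "((\<lambda>h. poly ([:0, 1:] * p) (inverse h) * exp (- inverse h)) \<longlongrightarrow> 0) (at_right 0)"
      by (rule filterlim_compose[OF poly_times_exp_tendsto_0 filterlim_inverse_at_top_right])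
    then have "((\<lambda>h. ?f h / h) \<longlongrightarrow> 0) (at_right 0)"
      by (rule Lim_transform_eventually)
         (auto simp: eventually_at_right_less field_simps intro: eventually_mono[OF eventually_at_right_less])
    moreover have "((\<lambda>h. ?f h / h) \<longlongrightarrow> 0) (at_left 0)"
      by (rule Lim_transform_eventually[OF tendsto_const])
         (auto simp: eventually_at_filter)
    ultimately have "((\<lambda>h. ?f h / h) \<longlongrightarrow> 0) (at 0)"
      by (rule filterlim_split_at[rotated])
    with 2 show ?thesis by (simp add: DERIV_def cong: if_cong)
  qed
qed

lemma smooth_on_flat_exp: "smooth_on UNIV flat_exp"
proof (rule smooth_on_coinduct[where P = "\<lambda>f. \<exists>p. f = (\<lambda>t. if t \<le> 0 then 0 else poly p (inverse t) * exp (- inverse t))"])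
  show "\<exists>p. flat_exp = (\<lambda>t. if t \<le> 0 then 0 else poly p (inverse t) * exp (- inverse t))"
    by (rule exI[of _ 1]) (simp add: flat_exp_def fun_eq_iff)
next
  fix f :: "real \<Rightarrow> real"
  assume "\<exists>p. f = (\<lambda>t. if t \<le> 0 then 0 else poly p (inverse t) * exp (- inverse t))"
  then obtain p where f: "f = (\<lambda>t. if t \<le> 0 then 0 else poly p (inverse t) * exp (- inverse t))" ..
  let ?q = "[:0, 0, 1:] * (p - pderiv p)"
  show "\<exists>f'. (\<forall>x\<in>UNIV. (f has_derivative f' x) (at x)) \<and>
      (\<forall>v. \<exists>p. (\<lambda>x. f' x v) = (\<lambda>t. if t \<le> 0 then 0 else poly p (inverse t) * exp (- inverse t)))"
  proof (intro exI[of _ "\<lambda>t v. (if t \<le> 0 then 0 else poly ?q (inverse t) * exp (- inverse t)) * v"] conjI ballI allI)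
    show "(f has_derivative (\<lambda>v. (if t \<le> 0 then 0 else poly ?q (inverse t) * exp (- inverse t)) * v)) (at t)" for t
      using flat_poly_has_real_derivative[of p t] unfolding has_field_derivative_def f .
    show "\<exists>p. (\<lambda>t. (if t \<le> 0 then 0 else poly ?q (inverse t) * exp (- inverse t)) * v) =
        (\<lambda>t. if t \<le> 0 then 0 else poly p (inverse t) * exp (- inverse t))" for v
      by (rule exI[of _ "[:v:] * ?q"]) (simp add: fun_eq_iff)
  qed
qed simp

lemma flat_exp_pos: "0 < t \<Longrightarrow> 0 < flat_exp t"
  and flat_exp_nonneg: "0 \<le> flat_exp t"
  and flat_exp_zero: "t \<le> 0 \<Longrightarrow> flat_exp t = 0"
  by (auto simp: flat_exp_def)

lemma smooth_on_cmod_power2: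
  "open U \<Longrightarrow> smooth_on U f \<Longrightarrow> smooth_on U (\<lambda>x. (cmod (f x))\<^sup>2)"
  unfolding cmod_power2 by (intro smooth_intros)

text \<open>The squared modulus is polynomial in real and imaginary part; away from its zeros, the
  root is taken through \<open>exp\<close> and \<open>ln\<close>.\<close>

lemma smooth_on_cmod:
  assumes "open U" "smooth_on U f" "\<And>x. x \<in> U \<Longrightarrow> f x \<noteq> 0"
  shows "smooth_on U (\<lambda>x. cmod (f x))"
proof -
  have "smooth_on U (\<lambda>x. exp (ln ((cmod (f x))\<^sup>2) / 2))"
    using assms by (intro smooth_on_exp smooth_on_divide smooth_on_ln smooth_on_cmod_power2 smooth_on_const) auto
  moreover have "exp (ln ((cmod (f x))\<^sup>2) / 2) = cmod (f x)" if "x \<in> U" for x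
    using assms(3)[OF that] by (simp add: ln_realpow)
  ultimately show ?thesis
    using smooth_on_cong[OF assms(1)] by (metis (no_types, lifting))
qed

section \<open>Averages over a period and local logarithms\<close>

lemma integral_periodic_shift:
  fixes g :: "real \<Rightarrow> complex"
  assumes cont: "continuous_on UNIV g" and per: "\<And>t. g (t + 2 * pi) = g t" and c: "0 \<le> c" "c \<le> 2 * pi"
  shows "integral {0..2 * pi} (\<lambda>t. g (t + c)) = integral {0..2 * pi} g"
proof -
  have int: "g integrable_on {a..b}" for a b
    by (intro integrable_continuous_interval continuous_on_subset[OF cont]) auto
  have sh: "integral {a..b} (\<lambda>t. g (t + d)) = integral {a + d..b + d} g" for a b d
    using integral_shift[OF continuous_on_subset[OF cont], of "a" d b] by (simp add: o_def)
  have "integral {0..2 * pi} (\<lambda>t. g (t + c)) = integral {c..2 * pi} g + integral {2 * pi..2 * pi + c} g"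
    unfolding sh using c by (simp add: Henstock_Kurzweil_Integration.integral_combine int)
  also have "integral {2 * pi..2 * pi + c} g = integral {0..c} (\<lambda>t. g (t + 2 * pi))"
    unfolding sh by (simp add: add.commute)
  also have "\<dots> = integral {0..c} g" by (simp add: per)
  finally show ?thesis
    using Henstock_Kurzweil_Integration.integral_combine[OF c int] by (simp add: add.commute)
qed

text \<open>Terms containing \<open>w\<close> twice vanish, so a shear along \<open>w\<close>
  changes the value to first order in \<open>\<kappa>\<close> only. In the application
  \<open>w\<close> is the angular direction.\<close>

lemma alt_multilinear_shear:
  fixes a :: "'b::real_vector list \<Rightarrow> complex" and \<kappa> :: "'a \<Rightarrow> real"
  assumes "alt_multilinear a"
  shows "a (map (\<lambda>v. L v + \<kappa> v *\<^sub>R w) vs) = a (map L vs) +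
    (\<Sum>i<length vs. (-1) ^ i * (of_real (\<kappa> (vs ! i)) * a (w # map L (take i vs @ drop (Suc i) vs))))"
  using assms
proof (induction vs arbitrary: a)
  case (Cons v vs)
  let ?M = "map (\<lambda>v. L v + \<kappa> v *\<^sub>R w) vs"
  note lin = alt_multilinear_linear_hd[OF Cons.prems]
  have "a (map (\<lambda>v. L v + \<kappa> v *\<^sub>R w) (v # vs)) = a (L v # ?M) + of_real (\<kappa> v) * a (w # ?M)"
    using linear_add[OF lin] linear_scale[OF lin] by (simp add: scaleR_conv_of_real)
  also have "a (w # ?M) = a (w # map L vs)"
    using Cons.IH[OF alt_multilinear_contract[OF Cons.prems, of w]] alt_multilinear_repeat_hd[OF Cons.prems, of w]
    by simp
  also have "a (L v # ?M) = a (L v # map L vs) -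
      (\<Sum>i<length vs. (-1) ^ i * (of_real (\<kappa> (vs ! i)) * a (w # L v # map L (take i vs @ drop (Suc i) vs))))"
    using Cons.IH[OF alt_multilinear_contract[OF Cons.prems, of "L v"]] alt_multilinear_swap_hd[OF Cons.prems, of "L v" w]
    by (simp add: sum_negf)
  finally show ?case
    by (simp add: sum.lessThan_Suc_shift sum_negf del: sum.lessThan_Suc)
qed simp

lemma frechet_derivative_periodic:
  assumes "\<And>p. m (p + c) = m p" "m differentiable (at (x + c))"
  shows "frechet_derivative m (at (x + c)) = frechet_derivative m (at x)"
proof -
  have "((\<lambda>p. p + c) has_derivative (\<lambda>v. v)) (at x)"
    by (auto intro!: derivative_eq_intros)
  then have "((\<lambda>p. m (p + c)) has_derivative frechet_derivative m (at (x + c))) (at x)"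
    using assms(2) by (intro has_derivative_compose[of "\<lambda>p. p + c" _ x UNIV m]) (auto simp: frechet_derivative_works)
  then show ?thesis
    using frechet_derivative_at by (simp add: assms(1)) blast
qed

text \<open>The principal logarithm is applied to \<open>f y / f x\<close> where this quotient has
  positive real part; the normalisation at \<open>x\<close> keeps the branch cut away.\<close>

lemma complex_log_branch:
  fixes f :: "'a::euclidean_space \<Rightarrow> complex"
  assumes S: "open S" "smooth_on S f" and x: "x \<in> S" "f x \<noteq> 0"
  obtains V l where "open V" "x \<in> V" "V \<subseteq> S" "l x = 0" "\<And>y. y \<in> V \<Longrightarrow> f y = f x * exp (l y)"
    "(l has_derivative (\<lambda>v. frechet_derivative f (at x) v / f x)) (at x)"
proof -
  define l where "l = (\<lambda>y. Ln (f y / f x))"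
  define V where "V = {y \<in> S. 0 < Re (f y / f x)}"
  have 1: "open V"
    unfolding V_def using x
    by (intro open_positive_set S continuous_intros smooth_on_continuous[OF S(2)]) auto
  have 2: "x \<in> V" "V \<subseteq> S" "l x = 0" using x by (auto simp: V_def l_def)
  have 3: "f y = f x * exp (l y)" if "y \<in> V" for y
  proof -
    have "f y / f x \<noteq> 0" using that by (auto simp: V_def)
    then show ?thesis using x by (simp add: l_def exp_Ln)
  qed
  have "((\<lambda>y. f y / f x) has_derivative (\<lambda>v. frechet_derivative f (at x) v / f x)) (at x)"
    using bounded_linear.has_derivative[OF bounded_linear_divide smooth_on_has_derivative[OF S x(1)]] .
  moreover have "(Ln has_derivative (\<lambda>w. w)) (at (f x / f x))"
    using has_field_derivative_Ln[of 1] x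
    by (auto simp: has_field_derivative_def fun_eq_iff elim!: has_derivative_eq_rhs)
  ultimately have 4: "(l has_derivative (\<lambda>v. frechet_derivative f (at x) v / f x)) (at x)"
    unfolding l_def by (rule has_derivative_compose)
  show thesis by (rule that[OF 1 2 3 4])
qed

lemma frechet_derivative_ln_cmod:
  assumes S: "open S" "smooth_on S f" and x: "x \<in> S" "f x \<noteq> 0"
  shows "frechet_derivative (\<lambda>y. complex_of_real (ln (cmod (f y)))) (at x) v =
    of_real (Re (frechet_derivative f (at x) v / f x))"
proof -
  obtain V l where V: "open V" "x \<in> V" "V \<subseteq> S" "\<And>y. y \<in> V \<Longrightarrow> f y = f x * exp (l y)"
    and l: "(l has_derivative (\<lambda>v. frechet_derivative f (at x) v / f x)) (at x)"
    by (rule complex_log_branch[OF S x]) blast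
  have eq: "complex_of_real (ln (cmod (f x)) + Re (l y)) = complex_of_real (ln (cmod (f y)))" if "y \<in> V" for y
    using V(4)[OF that] x by (simp add: norm_mult ln_mult)
  have "((\<lambda>y. complex_of_real (ln (cmod (f x)) + Re (l y))) has_derivative
      (\<lambda>v. complex_of_real (0 + Re (frechet_derivative f (at x) v / f x)))) (at x)"
    by (intro bounded_linear.has_derivative[OF bounded_linear_of_real] has_derivative_add has_derivative_const
        bounded_linear.has_derivative[OF bounded_linear_Re] l)
  from has_derivative_transform_within_open[OF this V(1,2) eq]
  show ?thesis by (simp add: frechet_derivative_eqI)
qed

lemma closed_on_local:
  assumes "open S" "\<And>x. x \<in> S \<Longrightarrow> \<exists>V. open V \<and> x \<in> V \<and> closed_on V \<eta>"
  shows "closed_on S \<eta>"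
  unfolding closed_on_def
proof (intro conjI ballI allI)
  show "ambient_form_on S \<eta>"
    using assms(2) closed_onD(1) by (intro ambient_form_on_local[OF assms(1)]) blast
  show "ambient_deriv \<eta> x vs = 0" if "x \<in> S" for x vs
    using assms(2)[OF that] closed_onD(2) by blast
qed

lemma pullback_eq_self:
  assumes "open U" "x \<in> U" "\<And>y. y \<in> U \<Longrightarrow> g y = y"
  shows "pullback g \<eta> x vs = \<eta> x vs"
  using pullback_cong[OF assms] by (simp add: pullback_ident)

section \<open>Residues along a fibred hypersurface\<close>

text \<open>The point \<open>E (z, w)\<close> lies on the fibre through \<open>z\<close>, and \<open>f\<close> takes the value \<open>w\<close> there. The value of \<open>r\<close>
  at a point of the hypersurface is the radius of a disc in its fibre that stays inside \<open>X\<close>.\<close>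

locale fibred_hypersurface =
  fixes T :: "'a::euclidean_space set" and W :: "complex set" and f :: "'a \<Rightarrow> complex"
    and E :: "'a \<times> complex \<Rightarrow> 'a" and r :: "'a \<Rightarrow> real" and X :: "'a set"
  assumes open_T: "open T" and open_W: "open W"
    and smooth_f: "smooth_on T f" and smooth_E: "smooth_on (T \<times> W) E" and smooth_r: "smooth_on T r"
    and E_T: "z \<in> T \<Longrightarrow> w \<in> W \<Longrightarrow> E (z, w) \<in> T" and f_W: "z \<in> T \<Longrightarrow> f z \<in> W" and W_0: "0 \<in> W"
    and E_f: "z \<in> T \<Longrightarrow> E (z, f z) = z" and f_E: "z \<in> T \<Longrightarrow> w \<in> W \<Longrightarrow> f (E (z, w)) = w"
    and E_E: "z \<in> T \<Longrightarrow> w \<in> W \<Longrightarrow> w' \<in> W \<Longrightarrow> E (E (z, w), w') = E (z, w')"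
    and X_def: "X = {z \<in> T. 0 < r z}" and r_nonneg: "z \<in> T \<Longrightarrow> 0 \<le> r z"
    and tube_W: "z \<in> T \<Longrightarrow> cmod w < r (E (z, 0)) \<Longrightarrow> w \<in> W"
    and tube_X: "z \<in> T \<Longrightarrow> cmod w < r (E (z, 0)) \<Longrightarrow> E (z, w) \<in> X"
begin

text \<open>\<open>proj\<close> retracts each fibre to the hypersurface, and \<open>R\<close> is the
  radius made constant along fibres. \<open>N\<close> is the tube, \<open>Y\<close> the punctured
  tube, and \<open>U\<close> the complement of the hypersurface in \<open>X\<close>.\<close>

definition proj where "proj z = E (z, 0)"
definition R where "R z = r (proj z)"
definition N where "N = {z \<in> T. cmod (f z) < R z}"
definition Y where "Y = {z \<in> N. f z \<noteq> 0}"
definition U where "U = {z \<in> X. f z \<noteq> 0}"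

section \<open>Geometry of the tube\<close>

lemma open_TW: "open (T \<times> W)"
  by (intro open_Times open_T open_W)

lemma smooth_E_comp:
  assumes "open S" "smooth_on S g" "smooth_on S w" "\<And>x. x \<in> S \<Longrightarrow> g x \<in> T" "\<And>x. x \<in> S \<Longrightarrow> w x \<in> W"
  shows "smooth_on S (\<lambda>x. E (g x, w x))"
  using assms by (intro smooth_on_compose[OF _ open_TW _ _ smooth_E] smooth_on_Pair) auto

lemma smooth_proj: "smooth_on T proj"
  unfolding proj_def using W_0 by (intro smooth_E_comp open_T smooth_on_ident smooth_on_const) auto

lemma proj_T: "z \<in> T \<Longrightarrow> proj z \<in> T"
  by (simp add: proj_def E_T W_0)

lemma smooth_R: "smooth_on T R"
  unfolding R_def using proj_T by (intro smooth_on_compose[OF open_T open_T _ smooth_proj smooth_r]) auto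

lemma R_nonneg: "z \<in> T \<Longrightarrow> 0 \<le> R z"
  by (simp add: R_def r_nonneg proj_T)

lemma N_T: "N \<subseteq> T" by (auto simp: N_def)
lemma Y_N: "Y \<subseteq> N" by (auto simp: Y_def)
lemma N_R: "z \<in> N \<Longrightarrow> 0 < R z" by (auto simp: N_def intro: le_less_trans[OF norm_ge_zero])

lemma continuous_cmod_f: "S \<subseteq> T \<Longrightarrow> continuous_on S (\<lambda>z. cmod (f z))"
  using continuous_on_norm[OF smooth_on_continuous[OF smooth_f]] continuous_on_subset by blast

lemma continuous_R: "S \<subseteq> T \<Longrightarrow> continuous_on S R"
  using smooth_on_continuous[OF smooth_R] continuous_on_subset by blast

lemma open_N: "open N"
proof -
  have "open {z \<in> T. 0 < R z - cmod (f z)}"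
    by (intro open_positive_set open_T continuous_on_diff continuous_R continuous_cmod_f) auto
  then show ?thesis by (simp add: N_def)
qed

lemma open_Y: "open Y"
proof -
  have "open {z \<in> N. 0 < cmod (f z)}"
    by (intro open_positive_set open_N continuous_cmod_f N_T)
  then show ?thesis by (simp add: Y_def)
qed

lemma open_X: "open X"
  unfolding X_def by (intro open_positive_set open_T smooth_on_continuous smooth_r)

lemma X_T: "X \<subseteq> T" by (auto simp: X_def)

lemma open_U: "open U"
proof -
  have "open {z \<in> X. 0 < cmod (f z)}"
    by (intro open_positive_set open_X continuous_cmod_f X_T)
  then show ?thesis by (simp add: U_def)
qed

lemma U_X: "U \<subseteq> X" by (auto simp: U_def)

lemma N_X: "N \<subseteq> X"
proof
  fix z assume z: "z \<in> N"
  then have "E (z, f z) \<in> X" by (intro tube_X) (auto simp: N_def R_def proj_def)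
  with z show "z \<in> X" using E_f[of z] by (simp add: N_def)
qed

lemma Y_U: "Y \<subseteq> U"
  using N_X by (auto simp: Y_def U_def)

lemma proj_E: "z \<in> T \<Longrightarrow> w \<in> W \<Longrightarrow> proj (E (z, w)) = proj z"
  by (simp add: proj_def E_E W_0)

lemma E_W: "z \<in> T \<Longrightarrow> cmod w < R z \<Longrightarrow> w \<in> W"
  by (auto simp: R_def proj_def intro: tube_W)

lemma E_N:
  assumes "z \<in> T" "cmod w < R z"
  shows "E (z, w) \<in> N"
  using assms E_W[OF assms] by (simp add: N_def E_T f_E R_def proj_E)

lemma E_Y: "z \<in> T \<Longrightarrow> cmod w < R z \<Longrightarrow> w \<noteq> 0 \<Longrightarrow> E (z, w) \<in> Y"
  using E_N E_W f_E by (simp add: Y_def)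

lemma proj_N: "z \<in> N \<Longrightarrow> proj z \<in> N"
  unfolding proj_def using N_R[of z] N_T by (intro E_N) auto

lemma f_proj: "z \<in> T \<Longrightarrow> f (proj z) = 0"
  by (simp add: proj_def f_E W_0)

lemma proj_f_zero: "z \<in> T \<Longrightarrow> f z = 0 \<Longrightarrow> proj z = z"
  using E_f[of z] by (simp add: proj_def)

text \<open>Scaling the fibre coordinate by \<open>t\<close> contracts the tube to the hypersurface;
  \<open>D\<close> is the open set of times for which the scaled point stays in the tube.\<close>

lemma closed_homologous_proj:
  assumes \<omega>: "closed_on N \<omega>"
  obtains \<tau> where "ambient_form_on N \<tau>"
    "\<And>x vs. x \<in> N \<Longrightarrow> \<omega> x vs - pullback proj \<omega> x vs = ambient_deriv \<tau> x vs"
proof -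
  define D where "D = {p \<in> UNIV \<times> N. 0 < R (snd p) - \<bar>fst p\<bar> * cmod (f (snd p))}"
  define H where "H = (\<lambda>p. E (snd p, of_real (fst p) * f (snd p)))"
  have D: "open D"
    unfolding D_def
    by (intro open_positive_set open_Times open_UNIV open_N continuous_on_diff continuous_on_mult
        continuous_intros continuous_on_compose2[OF continuous_R[OF N_T]] continuous_on_compose2[OF continuous_cmod_f[OF N_T]]) auto
  have sub: "{0..1} \<times> N \<subseteq> D"
  proof clarify
    fix t z assume tz: "t \<in> {0..1::real}" "z \<in> N"
    then have "\<bar>t\<bar> * cmod (f z) \<le> cmod (f z)" by (simp add: mult_left_le_one_le)
    with tz show "(t, z) \<in> D" by (auto simp: D_def N_def)
  qed
  have b: "cmod (of_real (fst p) * f (snd p)) < R (snd p)" "snd p \<in> T" if "p \<in> D" for p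
    using that N_T by (auto simp: D_def norm_mult)
  have HD: "H ` D \<subseteq> N"
    unfolding H_def using b by (auto intro!: E_N)
  have snd: "snd ` D \<subseteq> T" using b by auto
  have bW: "of_real (fst p) * f (snd p) \<in> W" if "p \<in> D" for p
    using E_W[OF b(2)[OF that] b(1)[OF that]] .
  have "smooth_on D H"
    unfolding H_def using b(2) bW
    by (intro smooth_E_comp D smooth_on_snd smooth_on_ident smooth_on_mult smooth_on_of_real smooth_on_fst
        smooth_on_compose[OF D open_T snd _ smooth_f]) auto
  from homotopy_formula[OF D sub open_N open_N HD this \<omega>] obtain \<tau> where
    \<tau>: "ambient_form_on N \<tau>" "\<And>x vs. x \<in> N \<Longrightarrow> pullback (\<lambda>x. H (1, x)) \<omega> x vs - pullback (\<lambda>x. H (0, x)) \<omega> x vs = ambient_deriv \<tau> x vs"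
    by blast
  have 1: "pullback (\<lambda>x. H (1, x)) \<omega> x vs = \<omega> x vs" if "x \<in> N" for x vs
    by (rule pullback_eq_self[OF open_N that]) (use N_T E_f in \<open>auto simp: H_def\<close>)
  have 0: "(\<lambda>x. H (0, x)) = proj" by (simp add: H_def proj_def fun_eq_iff)
  show thesis
    using that[OF \<tau>(1)] \<tau>(2) unfolding 0 by (simp add: 1)
qed

text \<open>\<open>circ\<close> describes the circle around the hypersurface at half the tube
  radius, starting at angle \<open>0\<close>; it makes sense for points of the hypersurface as well.
  \<open>rot\<close> starts at the point's own angle and is used off the hypersurface, and
  \<open>rot (0, z)\<close> is the radial projection of \<open>z\<close> to that circle.\<close>

definition circ where "circ p = E (snd p, of_real (R (snd p) / 2) * cis (fst p))"
definition rot where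
  "rot p = E (snd p, of_real (R (snd p) / 2) * cis (fst p) * (f (snd p) / of_real (cmod (f (snd p)))))"

lemma half_R: "z \<in> N \<Longrightarrow> cmod w = 1 \<Longrightarrow> cmod (of_real (R z / 2) * w) < R z"
  using N_R[of z] by (simp add: norm_mult)

lemma circ_Y: "circ ` (UNIV \<times> N) \<subseteq> Y"
proof clarify
  fix t :: real and z assume z: "z \<in> N"
  then have "z \<in> T" using N_T by auto
  then show "circ (t, z) \<in> Y"
    unfolding circ_def using half_R[OF z norm_cis, of t] N_R[OF z] by (intro E_Y) auto
qed

lemma rot_Y: "rot ` (UNIV \<times> Y) \<subseteq> Y"
proof clarify
  fix t :: real and z assume z: "z \<in> Y"
  then have z': "z \<in> T" "z \<in> N" "f z \<noteq> 0" using N_T by (auto simp: Y_def)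
  then have "cmod (cis t * (f z / of_real (cmod (f z)))) = 1" by (simp add: norm_mult norm_divide)
  from half_R[OF z'(2) this] z' N_R[OF z'(2)] show "rot (t, z) \<in> Y"
    unfolding rot_def by (intro E_Y) (auto simp: mult.assoc)
qed

lemma open_UNIV_Times: "open S \<Longrightarrow> open (UNIV \<times> S)"
  by (intro open_Times) auto

lemma smooth_on_snd_compose:
  assumes "open S" "smooth_on S g"
  shows "smooth_on (UNIV \<times> S) (\<lambda>p. g (snd p))"
  by (rule smooth_on_compose[OF open_UNIV_Times[OF assms(1)] assms(1) _ _ assms(2)])
     (auto intro!: smooth_on_snd smooth_on_ident open_UNIV_Times assms(1))

lemma smooth_circ: "smooth_on (UNIV \<times> N) circ"
  unfolding circ_def using half_R[OF _ norm_cis] E_W N_T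
  by (intro smooth_E_comp smooth_on_snd smooth_on_ident smooth_on_mult smooth_on_of_real smooth_on_divide smooth_on_const
      smooth_on_cis smooth_on_fst smooth_on_snd_compose smooth_on_subset[OF smooth_R] open_UNIV_Times open_N) auto

lemma smooth_rot: "smooth_on (UNIV \<times> Y) rot"
proof -
  have W: "of_real (R (snd p) / 2) * cis (fst p) * (f (snd p) / of_real (cmod (f (snd p)))) \<in> W" if "p \<in> UNIV \<times> Y" for p
  proof -
    have z': "snd p \<in> T" "snd p \<in> N" "f (snd p) \<noteq> 0" using that N_T by (auto simp: Y_def)
    then have "cmod (cis (fst p) * (f (snd p) / of_real (cmod (f (snd p))))) = 1" by (simp add: norm_mult norm_divide)
    from half_R[OF z'(2) this] show ?thesis by (intro E_W[OF z'(1)]) (simp add: mult.assoc)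
  qed
  have sf: "smooth_on Y f" "smooth_on Y R"
    using smooth_on_subset[OF smooth_f] smooth_on_subset[OF smooth_R] N_T Y_N by blast+
  have c: "smooth_on (UNIV \<times> Y) (\<lambda>p. cmod (f (snd p)))" "smooth_on (UNIV \<times> Y) (\<lambda>p. R (snd p))"
    "smooth_on (UNIV \<times> Y) (\<lambda>p. f (snd p))"
    by (intro smooth_on_snd_compose open_Y smooth_on_cmod sf; auto simp: Y_def)+
  show ?thesis
    unfolding rot_def using W N_T
    by (intro smooth_E_comp smooth_on_snd smooth_on_ident smooth_on_mult smooth_on_of_real smooth_on_divide smooth_on_const
        smooth_on_cis smooth_on_fst c open_UNIV_Times open_Y) (auto simp: Y_def)
qed

text \<open>A radial homotopy: the factor \<open>c\<close> moves linearly from \<open>1\<close> to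
  the factor that brings the modulus of \<open>f\<close> to half the tube radius.\<close>

lemma closed_homologous_rot:
  assumes \<omega>: "closed_on Y \<omega>"
  obtains \<tau> where "ambient_form_on Y \<tau>"
    "\<And>x vs. x \<in> Y \<Longrightarrow> pullback (\<lambda>x. rot (0, x)) \<omega> x vs - \<omega> x vs = ambient_deriv \<tau> x vs"
proof -
  define c where "c = (\<lambda>p. (1 - fst p) + fst p * (R (snd p) / (2 * cmod (f (snd p)))))"
  \<comment> \<open>Positivity of \<open>c\<close> keeps the homotopy off the hypersurface, and the
    second condition keeps it inside the tube.\<close>
  define D where "D = {p \<in> {p \<in> UNIV \<times> Y. 0 < c p}. 0 < R (snd p) - c p * cmod (f (snd p))}"
  define H where "H = (\<lambda>p. E (snd p, of_real (c p) * f (snd p)))"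
  note YT = subset_trans[OF Y_N N_T]
  have contc: "continuous_on (UNIV \<times> Y) c"
    unfolding c_def
    by (intro continuous_intros continuous_on_compose2[OF continuous_R[OF YT]]
        continuous_on_compose2[OF continuous_cmod_f[OF YT]]) (auto simp: Y_def)
  have o1: "open {p \<in> UNIV \<times> Y. 0 < c p}"
    by (intro open_positive_set open_UNIV_Times open_Y contc)
  have D: "open D"
    unfolding D_def
    by (intro open_positive_set o1 continuous_on_diff continuous_on_mult continuous_on_subset[OF contc]
        continuous_on_compose2[OF continuous_R[OF YT]] continuous_on_compose2[OF continuous_cmod_f[OF YT]]
        continuous_intros) auto
  have sub: "{0..1} \<times> Y \<subseteq> D"
  proof clarify
    fix t z assume t: "t \<in> {0..1::real}" and z: "z \<in> Y"
    have z': "z \<in> N" "f z \<noteq> 0" "cmod (f z) < R z" "0 < R z" using z N_R by (auto simp: Y_def N_def)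
    have "0 < c (t, z)"
    proof (cases "t = 1")
      case False
      then show ?thesis using t z' by (auto simp: c_def intro!: add_pos_nonneg)
    qed (use z' in \<open>simp add: c_def\<close>)
    \<comment> \<open>The new modulus is a convex combination of \<open>cmod (f z)\<close> and
      \<open>R z / 2\<close>, both of which are below \<open>R z\<close>.\<close>
    moreover have "c (t, z) * cmod (f z) = (1 - t) * cmod (f z) + t * (R z / 2)"
      using z' by (simp add: c_def distrib_right)
    moreover have "(1 - t) * cmod (f z) + t * (R z / 2) < R z"
    proof (cases "t = 1")
      case False
      then have "(1 - t) * cmod (f z) < (1 - t) * R z" using t z' by simp
      moreover have "t * (R z / 2) \<le> t * R z" using t z' by (intro mult_left_mono) auto
      ultimately show ?thesis by (simp add: algebra_simps)
    qed (use z' in simp)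
    ultimately show "(t, z) \<in> D" using z by (simp add: D_def)
  qed
  have b: "cmod (of_real (c p) * f (snd p)) < R (snd p)" "snd p \<in> T" "c p \<noteq> 0" "f (snd p) \<noteq> 0" if "p \<in> D" for p
    using that YT by (auto simp: D_def norm_mult Y_def)
  have HD: "H ` D \<subseteq> Y"
    unfolding H_def using b by (auto intro!: E_Y)
  have snd: "snd ` D \<subseteq> T" using b by auto
  have sn: "smooth_on D (\<lambda>p. g (snd p))" if "smooth_on T g" for g :: "'a \<Rightarrow> 'c::real_normed_vector"
    by (intro smooth_on_compose[OF D open_T snd _ that] smooth_on_snd smooth_on_ident D)
  have sc: "smooth_on D c"
    unfolding c_def
    by (intro smooth_on_add smooth_on_diff smooth_on_mult smooth_on_divide smooth_on_fst smooth_on_ident smooth_on_const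
        smooth_on_cmod sn smooth_f smooth_R D) (use b in auto)
  have bW: "of_real (c p) * f (snd p) \<in> W" if "p \<in> D" for p
    using E_W[OF b(2)[OF that] b(1)[OF that]] .
  have "smooth_on D H"
    unfolding H_def using b(2) bW
    by (intro smooth_E_comp D smooth_on_snd smooth_on_ident smooth_on_mult smooth_on_of_real sc sn smooth_f) auto
  from homotopy_formula[OF D sub open_Y open_Y HD this \<omega>] obtain \<tau> where
    \<tau>: "ambient_form_on Y \<tau>" "\<And>x vs. x \<in> Y \<Longrightarrow> pullback (\<lambda>x. H (1, x)) \<omega> x vs - pullback (\<lambda>x. H (0, x)) \<omega> x vs = ambient_deriv \<tau> x vs"
    by blast
  have 0: "pullback (\<lambda>x. H (0, x)) \<omega> x vs = \<omega> x vs" if "x \<in> Y" for x vs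
    by (rule pullback_eq_self[OF open_Y that]) (use YT E_f in \<open>auto simp: H_def c_def\<close>)
  have 1: "(\<lambda>x. H (1, x)) = (\<lambda>x. rot (0, x))" by (simp add: H_def c_def rot_def fun_eq_iff)
  show thesis
    using that[OF \<tau>(1)] \<tau>(2) unfolding 1 by (simp add: 0)
qed

end

context fibred_hypersurface
begin

text \<open>The differential of the argument of \<open>f\<close>, globally defined although the
  argument itself is not.\<close>

definition angle_form :: "'a form" where
  "angle_form = (\<lambda>x vs. if length vs = 1 then of_real (Im (frechet_derivative f (at x) (vs ! 0) / f x)) else 0)"

text \<open>Near \<open>z\<close> the argument of \<open>f\<close> is \<open>\<theta>\<close> plus
  the imaginary part of a local logarithm. So \<open>rot\<close> is \<open>circ\<close> at a shifted
  time, and the chain rule adds the derivative of the shift times the velocity of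
  \<open>circ\<close>.\<close>

lemma frechet_derivative_rot:
  assumes z: "z \<in> Y" and \<theta>: "f z = of_real (cmod (f z)) * cis \<theta>"
  shows "rot (t, z) = circ (t + \<theta>, z)"
    and "frechet_derivative (\<lambda>y. rot (t, y)) (at z) v = frechet_derivative circ (at (t + \<theta>, z)) (0, v) +
      Im (frechet_derivative f (at z) v / f z) *\<^sub>R frechet_derivative circ (at (t + \<theta>, z)) (1, 0)"
proof -
  have zT: "z \<in> T" "z \<in> N" "f z \<noteq> 0" using z N_T by (auto simp: Y_def)
  obtain V l where V: "open V" "z \<in> V" "V \<subseteq> T" "l z = 0" "\<And>y. y \<in> V \<Longrightarrow> f y = f z * exp (l y)"
    and l: "(l has_derivative (\<lambda>v. frechet_derivative f (at z) v / f z)) (at z)"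
    by (rule complex_log_branch[OF open_T smooth_f zT(1,3)]) blast
  have eq: "circ (t + \<theta> + Im (l y), y) = rot (t, y)" if "y \<in> V" for y
  proof -
    have "f y = of_real (cmod (f z)) * cis \<theta> * (of_real (exp (Re (l y))) * cis (Im (l y)))"
      using V(5)[OF that] \<theta> exp_eq_polar[of "l y"] by simp
    moreover have "cmod (f y) = cmod (f z) * exp (Re (l y))"
      using V(5)[OF that] by (simp add: norm_mult)
    ultimately have "f y / of_real (cmod (f y)) = cis (\<theta> + Im (l y))"
      using zT(3) by (simp add: cis_mult)
    then show ?thesis
      by (simp add: circ_def rot_def cis_mult mult.assoc add.assoc)
  qed
  from eq[OF V(2)] V(4) show "rot (t, z) = circ (t + \<theta>, z)" by simp
  let ?D = "frechet_derivative circ (at (t + \<theta>, z))"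
  have "((\<lambda>y. (t + \<theta> + Im (l y), y)) has_derivative (\<lambda>v. (0 + Im (frechet_derivative f (at z) v / f z), v))) (at z)"
    by (intro has_derivative_Pair has_derivative_ident has_derivative_add has_derivative_const
        bounded_linear.has_derivative[OF bounded_linear_Im] l)
  moreover have dc: "(circ has_derivative ?D) (at (t + \<theta> + Im (l z), z))"
    using smooth_on_has_derivative[OF open_UNIV_Times[OF open_N] smooth_circ] zT V(4) by simp
  ultimately have "((\<lambda>y. circ (t + \<theta> + Im (l y), y)) has_derivative
      (\<lambda>v. ?D (0 + Im (frechet_derivative f (at z) v / f z), v))) (at z)"
    by (rule has_derivative_compose)
  from has_derivative_transform_within_open[OF this V(1,2) eq]
  have "frechet_derivative (\<lambda>y. rot (t, y)) (at z) v = ?D (Im (frechet_derivative f (at z) v / f z), v)"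
    by (simp add: frechet_derivative_eqI)
  moreover have lin: "linear ?D" using dc by (rule has_derivative_linear)
  moreover have "?D (s, v) = ?D (0, v) + s *\<^sub>R ?D (1, 0)" for s
    using linear_add[OF lin, of "(0, v)" "s *\<^sub>R (1, 0)"] linear_scale[OF lin, of s "(1, 0)"] by simp
  ultimately show "frechet_derivative (\<lambda>y. rot (t, y)) (at z) v = ?D (0, v) +
      Im (frechet_derivative f (at z) v / f z) *\<^sub>R ?D (1, 0)" by metis
qed

lemma circ_periodic: "circ (p + (2 * pi, 0)) = circ p"
  by (simp add: circ_def cis_mult[symmetric])

lemma pullback_circ_periodic:
  assumes "z \<in> N"
  shows "pullback circ \<omega> (t + 2 * pi, z) us = pullback circ \<omega> (t, z) us"
proof -
  have "frechet_derivative circ (at ((t, z) + (2 * pi, 0))) = frechet_derivative circ (at (t, z))"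
    by (rule frechet_derivative_periodic[where c = "(2 * pi, 0)" and m = circ, OF circ_periodic])
       (use assms smooth_on_differentiable[OF open_UNIV_Times[OF open_N] smooth_circ] in auto)
  then show ?thesis
    using circ_periodic[of "(t, z)"] by (simp add: pullback_def)
qed

text \<open>At a fixed point \<open>rot\<close> is \<open>circ\<close> with time shifted by the
  argument of \<open>f\<close>. The shift drops out of integrals over a period, but its derivative
  shears the arguments along the angular direction. This produces \<open>angle_form\<close>, with
  the residue, up to a constant factor, as the form it multiplies.\<close>

lemma fiber_average_rot:
  assumes \<omega>: "ambient_form_on Y \<omega>" and z: "z \<in> Y"
  shows "fiber_average 0 (2 * pi) (pullback rot \<omega>) z vs = fiber_average 0 (2 * pi) (pullback circ \<omega>) z vs +
    wedge angle_form (fiber_integral 0 (2 * pi) (pullback circ \<omega>)) z vs"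
proof -
  let ?\<theta> = "Arg2pi (f z)"
  let ?P = "\<lambda>us t. pullback circ \<omega> (t, z) us"
  let ?\<kappa> = "\<lambda>v. Im (frechet_derivative f (at z) v / f z)"
  have zT: "z \<in> T" "z \<in> N" "f z \<noteq> 0" using z N_T by (auto simp: Y_def)
  have \<theta>: "f z = of_real (cmod (f z)) * cis ?\<theta>"
    using Arg2pi_eq[of "f z"] by (simp add: cis_conv_exp)
  note form = ambient_form_on_pullback[OF open_UNIV_Times[OF open_N] open_Y circ_Y smooth_circ \<omega>]
  have cont: "continuous_on UNIV (?P us)" for us
    by (rule continuous_on_compose2[OF smooth_on_continuous[OF ambient_form_on_smooth[OF form]]])
       (use zT in \<open>auto intro!: continuous_intros\<close>)
  have int: "(\<lambda>t. ?P us (t + ?\<theta>)) integrable_on {0..2 * pi}" for us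
    by (intro integrable_continuous_interval continuous_on_compose2[OF cont]) (auto intro!: continuous_intros)
  have shift: "integral {0..2 * pi} (\<lambda>t. ?P us (t + ?\<theta>)) = integral {0..2 * pi} (?P us)" for us
    using integral_periodic_shift[OF cont pullback_circ_periodic[OF zT(2)] Arg2pi_ge_0] Arg2pi_lt_2pi[of "f z"] by simp
  have pt: "pullback rot \<omega> (t, z) (map (Pair 0) vs) = ?P (map (Pair 0) vs) (t + ?\<theta>) +
      (\<Sum>i<length vs. (-1) ^ i * (of_real (?\<kappa> (vs ! i)) * ?P ((1, 0) # map (Pair 0) (take i vs @ drop (Suc i) vs)) (t + ?\<theta>)))" for t
  proof -
    let ?D = "frechet_derivative circ (at (t + ?\<theta>, z))"
    have mem: "(t, z) \<in> UNIV \<times> Y" using z by simp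
    have "circ (t + ?\<theta>, z) \<in> Y" using circ_Y zT by blast
    note alt = ambient_form_on_alt[OF \<omega> this]
    have "pullback rot \<omega> (t, z) (map (Pair 0) vs) = pullback (\<lambda>y. rot (t, y)) \<omega> z vs"
      by (rule pullback_slice[OF smooth_on_differentiable[OF open_UNIV_Times[OF open_Y] smooth_rot mem]])
    also have "\<dots> = \<omega> (circ (t + ?\<theta>, z)) (map (\<lambda>v. ?D (0, v) + ?\<kappa> v *\<^sub>R ?D (1, 0)) vs)"
      unfolding pullback_def frechet_derivative_rot(1)[OF z \<theta>]
      by (intro arg_cong[of _ _ "\<omega> _"] map_cong refl frechet_derivative_rot(2)[OF z \<theta>])
    finally show ?thesis
      unfolding alt_multilinear_shear[OF alt] by (simp add: pullback_def o_def)
  qed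
  have sumint: "(\<lambda>t. (-1) ^ i * (of_real (?\<kappa> (vs ! i)) * ?P us (t + ?\<theta>))) integrable_on {0..2 * pi}" for i us
    using integrable_on_mult_right[OF int, of "(-1) ^ i * of_real (?\<kappa> (vs ! i))" us] by (simp add: mult.assoc)
  have "fiber_average 0 (2 * pi) (pullback rot \<omega>) z vs =
      integral {0..2 * pi} (\<lambda>t. ?P (map (Pair 0) vs) (t + ?\<theta>)) +
      integral {0..2 * pi} (\<lambda>t. \<Sum>i<length vs. (-1) ^ i * (of_real (?\<kappa> (vs ! i)) *
        ?P ((1, 0) # map (Pair 0) (take i vs @ drop (Suc i) vs)) (t + ?\<theta>)))"
    unfolding fiber_average_def pt
    by (rule integral_add[OF int integrable_sum[OF finite_lessThan sumint]])
  also have "integral {0..2 * pi} (\<lambda>t. \<Sum>i<length vs. (-1) ^ i * (of_real (?\<kappa> (vs ! i)) *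
        ?P ((1, 0) # map (Pair 0) (take i vs @ drop (Suc i) vs)) (t + ?\<theta>))) =
      (\<Sum>i<length vs. integral {0..2 * pi} (\<lambda>t. (-1) ^ i * (of_real (?\<kappa> (vs ! i)) *
        ?P ((1, 0) # map (Pair 0) (take i vs @ drop (Suc i) vs)) (t + ?\<theta>))))"
    by (rule integral_sum[OF finite_lessThan sumint])
  also have "integral {0..2 * pi} (\<lambda>t. ?P (map (Pair 0) vs) (t + ?\<theta>)) + \<dots> = fiber_average 0 (2 * pi) (pullback circ \<omega>) z vs +
      (\<Sum>i<length vs. (-1) ^ i * (of_real (?\<kappa> (vs ! i)) *
        fiber_integral 0 (2 * pi) (pullback circ \<omega>) z (take i vs @ drop (Suc i) vs)))"
    by (simp add: shift fiber_average_def fiber_integral_def contract_def mult.assoc[symmetric])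
  also have "(\<Sum>i<length vs. (-1) ^ i * (of_real (?\<kappa> (vs ! i)) *
        fiber_integral 0 (2 * pi) (pullback circ \<omega>) z (take i vs @ drop (Suc i) vs))) =
      wedge angle_form (fiber_integral 0 (2 * pi) (pullback circ \<omega>)) z vs"
    by (subst wedge_one_form) (simp_all add: angle_form_def)
  finally show ?thesis .
qed

text \<open>Both forms are closed across the hypersurface because \<open>circ\<close> takes values
  in \<open>Y\<close> even there. For the fibre integral, the boundary terms at \<open>0\<close> and
  \<open>2 * pi\<close> cancel by periodicity.\<close>

lemma
  assumes \<omega>: "closed_on Y \<omega>"
  shows closed_on_fiber_integral_circ: "closed_on N (fiber_integral 0 (2 * pi) (pullback circ \<omega>))"
    and closed_on_fiber_average_circ: "closed_on N (fiber_average 0 (2 * pi) (pullback circ \<omega>))"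
proof -
  note UN = open_UNIV_Times[OF open_N]
  note p = closed_on_pullback[OF UN open_Y circ_Y smooth_circ \<omega>]
  have sub: "{0..2 * pi} \<times> N \<subseteq> UNIV \<times> N" by auto
  have z: "fiber_average 0 (2 * pi) (ambient_deriv (pullback circ \<omega>)) x vs = 0"
    "fiber_integral 0 (2 * pi) (ambient_deriv (pullback circ \<omega>)) x vs = 0" if "x \<in> N" for x vs
    using closed_onD(2)[OF p] that by (simp_all add: fiber_integral_def fiber_average_def contract_def)
  show "closed_on N (fiber_average 0 (2 * pi) (pullback circ \<omega>))"
    unfolding closed_on_def
    using ambient_form_on_fiber_average[OF UN sub open_N closed_onD(1)[OF p]]
      ambient_deriv_fiber_average[OF UN sub open_N closed_onD(1)[OF p]] z by simp
  have "pullback circ \<omega> (2 * pi, x) us = pullback circ \<omega> (0, x) us" if "x \<in> N" for x us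
    using pullback_circ_periodic[OF that, of \<omega> 0] by simp
  then show "closed_on N (fiber_integral 0 (2 * pi) (pullback circ \<omega>))"
    unfolding closed_on_def
    using ambient_form_on_fiber_integral[OF UN sub open_N closed_onD(1)[OF p]]
      ambient_deriv_fiber_integral[OF UN sub open_N closed_onD(1)[OF p]] z by simp
qed

text \<open>Averaging over the rotations: the primitive is the fibre integral of the pulled back form
  with the weight \<open>1 - t / 2\<pi>\<close>, which vanishes at one end of the period only.\<close>

lemma rot_average_homologous:
  assumes \<omega>: "closed_on Y \<omega>"
  obtains \<tau> where "ambient_form_on Y \<tau>"
    "\<And>x vs. x \<in> Y \<Longrightarrow> pullback (\<lambda>x. rot (0, x)) \<omega> x vs =
      of_real (1 / (2 * pi)) * fiber_average 0 (2 * pi) (pullback rot \<omega>) x vs + ambient_deriv \<tau> x vs"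
proof -
  note UY = open_UNIV_Times[OF open_Y]
  let ?\<Omega> = "pullback rot \<omega>"
  define w :: "real \<times> 'a \<Rightarrow> complex" where "w = (\<lambda>p. of_real (1 - fst p / (2 * pi)))"
  let ?w\<Omega> = "\<lambda>p us. w p * ?\<Omega> p us"
  note p = closed_on_pullback[OF UY open_Y rot_Y smooth_rot \<omega>]
  have sub: "{0..2 * pi} \<times> Y \<subseteq> UNIV \<times> Y" by auto
  have w: "smooth_on (UNIV \<times> Y) w"
    unfolding w_def
    by (intro smooth_on_of_real smooth_on_diff smooth_on_const smooth_on_divide smooth_on_fst smooth_on_ident UY) auto
  have dw: "frechet_derivative w (at q) v = - of_real (fst v / (2 * pi))" for q v
  proof -
    have "(w has_derivative (\<lambda>v. of_real (0 - fst v / (2 * pi)))) (at q)"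
      unfolding w_def
      by (intro bounded_linear.has_derivative[OF bounded_linear_of_real] has_derivative_diff has_derivative_const
          bounded_linear.has_derivative[OF bounded_linear_divide] has_derivative_fst has_derivative_ident)
    then show ?thesis by (simp add: frechet_derivative_eqI)
  qed
  note form = ambient_form_on_mult[OF UY w closed_onD(1)[OF p]]
  note F = ambient_form_on_fiber_integral[OF UY sub open_Y form]
  have "ambient_deriv (fiber_integral 0 (2 * pi) ?w\<Omega>) x vs = - pullback (\<lambda>x. rot (0, x)) \<omega> x vs
      + of_real (1 / (2 * pi)) * fiber_average 0 (2 * pi) ?\<Omega> x vs" if x: "x \<in> Y" for x vs
  proof -
    have mem: "(t, x) \<in> UNIV \<times> Y" for t using x by simp
    have d: "ambient_deriv ?w\<Omega> (t, x) ((1, 0) # map (Pair 0) vs) = of_real (- (1 / (2 * pi))) * ?\<Omega> (t, x) (map (Pair 0) vs)" for t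
    proof -
      have "ambient_deriv ?w\<Omega> (t, x) ((1, 0) # map (Pair 0) vs) = wedge (differential w) ?\<Omega> (t, x) ((1, 0) # map (Pair 0) vs)"
        unfolding ambient_deriv_mult[OF UY w closed_onD(1)[OF p] mem] by (simp add: closed_onD(2)[OF p mem])
      also have "\<dots> = differential w (t, x) [(1, 0)] * ?\<Omega> (t, x) (map (Pair 0) vs)"
        by (subst wedge_one_form)
           (simp_all add: differential_length sum.lessThan_Suc_shift differential_def dw del: sum.lessThan_Suc)
      finally show ?thesis by (simp add: differential_def dw)
    qed
    have "fiber_integral 0 (2 * pi) (ambient_deriv ?w\<Omega>) x vs = of_real (- (1 / (2 * pi))) * fiber_average 0 (2 * pi) ?\<Omega> x vs"
      unfolding fiber_integral_def fiber_average_def contract_def d by (rule integral_mult_right)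
    moreover have "?\<Omega> (0, x) (map (Pair 0) vs) = pullback (\<lambda>x. rot (0, x)) \<omega> x vs"
      by (rule pullback_slice[OF smooth_on_differentiable[OF UY smooth_rot mem]])
    ultimately show ?thesis
      using ambient_deriv_fiber_integral[OF UY sub open_Y form x] by (simp add: w_def)
  qed
  moreover have "ambient_deriv (\<lambda>x vs. -1 * fiber_integral 0 (2 * pi) ?w\<Omega> x vs) x vs =
      - ambient_deriv (fiber_integral 0 (2 * pi) ?w\<Omega>) x vs" if "x \<in> Y" for x vs
    using ambient_deriv_scale[OF open_Y F that, of "-1"] by simp
  ultimately show thesis
    by (intro that[of "\<lambda>x vs. -1 * fiber_integral 0 (2 * pi) ?w\<Omega> x vs"] ambient_form_on_scale open_Y F) simp
qed

lemma smooth_f_Y: "smooth_on Y f" and f_Y: "x \<in> Y \<Longrightarrow> f x \<noteq> 0"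
proof -
  show "smooth_on Y f"
    by (rule smooth_on_subset[OF smooth_f]) (use N_T Y_N in blast)
qed (simp add: Y_def)

lemma smooth_ln_f: "smooth_on Y (\<lambda>y. complex_of_real (ln (cmod (f y))))"
  using f_Y by (intro smooth_on_of_real smooth_on_ln smooth_on_cmod smooth_f_Y open_Y) auto

text \<open>Locally \<open>log f = ln |f| + i arg f\<close>, so \<open>df / f\<close> is
  \<open>d ln |f|\<close> plus \<open>\<i>\<close> times \<open>angle_form\<close>.\<close>

lemma wedge_angle_form:
  assumes "x \<in> Y"
  shows "\<i> * wedge angle_form B x vs = wedge (log_form f) B x vs -
    wedge (differential (\<lambda>y. complex_of_real (ln (cmod (f y))))) B x vs"
proof -
  let ?l = "differential (\<lambda>y. complex_of_real (ln (cmod (f y))))"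
  have "log_form f x us = ?l x us + \<i> * angle_form x us" for us
  proof (cases "length us = 1")
    case True
    have "log_form f x us = frechet_derivative f (at x) (us ! 0) / f x"
      using True by (simp add: log_form_def differential_def divide_inverse)
    also have "\<dots> = of_real (Re (frechet_derivative f (at x) (us ! 0) / f x)) +
        \<i> * of_real (Im (frechet_derivative f (at x) (us ! 0) / f x))"
      by (rule complex_eq)
    also have "of_real (Re (frechet_derivative f (at x) (us ! 0) / f x)) = ?l x us"
      unfolding differential_def frechet_derivative_ln_cmod[OF open_Y smooth_f_Y assms f_Y[OF assms]]
      by (simp only: True if_True simp_thms)
    also have "of_real (Im (frechet_derivative f (at x) (us ! 0) / f x)) = angle_form x us"
      unfolding angle_form_def by (simp only: True if_True simp_thms)
    finally show ?thesis .
  qed (simp add: log_form_def differential_def angle_form_def)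
  then have "log_form f x = (\<lambda>us. ?l x us + \<i> * angle_form x us)" by blast
  then have "wedge (log_form f) B x vs = wedge (\<lambda>x us. ?l x us + \<i> * angle_form x us) B x vs"
    by (intro wedge_cong) auto
  then show ?thesis
    using wedge_scale_left[of "\<lambda>x. \<i>" angle_form B x vs] by (simp add: wedge_add_left)
qed

text \<open>Up to exact forms, \<open>\<omega>\<close> equals its radial projection, and this equals
  its average over rotations. By \<open>fiber_average_rot\<close> that average is a multiple of
  \<open>C\<close> plus \<open>angle_form\<close> wedge \<open>B\<close>; finally the angular form
  is traded for \<open>log_form f\<close>.\<close>

theorem closed_form_decomposition:
  assumes \<omega>: "closed_on Y \<omega>"
  obtains B C \<tau> where "closed_on N B" "closed_on N C" "ambient_form_on Y \<tau>"
    "\<And>x vs. x \<in> Y \<Longrightarrow> \<omega> x vs = C x vs + wedge (log_form f) B x vs + ambient_deriv \<tau> x vs"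
proof -
  define k :: complex where "k = of_real (1 / (2 * pi))"
  define B where "B = fiber_integral 0 (2 * pi) (pullback circ \<omega>)"
  define C where "C = fiber_average 0 (2 * pi) (pullback circ \<omega>)"
  let ?l = "\<lambda>y. complex_of_real (ln (cmod (f y)))"
  have B: "closed_on N B" and C: "closed_on N C"
    unfolding B_def C_def by (rule closed_on_fiber_integral_circ[OF \<omega>] closed_on_fiber_average_circ[OF \<omega>])+
  have BY: "closed_on Y B" using closed_on_subset[OF B Y_N] .
  obtain \<tau>1 where t1: "ambient_form_on Y \<tau>1"
    "\<And>x vs. x \<in> Y \<Longrightarrow> pullback (\<lambda>x. rot (0, x)) \<omega> x vs - \<omega> x vs = ambient_deriv \<tau>1 x vs"
    using closed_homologous_rot[OF \<omega>] by blast
  obtain \<tau>2 where t2: "ambient_form_on Y \<tau>2"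
    "\<And>x vs. x \<in> Y \<Longrightarrow> pullback (\<lambda>x. rot (0, x)) \<omega> x vs =
      k * fiber_average 0 (2 * pi) (pullback rot \<omega>) x vs + ambient_deriv \<tau>2 x vs"
    unfolding k_def by (rule rot_average_homologous[OF \<omega>]) blast
  \<comment> \<open>Since \<open>B\<close> is closed, \<open>d (ln |f| B)\<close> is
    \<open>d ln |f|\<close> wedge \<open>B\<close>, the discrepancy between the angular and the
    logarithmic form.\<close>
  define \<tau>3 where "\<tau>3 = (\<lambda>x vs. (\<i> * k) * (?l x * B x vs))"
  have lB: "ambient_form_on Y (\<lambda>x vs. ?l x * B x vs)"
    by (intro ambient_form_on_mult smooth_ln_f open_Y closed_onD(1)[OF BY])
  have t3: "ambient_form_on Y \<tau>3"
    unfolding \<tau>3_def by (intro ambient_form_on_scale open_Y lB)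
  have d3: "ambient_deriv \<tau>3 x vs = \<i> * k * wedge (differential ?l) B x vs" if "x \<in> Y" for x vs
    unfolding \<tau>3_def using that
    by (simp add: ambient_deriv_scale[OF open_Y lB] ambient_deriv_mult[OF open_Y smooth_ln_f closed_onD(1)[OF BY]]
        closed_onD(2)[OF BY])
  let ?\<tau> = "\<lambda>x vs. (\<tau>2 x vs - \<tau>1 x vs) + \<tau>3 x vs"
  have \<tau>: "ambient_form_on Y ?\<tau>"
    by (intro ambient_form_on_add ambient_form_on_diff open_Y t1 t2 t3)
  \<comment> \<open>The coefficient \<open>- (\<i> * k)\<close> is the factor
    \<open>1 / (2 \<pi> \<i>)\<close> of the residue formula.\<close>
  have fin: "\<omega> x vs = k * C x vs + wedge (log_form f) (\<lambda>x vs. - (\<i> * k) * B x vs) x vs + ambient_deriv ?\<tau> x vs"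
    if x: "x \<in> Y" for x vs
  proof -
    have a: "\<i> * wedge angle_form B x vs = wedge (log_form f) B x vs - wedge (differential ?l) B x vs"
      by (rule wedge_angle_form[OF x])
    have a': "wedge angle_form B x vs = - \<i> * wedge (log_form f) B x vs + \<i> * wedge (differential ?l) B x vs"
      using arg_cong[OF a, of "\<lambda>u. - \<i> * u"] by (simp add: algebra_simps)
    have e1: "\<omega> x vs = k * (C x vs + wedge angle_form B x vs) + (ambient_deriv \<tau>2 x vs - ambient_deriv \<tau>1 x vs)"
      using t1(2)[OF x, of vs] t2(2)[OF x, of vs] fiber_average_rot[OF closed_onD(1)[OF \<omega>] x]
      by (simp add: B_def C_def algebra_simps)
    have e2: "ambient_deriv \<tau>2 x vs - ambient_deriv \<tau>1 x vs = ambient_deriv ?\<tau> x vs - \<i> * k * wedge (differential ?l) B x vs"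
      using d3[OF x] by (simp add: ambient_deriv_add[OF open_Y _ t3 x] ambient_deriv_diff[OF open_Y t2(1) t1(1) x]
          ambient_form_on_diff open_Y t1 t2)
    show ?thesis
      unfolding e1 e2 a' wedge_scale_right[of _ "\<lambda>x. - (\<i> * k)"] by (simp add: algebra_simps)
  qed
  show thesis
  proof (rule that[of "\<lambda>x vs. - (\<i> * k) * B x vs" "\<lambda>x vs. k * C x vs" ?\<tau>])
    show "closed_on N (\<lambda>x vs. - (\<i> * k) * B x vs)" "closed_on N (\<lambda>x vs. k * C x vs)"
      by (intro closed_on_scale open_N B C)+
  qed (use \<tau> fin in auto)
qed

text \<open>Equal to \<open>1\<close> on \<open>X\<close> where \<open>cmod f < R / 2\<close>, and
  to \<open>0\<close> where \<open>cmod f\<close> is at least \<open>R / sqrt 2\<close>. Squares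
  keep it smooth at the zeros of \<open>f\<close>; the denominator could vanish only where
  \<open>f\<close> and \<open>R\<close> are both zero, which does not happen on
  \<open>X\<close>.\<close>

definition bump :: "'a \<Rightarrow> complex" where
  "bump z = (let p = flat_exp ((R z)\<^sup>2 / 2 - (cmod (f z))\<^sup>2); q = flat_exp ((cmod (f z))\<^sup>2 - (R z)\<^sup>2 / 4)
    in of_real (p / (p + q)))"

lemma R_X: "z \<in> X \<Longrightarrow> f z = 0 \<Longrightarrow> 0 < R z"
  by (simp add: R_def X_def proj_f_zero)

lemma smooth_bump: "smooth_on X bump"
proof -
  have s: "smooth_on X (\<lambda>z. flat_exp (g z))" if "smooth_on X g" for g
    by (rule smooth_on_compose[OF open_X open_UNIV _ that smooth_on_flat_exp]) auto
  have sm: "smooth_on X f" "smooth_on X R"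
    using smooth_on_subset[OF smooth_f X_T] smooth_on_subset[OF smooth_R X_T] by auto
  have pos: "flat_exp ((R z)\<^sup>2 / 2 - (cmod (f z))\<^sup>2) + flat_exp ((cmod (f z))\<^sup>2 - (R z)\<^sup>2 / 4) \<noteq> 0" if "z \<in> X" for z
  proof (cases "(cmod (f z))\<^sup>2 < (R z)\<^sup>2 / 2")
    case True
    then have "0 < flat_exp ((R z)\<^sup>2 / 2 - (cmod (f z))\<^sup>2)" by (simp add: flat_exp_pos)
    then show ?thesis using flat_exp_nonneg[of "(cmod (f z))\<^sup>2 - (R z)\<^sup>2 / 4"] by linarith
  next
    case False
    have "0 < (cmod (f z))\<^sup>2 - (R z)\<^sup>2 / 4"
    proof (cases "R z = 0")
      case True
      then have "f z \<noteq> 0" using R_X[OF that] by auto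
      then show ?thesis using True by simp
    next
      case False
      then have "0 < (R z)\<^sup>2" by simp
      then show ?thesis using \<open>\<not> (cmod (f z))\<^sup>2 < (R z)\<^sup>2 / 2\<close> by linarith
    qed
    then have "0 < flat_exp ((cmod (f z))\<^sup>2 - (R z)\<^sup>2 / 4)" by (rule flat_exp_pos)
    then show ?thesis using flat_exp_nonneg[of "(R z)\<^sup>2 / 2 - (cmod (f z))\<^sup>2"] by linarith
  qed
  have "smooth_on X (\<lambda>z. complex_of_real (flat_exp ((R z)\<^sup>2 / 2 - (cmod (f z))\<^sup>2) /
      (flat_exp ((R z)\<^sup>2 / 2 - (cmod (f z))\<^sup>2) + flat_exp ((cmod (f z))\<^sup>2 - (R z)\<^sup>2 / 4))))"
    by (intro smooth_on_of_real smooth_on_divide smooth_on_add s smooth_on_diff smooth_on_power smooth_on_const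
        smooth_on_cmod_power2 sm open_X pos) auto
  then show ?thesis by (simp add: bump_def[abs_def] Let_def)
qed

lemma bump_zero: "(R z)\<^sup>2 / 2 \<le> (cmod (f z))\<^sup>2 \<Longrightarrow> bump z = 0"
  by (simp add: bump_def flat_exp_zero)

lemma bump_one: "z \<in> X \<Longrightarrow> 0 < (R z)\<^sup>2 / 4 - (cmod (f z))\<^sup>2 \<Longrightarrow> bump z = 1"
proof -
  assume "z \<in> X" and h: "0 < (R z)\<^sup>2 / 4 - (cmod (f z))\<^sup>2"
  moreover have "0 \<le> (R z)\<^sup>2" by simp
  ultimately have "0 < flat_exp ((R z)\<^sup>2 / 2 - (cmod (f z))\<^sup>2)"
    by (intro flat_exp_pos) linarith
  with h show ?thesis by (simp add: bump_def flat_exp_zero)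
qed

text \<open>At a point of \<open>U\<close> outside \<open>Y\<close>, \<open>cmod f\<close> is
  positive and at least \<open>R\<close>. The strict inequality \<open>R^2 / 2 < |f|^2\<close> then
  holds on a whole neighbourhood, where \<open>bump\<close> vanishes.\<close>

lemma extend_by_bump:
  assumes \<tau>: "ambient_form_on Y \<tau>"
  shows "ambient_form_on U (\<lambda>x vs. if x \<in> Y then bump x * \<tau> x vs else 0)" (is "ambient_form_on U ?\<mu>")
proof (rule ambient_form_on_local[OF open_U])
  fix x assume x: "x \<in> U"
  show "\<exists>V. open V \<and> x \<in> V \<and> ambient_form_on V ?\<mu>"
  proof (cases "x \<in> Y")
    case True
    have "ambient_form_on Y (\<lambda>x vs. bump x * \<tau> x vs)"
      using Y_U U_X by (intro ambient_form_on_mult open_Y \<tau> smooth_on_subset[OF smooth_bump]) auto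
    then have "ambient_form_on Y ?\<mu>"
      by (rule ambient_form_on_cong[OF open_Y]) auto
    with True open_Y show ?thesis by blast
  next
    case False
    have xT: "x \<in> T" "f x \<noteq> 0" using x U_X X_T by (auto simp: U_def)
    define V where "V = {z \<in> U. 0 < (cmod (f z))\<^sup>2 - (R z)\<^sup>2 / 2}"
    have UT: "U \<subseteq> T" using U_X X_T by auto
    have oV: "open V"
      unfolding V_def
      by (intro open_positive_set open_U continuous_intros continuous_cmod_f continuous_R UT) auto
    have "R x \<le> cmod (f x)" using False xT by (auto simp: Y_def N_def)
    then have "(R x)\<^sup>2 \<le> (cmod (f x))\<^sup>2" using R_nonneg[OF xT(1)] by (intro power_mono)
    moreover have "0 < (cmod (f x))\<^sup>2" using xT by simp
    ultimately have "(R x)\<^sup>2 / 2 < (cmod (f x))\<^sup>2" by linarith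
    with x have "x \<in> V" by (simp add: V_def)
    moreover have "ambient_form_on V ?\<mu>"
      by (rule ambient_form_on_cong[OF oV ambient_form_on_zero[OF oV]]) (auto simp: V_def bump_zero fun_eq_iff)
    ultimately show ?thesis using oV by blast
  qed
qed

theorem residue_decomposition:
  assumes surj: "\<And>B. closed_on N B \<Longrightarrow> \<exists>\<beta> \<sigma>. closed_on X \<beta> \<and> ambient_form_on N \<sigma> \<and>
      (\<forall>x\<in>N. \<forall>vs. B x vs - \<beta> x vs = ambient_deriv \<sigma> x vs)"
    and \<omega>: "closed_on U \<omega>"
  obtains \<beta> \<xi> \<mu> where "closed_on X \<beta>" "closed_on X \<xi>" "ambient_form_on U \<mu>"
    "\<And>x vs. x \<in> U \<Longrightarrow> \<omega> x vs = \<xi> x vs + wedge (log_form f) \<beta> x vs + ambient_deriv \<mu> x vs"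
proof -
  obtain B C \<tau> where B: "closed_on N B" and C: "closed_on N C" and \<tau>: "ambient_form_on Y \<tau>"
    and dec: "\<And>x vs. x \<in> Y \<Longrightarrow> \<omega> x vs = C x vs + wedge (log_form f) B x vs + ambient_deriv \<tau> x vs"
    using closed_form_decomposition[OF closed_on_subset[OF \<omega> Y_U]] by blast
  obtain \<beta> \<sigma> where \<beta>: "closed_on X \<beta>" and \<sigma>: "ambient_form_on N \<sigma>"
    and B\<beta>: "\<And>x vs. x \<in> N \<Longrightarrow> B x vs - \<beta> x vs = ambient_deriv \<sigma> x vs"
    using surj[OF B] by blast
  have fU: "smooth_on U f" "\<And>x. x \<in> U \<Longrightarrow> f x \<noteq> 0"
    using smooth_on_subset[OF smooth_f, of U] U_X X_T by (auto simp: U_def)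
  have logU: "closed_on U (log_form f)"
    unfolding closed_on_def
    using ambient_form_on_log_form[OF open_U fU] ambient_deriv_log_form[OF open_U fU] by blast
  have logY: "closed_on Y (log_form f)" by (rule closed_on_subset[OF logU Y_U])
  have \<sigma>Y: "ambient_form_on Y \<sigma>" using ambient_form_on_subset[OF \<sigma> Y_N] .
  \<comment> \<open>The derivative of \<open>log_form f\<close> wedge \<open>\<sigma>\<close> is
    minus \<open>log_form f\<close> wedge \<open>d \<sigma>\<close>. Subtracting this product from
    the primitive therefore pays for replacing \<open>B\<close> by \<open>\<beta>\<close>.\<close>
  define \<tau>' where "\<tau>' = (\<lambda>x vs. \<tau> x vs - wedge (log_form f) \<sigma> x vs)"
  have \<tau>': "ambient_form_on Y \<tau>'"
    unfolding \<tau>'_def by (intro ambient_form_on_diff ambient_form_on_wedge open_Y \<tau> closed_onD(1)[OF logY] \<sigma>Y)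
  have d\<tau>': "ambient_deriv \<tau>' x vs = ambient_deriv \<tau> x vs + wedge (log_form f) (ambient_deriv \<sigma>) x vs" if x: "x \<in> Y" for x vs
  proof -
    have "wedge (ambient_deriv (log_form f)) \<sigma> x vs = wedge (\<lambda>x vs. 0) \<sigma> x vs"
      by (rule wedge_cong) (use closed_onD(2)[OF logY x] in auto)
    moreover have "parity (log_form f) = (\<lambda>x vs. - log_form f x vs)"
      by (auto simp: parity_def log_form_def differential_def fun_eq_iff)
    ultimately show ?thesis
      using x by (simp add: \<tau>'_def ambient_deriv_diff[OF open_Y \<tau>] ambient_form_on_wedge open_Y closed_onD(1)[OF logY] \<sigma>Y
          ambient_deriv_wedge[OF open_Y closed_onD(1)[OF logY] \<sigma>Y] wedge_zero_left wedge_minus_left)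
  qed
  have dec': "\<omega> x vs = C x vs + wedge (log_form f) \<beta> x vs + ambient_deriv \<tau>' x vs" if x: "x \<in> Y" for x vs
  proof -
    have "wedge (log_form f) B x vs = wedge (log_form f) (\<lambda>x vs. \<beta> x vs + ambient_deriv \<sigma> x vs) x vs"
      using x Y_N by (intro wedge_cong) (auto simp: B\<beta>[symmetric])
    then show ?thesis using dec[OF x, of vs] d\<tau>'[OF x, of vs] by (simp add: wedge_add_right)
  qed
  define \<mu> where "\<mu> = (\<lambda>x vs. if x \<in> Y then bump x * \<tau>' x vs else 0)"
  have \<mu>: "ambient_form_on U \<mu>" unfolding \<mu>_def by (rule extend_by_bump[OF \<tau>'])
  \<comment> \<open>A neighbourhood of the hypersurface on which \<open>bump\<close> is identically
    \<open>1\<close>, so that \<open>\<mu>\<close> and \<open>\<tau>'\<close> have the same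
    derivative on its punctured part.\<close>
  define M where "M = {z \<in> X. 0 < (R z)\<^sup>2 / 4 - (cmod (f z))\<^sup>2}"
  have oM: "open M"
    unfolding M_def
    by (intro open_positive_set open_X continuous_intros continuous_cmod_f continuous_R X_T) auto
  have MN: "M \<subseteq> N"
  proof
    fix z assume z: "z \<in> M"
    then have zT: "z \<in> T" using X_T by (auto simp: M_def)
    have "4 * (cmod (f z))\<^sup>2 < (R z)\<^sup>2" using z by (simp add: M_def)
    moreover have "0 \<le> (cmod (f z))\<^sup>2" by simp
    ultimately have "(cmod (f z))\<^sup>2 < (R z)\<^sup>2" by linarith
    then have "cmod (f z) < R z" using R_nonneg[OF zT] by (rule power_less_imp_less_base)
    with zT show "z \<in> N" by (simp add: N_def)
  qed
  define \<xi>0 where "\<xi>0 = (\<lambda>x vs. \<omega> x vs - wedge (log_form f) \<beta> x vs - ambient_deriv \<mu> x vs)"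
  have \<beta>U: "closed_on U \<beta>" by (rule closed_on_subset[OF \<beta> U_X])
  have \<xi>0: "closed_on U \<xi>0"
    unfolding \<xi>0_def by (intro closed_on_diff closed_on_wedge closed_on_ambient_deriv open_U \<omega> logU \<beta>U \<mu>)
  have agree: "C x = \<xi>0 x" if x: "x \<in> M" "f x \<noteq> 0" for x
  proof -
    have xY: "x \<in> Y" using x MN by (auto simp: Y_def)
    have "ambient_deriv \<mu> x = ambient_deriv \<tau>' x"
    proof (rule ambient_deriv_cong[of "M \<inter> Y"])
      show "\<mu> y = \<tau>' y" if "y \<in> M \<inter> Y" for y
        using that bump_one[of y] by (auto simp: \<mu>_def M_def)
    qed (use oM open_Y x xY in auto)
    then show ?thesis using dec'[OF xY] by (simp add: \<xi>0_def fun_eq_iff)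
  qed
  \<comment> \<open>\<open>C\<close> is closed across the hypersurface and agrees with
    \<open>\<xi>0\<close> on the rest of \<open>M\<close>, so the gluing extends
    \<open>\<xi>0\<close> to a closed form on \<open>X\<close>.\<close>
  define \<xi> where "\<xi> = (\<lambda>x. if x \<in> M then C x else \<xi>0 x)"
  have "closed_on X \<xi>"
  proof (rule closed_on_local[OF open_X])
    fix x assume x: "x \<in> X"
    show "\<exists>V. open V \<and> x \<in> V \<and> closed_on V \<xi>"
    proof (cases "f x = 0")
      case True
      have "x \<in> M" using x R_X[OF x True] True by (simp add: M_def)
      moreover have "closed_on M \<xi>"
        by (rule closed_on_cong[OF oM closed_on_subset[OF C MN]]) (simp add: \<xi>_def)
      ultimately show ?thesis using oM by blast
    next
      case False
      have "closed_on U \<xi>"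
        by (rule closed_on_cong[OF open_U \<xi>0]) (use agree in \<open>auto simp: \<xi>_def U_def\<close>)
      then show ?thesis using False x open_U by (auto simp: U_def)
    qed
  qed
  moreover have "\<omega> x vs = \<xi> x vs + wedge (log_form f) \<beta> x vs + ambient_deriv \<mu> x vs" if "x \<in> U" for x vs
    using that agree[of x] by (auto simp: \<xi>_def \<xi>0_def U_def fun_eq_iff split: if_splits)
  ultimately show thesis using that \<beta> \<mu> by blast
qed

end

section \<open>De Rham classes on open sets\<close>

lemma smooth_on_affine: "open I \<Longrightarrow> smooth_on I (\<lambda>t::real. x + t *\<^sub>R v)"
  by (intro smooth_on_add smooth_on_scaleR smooth_on_const smooth_on_ident)

text \<open>The image under \<open>h\<close> of a short straight line through \<open>x\<close> is a
  smooth curve in \<open>S\<close> with this velocity.\<close>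

lemma frechet_derivative_in_tangent_space:
  assumes "open V" "x \<in> V" "h ` V \<subseteq> S" "smooth_on V h"
  shows "frechet_derivative h (at x) v \<in> tangent_space S (h x)"
proof -
  have "isCont (\<lambda>t::real. x + t *\<^sub>R v) 0" by (intro continuous_intros)
  moreover have "open V" "x + 0 *\<^sub>R v \<in> V" using assms by auto
  ultimately obtain e where e: "0 < e" "\<And>t::real. dist t 0 < e \<Longrightarrow> x + t *\<^sub>R v \<in> V"
    unfolding continuous_at_open eventually_at_topological
    by (metis (no_types, lifting) continuous_at_avoid[of 0 "\<lambda>t::real. x + t *\<^sub>R v"] dist_commute
        continuous_at_open open_contains_ball mem_ball subsetD)
  let ?\<gamma> = "\<lambda>t::real. h (x + t *\<^sub>R v)"
  have V: "x + t *\<^sub>R v \<in> V" if "t \<in> {-e<..<e}" for t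
    using that by (intro e) (auto simp: dist_real_def)
  have "smooth_on {-e<..<e} ?\<gamma>"
    using V by (intro smooth_on_compose[OF _ assms(1) _ smooth_on_affine assms(4)]) auto
  moreover have "?\<gamma> ` {-e<..<e} \<subseteq> S" using V assms(3) by auto
  moreover have "(?\<gamma> has_vector_derivative frechet_derivative h (at x) v) (at 0)"
  proof -
    have d: "(h has_derivative frechet_derivative h (at x)) (at (x + 0 *\<^sub>R v))"
      using smooth_on_has_derivative[OF assms(1,4,2)] by simp
    have "((\<lambda>t::real. x + t *\<^sub>R v) has_derivative (\<lambda>s. s *\<^sub>R v)) (at 0)"
      by (auto intro!: derivative_eq_intros)
    from has_derivative_compose[OF this d] show ?thesis
      unfolding has_vector_derivative_def
      by (elim has_derivative_eq_rhs) (simp add: fun_eq_iff linear_scale[OF has_derivative_linear[OF d]])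
  qed
  ultimately show ?thesis
    unfolding tangent_space_def using e(1) by (auto intro!: exI[of _ ?\<gamma>] exI[of _ e])
qed

lemma tangent_space_open:
  assumes "open S" "x \<in> S"
  shows "tangent_space S x = UNIV"
proof -
  have "frechet_derivative (\<lambda>y. y) (at x) v \<in> tangent_space S x" for v
    using assms by (intro frechet_derivative_in_tangent_space[of S x "\<lambda>y. y" S, simplified]) (auto intro: smooth_on_ident)
  then show ?thesis by auto
qed

lemma restrict_form_open: "open S \<Longrightarrow> restrict_form S \<omega> x vs = (if x \<in> S then \<omega> x vs else 0)"
  by (simp add: restrict_form_def tangent_space_open)

lemma local_extension_openD:
  assumes "open S" "x \<in> S" "local_extension S \<omega> x \<eta>"
  obtains V where "open V" "x \<in> V" "V \<subseteq> S" "ambient_form_on V \<eta>" "\<And>y. y \<in> V \<Longrightarrow> \<eta> y = \<omega> y"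
proof -
  obtain V where V: "open V" "x \<in> V" "ambient_form_on V \<eta>"
    "\<And>y vs. y \<in> S \<inter> V \<Longrightarrow> set vs \<subseteq> tangent_space S y \<Longrightarrow> \<omega> y vs = \<eta> y vs"
    using assms(3) unfolding local_extension_def by blast
  show thesis
    by (rule that[of "S \<inter> V"])
       (use assms V in \<open>auto simp: fun_eq_iff tangent_space_open intro: ambient_form_on_subset\<close>)
qed

lemma local_extension_open: "open S \<Longrightarrow> x \<in> S \<Longrightarrow> ambient_form_on S \<omega> \<Longrightarrow> local_extension S \<omega> x \<omega>"
  unfolding local_extension_def by blast

text \<open>On an open set every vector is tangent, so a local extension agrees with the form itself
  near the point.\<close>

lemma forms_open_iff:
  assumes S: "open S"
  shows "\<omega> \<in> forms S \<longleftrightarrow> ambient_form_on S \<omega> \<and> restrict_form S \<omega> = \<omega>"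
proof
  assume \<omega>: "\<omega> \<in> forms S"
  have "ambient_form_on S \<omega>"
  proof (rule ambient_form_on_local[OF S])
    fix x assume x: "x \<in> S"
    then obtain \<eta> where "local_extension S \<omega> x \<eta>" using \<omega> by (auto simp: forms_def)
    then obtain V where V: "open V" "x \<in> V" "V \<subseteq> S" "ambient_form_on V \<eta>" "\<And>y. y \<in> V \<Longrightarrow> \<eta> y = \<omega> y"
      using local_extension_openD[OF S x] by metis
    then show "\<exists>V. open V \<and> x \<in> V \<and> ambient_form_on V \<omega>"
      using ambient_form_on_cong[OF V(1,4), of \<omega>] by auto
  qed
  with \<omega> show "ambient_form_on S \<omega> \<and> restrict_form S \<omega> = \<omega>" by (simp add: forms_def)
qed (auto simp: forms_def intro: local_extension_open[OF S])

lemma restrict_form_idem: "restrict_form S (restrict_form S \<omega>) = restrict_form S \<omega>"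
  by (simp add: restrict_form_def fun_eq_iff)

lemma restrict_form_in_forms:
  assumes S: "open S" and \<omega>: "ambient_form_on S \<omega>"
  shows "restrict_form S \<omega> \<in> forms S"
  unfolding forms_open_iff[OF S] restrict_form_idem
  by (intro conjI refl ambient_form_on_cong[OF S \<omega>]) (simp add: restrict_form_open[OF S] fun_eq_iff)

text \<open>Whatever extension \<open>SOME\<close> picks, it coincides with \<open>\<omega>\<close>
  near \<open>x\<close>, and the derivative at \<open>x\<close> depends on nothing else.\<close>

lemma ext_deriv_open:
  assumes S: "open S" and \<omega>: "ambient_form_on S \<omega>"
  shows "ext_deriv S \<omega> = restrict_form S (ambient_deriv \<omega>)"
proof (intro ext)
  fix x vs
  show "ext_deriv S \<omega> x vs = restrict_form S (ambient_deriv \<omega>) x vs"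
  proof (cases "x \<in> S")
    case True
    define \<eta> where "\<eta> = (SOME \<eta>. local_extension S \<omega> x \<eta>)"
    have "local_extension S \<omega> x \<eta>"
      unfolding \<eta>_def
      by (rule someI[where P = "local_extension S \<omega> x", OF local_extension_open[OF S True \<omega>]])
    then obtain V where V: "open V" "x \<in> V" "V \<subseteq> S" "\<And>y. y \<in> V \<Longrightarrow> \<eta> y = \<omega> y"
      using local_extension_openD[OF S True] by metis
    have "ambient_deriv \<eta> x = ambient_deriv \<omega> x"
      by (rule ambient_deriv_cong[OF V(1,2,4)])
    then show ?thesis
      by (simp add: ext_deriv_def restrict_form_open[OF S] \<eta>_def)
  qed (simp add: ext_deriv_def restrict_form_open[OF S])
qed

lemma restrict_form_eq_zero_iff:
  "open S \<Longrightarrow> restrict_form S \<eta> = (\<lambda>x vs. 0) \<longleftrightarrow> (\<forall>x\<in>S. \<forall>vs. \<eta> x vs = 0)"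
  by (auto simp: restrict_form_open fun_eq_iff split: if_splits)

lemma closed_forms_open_iff:
  assumes S: "open S"
  shows "\<omega> \<in> closed_forms S \<longleftrightarrow> closed_on S \<omega> \<and> restrict_form S \<omega> = \<omega>"
  unfolding closed_forms_def closed_on_def
  by (auto simp: forms_open_iff[OF S] ext_deriv_open[OF S] restrict_form_eq_zero_iff[OF S])

lemma closed_on_restrict_form: "open S \<Longrightarrow> closed_on S \<omega> \<Longrightarrow> closed_on S (restrict_form S \<omega>)"
  by (rule closed_on_cong[of S \<omega>]) (simp_all add: restrict_form_open fun_eq_iff)

lemma restrict_form_closed: "open S \<Longrightarrow> closed_on S \<omega> \<Longrightarrow> restrict_form S \<omega> \<in> closed_forms S"
  by (simp add: closed_forms_open_iff closed_on_restrict_form restrict_form_idem)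

lemma exact_forms_open_iff:
  assumes S: "open S"
  shows "\<omega> \<in> exact_forms S \<longleftrightarrow> (\<exists>\<eta>. ambient_form_on S \<eta> \<and> \<omega> = restrict_form S (ambient_deriv \<eta>))"
proof
  assume "\<omega> \<in> exact_forms S"
  then show "\<exists>\<eta>. ambient_form_on S \<eta> \<and> \<omega> = restrict_form S (ambient_deriv \<eta>)"
    by (auto simp: exact_forms_def forms_open_iff[OF S] ext_deriv_open[OF S])
next
  assume "\<exists>\<eta>. ambient_form_on S \<eta> \<and> \<omega> = restrict_form S (ambient_deriv \<eta>)"
  then obtain \<eta> where \<eta>: "ambient_form_on S \<eta>" "\<omega> = restrict_form S (ambient_deriv \<eta>)" by blast
  have f: "restrict_form S \<eta> \<in> forms S" by (rule restrict_form_in_forms[OF S \<eta>(1)])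
  have "ambient_deriv (restrict_form S \<eta>) x = ambient_deriv \<eta> x" if "x \<in> S" for x
    by (rule ambient_deriv_cong[OF S that]) (simp add: restrict_form_open[OF S] fun_eq_iff)
  then have "\<omega> = ext_deriv S (restrict_form S \<eta>)"
    using f by (simp add: \<eta>(2) ext_deriv_open[OF S] forms_open_iff[OF S])
      (simp add: restrict_form_open[OF S] fun_eq_iff)
  with f show "\<omega> \<in> exact_forms S" by (auto simp: exact_forms_def)
qed

section \<open>Exact forms and the operations on classes\<close>

lemma exact_forms_add:
  assumes S: "open S" and "\<alpha> \<in> exact_forms S" "\<beta> \<in> exact_forms S"
  shows "(\<lambda>x vs. \<alpha> x vs + \<beta> x vs) \<in> exact_forms S"
proof -
  obtain \<eta> \<zeta> where "ambient_form_on S \<eta>" "\<alpha> = restrict_form S (ambient_deriv \<eta>)"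
    "ambient_form_on S \<zeta>" "\<beta> = restrict_form S (ambient_deriv \<zeta>)"
    using assms by (auto simp: exact_forms_open_iff)
  then show ?thesis
    unfolding exact_forms_open_iff[OF S]
    by (intro exI[of _ "\<lambda>x vs. \<eta> x vs + \<zeta> x vs"])
       (simp add: ambient_form_on_add[OF S] restrict_form_open[OF S] ambient_deriv_add[OF S] fun_eq_iff)
qed

lemma exact_forms_scale:
  assumes S: "open S" and "\<alpha> \<in> exact_forms S"
  shows "(\<lambda>x vs. a * \<alpha> x vs) \<in> exact_forms S"
proof -
  obtain \<eta> where "ambient_form_on S \<eta>" "\<alpha> = restrict_form S (ambient_deriv \<eta>)"
    using assms by (auto simp: exact_forms_open_iff)
  then show ?thesis
    unfolding exact_forms_open_iff[OF S]
    by (intro exI[of _ "\<lambda>x vs. a * \<eta> x vs"])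
       (simp add: ambient_form_on_scale[OF S] restrict_form_open[OF S] ambient_deriv_scale[OF S] fun_eq_iff)
qed

lemma exact_forms_zero: "open S \<Longrightarrow> (\<lambda>x vs. 0) \<in> exact_forms S"
  unfolding exact_forms_open_iff
  by (intro exI[of _ "\<lambda>x vs. 0"])
     (simp add: ambient_form_on_zero restrict_form_open fun_eq_iff ambient_deriv_def)

lemma de_rham_class_eqI:
  assumes S: "open S" and "(\<lambda>x vs. \<alpha> x vs - \<beta> x vs) \<in> exact_forms S"
  shows "de_rham_class S \<alpha> = de_rham_class S \<beta>"
proof -
  have "(\<lambda>x vs. \<omega> x vs - \<beta> x vs) \<in> exact_forms S" if "(\<lambda>x vs. \<omega> x vs - \<alpha> x vs) \<in> exact_forms S" for \<omega>
    using exact_forms_add[OF S that assms(2)] by simp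
  moreover have "(\<lambda>x vs. \<omega> x vs - \<alpha> x vs) \<in> exact_forms S" if "(\<lambda>x vs. \<omega> x vs - \<beta> x vs) \<in> exact_forms S" for \<omega>
    using exact_forms_add[OF S that exact_forms_scale[OF S assms(2), of "-1"]] by simp
  ultimately show ?thesis by (auto simp: de_rham_class_def)
qed

lemma de_rham_class_refl: "open S \<Longrightarrow> \<omega> \<in> closed_forms S \<Longrightarrow> \<omega> \<in> de_rham_class S \<omega>"
  by (simp add: de_rham_class_def exact_forms_zero)

lemma de_rham_classD:
  "\<omega>' \<in> de_rham_class S \<omega> \<Longrightarrow> \<omega>' \<in> closed_forms S"
  "\<omega>' \<in> de_rham_class S \<omega> \<Longrightarrow> (\<lambda>x vs. \<omega>' x vs - \<omega> x vs) \<in> exact_forms S"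
  by (auto simp: de_rham_class_def)

text \<open>With \<open>a - \<alpha> = d \<eta>\<close> and \<open>b - \<beta> = d \<zeta>\<close>
  on \<open>S\<close>, a primitive is \<open>\<eta>\<close> wedge \<open>b\<close> plus
  \<open>parity \<alpha>\<close> wedge \<open>\<zeta>\<close>. The normalisation of the first
  factors makes both products vanish outside \<open>S\<close>.\<close>

lemma exact_forms_wedge_diff:
  assumes S: "open S" and closed: "closed_on S a" "closed_on S \<alpha>" "closed_on S b" "closed_on S \<beta>"
    and "(\<lambda>x vs. a x vs - \<alpha> x vs) \<in> exact_forms S" "(\<lambda>x vs. b x vs - \<beta> x vs) \<in> exact_forms S"
    and out: "restrict_form S a = a" "restrict_form S \<alpha> = \<alpha>"
  shows "(\<lambda>x vs. wedge a b x vs - wedge \<alpha> \<beta> x vs) \<in> exact_forms S"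
proof -
  obtain \<eta> \<zeta> where \<eta>: "ambient_form_on S \<eta>" and a: "(\<lambda>x vs. a x vs - \<alpha> x vs) = restrict_form S (ambient_deriv \<eta>)"
    and \<zeta>: "ambient_form_on S \<zeta>" and b: "(\<lambda>x vs. b x vs - \<beta> x vs) = restrict_form S (ambient_deriv \<zeta>)"
    using assms by (auto simp: exact_forms_open_iff)
  note form = closed[THEN closed_onD(1)]
  let ?\<mu> = "\<lambda>x vs. wedge \<eta> b x vs + wedge (parity \<alpha>) \<zeta> x vs"
  have p: "ambient_form_on S (parity \<alpha>)" by (intro ambient_form_on_parity S form)
  have "ambient_deriv ?\<mu> x vs = wedge a b x vs - wedge \<alpha> \<beta> x vs" if x: "x \<in> S" for x vs
  proof -
    have "wedge (parity \<eta>) (ambient_deriv b) x vs = wedge (parity \<eta>) (\<lambda>x vs. 0) x vs"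
      by (rule wedge_cong) (simp_all add: fun_eq_iff closed_onD(2)[OF closed(3) x])
    moreover have "ambient_deriv (parity \<alpha>) x us = 0" for us
      using ambient_deriv_parity[OF S form(2) x, of us] closed_onD(2)[OF closed(2) x, of us]
      by (simp add: parity_def[of "ambient_deriv \<alpha>"])
    then have "wedge (ambient_deriv (parity \<alpha>)) \<zeta> x vs = wedge (\<lambda>x vs. 0) \<zeta> x vs"
      by (intro wedge_cong) (simp_all add: fun_eq_iff)
    moreover have "wedge a b x vs = wedge (\<lambda>x vs. \<alpha> x vs + ambient_deriv \<eta> x vs) b x vs"
      using fun_cong[OF fun_cong[OF a], of x] x
      by (intro wedge_cong) (auto simp: fun_eq_iff restrict_form_open[OF S] algebra_simps)
    moreover have "wedge \<alpha> b x vs = wedge \<alpha> (\<lambda>x vs. \<beta> x vs + ambient_deriv \<zeta> x vs) x vs"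
      using fun_cong[OF fun_cong[OF b], of x] x
      by (intro wedge_cong) (auto simp: fun_eq_iff restrict_form_open[OF S] algebra_simps)
    ultimately show ?thesis
      by (simp add: ambient_deriv_add[OF S _ _ x] ambient_form_on_wedge S \<eta> \<zeta> form p
          ambient_deriv_wedge[OF S _ _ x] wedge_zero_left wedge_zero_right parity_parity wedge_add_left wedge_add_right)
  qed
  moreover have "wedge a b x vs = 0" "wedge \<alpha> \<beta> x vs = 0" if "x \<notin> S" for x vs
  proof -
    have "a x = (\<lambda>us. 0)" "\<alpha> x = (\<lambda>us. 0)"
      using fun_cong[OF out(1), of x] fun_cong[OF out(2), of x] that
      by (auto simp: restrict_form_open[OF S] fun_eq_iff)
    then show "wedge a b x vs = 0" "wedge \<alpha> \<beta> x vs = 0"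
      by (simp_all add: wedge_def)
  qed
  ultimately have "(\<lambda>x vs. wedge a b x vs - wedge \<alpha> \<beta> x vs) = restrict_form S (ambient_deriv ?\<mu>)"
    by (simp add: restrict_form_open[OF S] fun_eq_iff)
  moreover have "ambient_form_on S ?\<mu>"
    by (intro ambient_form_on_add ambient_form_on_wedge S \<eta> \<zeta> form p)
  ultimately show ?thesis
    unfolding exact_forms_open_iff[OF S] by blast
qed

text \<open>Working representatives may be arbitrary outside \<open>S\<close>, so they are
  normalised before the class is taken.\<close>

abbreviation cls :: "'a::euclidean_space set \<Rightarrow> 'a form \<Rightarrow> 'a form set" where
  "cls S \<omega> \<equiv> de_rham_class S (restrict_form S \<omega>)"

lemma cls_exact_diff:
  assumes S: "open S" and \<eta>: "ambient_form_on S \<eta>"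
    and "\<And>x vs. x \<in> S \<Longrightarrow> \<omega> x vs = \<omega>' x vs + ambient_deriv \<eta> x vs"
  shows "cls S \<omega> = cls S \<omega>'"
proof (rule de_rham_class_eqI[OF S])
  have "(\<lambda>x vs. restrict_form S \<omega> x vs - restrict_form S \<omega>' x vs) = restrict_form S (ambient_deriv \<eta>)"
    using assms(3) by (auto simp: restrict_form_open[OF S] fun_eq_iff)
  then show "(\<lambda>x vs. restrict_form S \<omega> x vs - restrict_form S \<omega>' x vs) \<in> exact_forms S"
    unfolding exact_forms_open_iff[OF S] using \<eta> by blast
qed

lemma carrier_de_rham_algebra:
  assumes S: "open S"
  shows "carrier (de_rham_algebra S) = cls S ` {\<omega>. closed_on S \<omega>}"
proof -
  have "closed_forms S = restrict_form S ` {\<omega>. closed_on S \<omega>}"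
    using restrict_form_closed[OF S] closed_forms_open_iff[OF S]
    by (auto simp: image_iff) metis
  then show ?thesis by (simp add: de_rham_algebra_def image_image)
qed

text \<open>The operations of \<open>de_rham_algebra\<close> are unions over representatives;
  independence of the representatives collapses such a union to a single class.\<close>

lemma UN_UN_const:
  assumes "a \<in> A" "b \<in> B" "\<And>x y. x \<in> A \<Longrightarrow> y \<in> B \<Longrightarrow> F x y = C"
  shows "(\<Union>x\<in>A. \<Union>y\<in>B. F x y) = C"
  using assms by auto

lemma de_rham_mult:
  assumes S: "open S" and closed: "closed_on S \<alpha>" "closed_on S \<beta>"
  shows "cls S \<alpha> \<otimes>\<^bsub>de_rham_algebra S\<^esub> cls S \<beta> = cls S (wedge \<alpha> \<beta>)"
proof -
  let ?\<alpha> = "restrict_form S \<alpha>" and ?\<beta> = "restrict_form S \<beta>"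
  have c: "?\<alpha> \<in> closed_forms S" "?\<beta> \<in> closed_forms S"
    by (intro restrict_form_closed S closed)+
  have "wedge ?\<alpha> ?\<beta> = restrict_form S (wedge \<alpha> \<beta>)"
    by (auto simp: fun_eq_iff restrict_form_open[OF S] wedge_def)
  moreover have "(\<Union>a\<in>cls S \<alpha>. \<Union>b\<in>cls S \<beta>. de_rham_class S (wedge a b)) = de_rham_class S (wedge ?\<alpha> ?\<beta>)"
  proof (rule UN_UN_const[OF de_rham_class_refl[OF S c(1)] de_rham_class_refl[OF S c(2)]])
    fix a b assume a: "a \<in> cls S \<alpha>" and b: "b \<in> cls S \<beta>"
    have "closed_on S a" "closed_on S b" "restrict_form S a = a"
      using de_rham_classD(1)[OF a] de_rham_classD(1)[OF b] by (simp_all add: closed_forms_open_iff[OF S])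
    with c de_rham_classD(2)[OF a] de_rham_classD(2)[OF b]
    show "de_rham_class S (wedge a b) = de_rham_class S (wedge ?\<alpha> ?\<beta>)"
      by (intro de_rham_class_eqI[OF S] exact_forms_wedge_diff[OF S])
         (simp_all add: closed_forms_open_iff[OF S] restrict_form_idem)
  qed
  ultimately show ?thesis by (simp add: de_rham_algebra_def)
qed

lemma de_rham_add:
  assumes S: "open S" and closed: "closed_on S \<alpha>" "closed_on S \<beta>"
  shows "cls S \<alpha> \<oplus>\<^bsub>de_rham_algebra S\<^esub> cls S \<beta> = cls S (\<lambda>x vs. \<alpha> x vs + \<beta> x vs)"
proof -
  let ?\<alpha> = "restrict_form S \<alpha>" and ?\<beta> = "restrict_form S \<beta>"
  have c: "?\<alpha> \<in> closed_forms S" "?\<beta> \<in> closed_forms S"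
    by (intro restrict_form_closed S closed)+
  have "(\<lambda>x vs. ?\<alpha> x vs + ?\<beta> x vs) = restrict_form S (\<lambda>x vs. \<alpha> x vs + \<beta> x vs)"
    by (auto simp: fun_eq_iff restrict_form_open[OF S])
  moreover have "(\<Union>a\<in>cls S \<alpha>. \<Union>b\<in>cls S \<beta>. de_rham_class S (\<lambda>x vs. a x vs + b x vs)) =
      de_rham_class S (\<lambda>x vs. ?\<alpha> x vs + ?\<beta> x vs)"
  proof (rule UN_UN_const[OF de_rham_class_refl[OF S c(1)] de_rham_class_refl[OF S c(2)]])
    fix a b assume ab: "a \<in> cls S \<alpha>" "b \<in> cls S \<beta>"
    show "de_rham_class S (\<lambda>x vs. a x vs + b x vs) = de_rham_class S (\<lambda>x vs. ?\<alpha> x vs + ?\<beta> x vs)"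
      using exact_forms_add[OF S de_rham_classD(2)[OF ab(1)] de_rham_classD(2)[OF ab(2)]]
      by (intro de_rham_class_eqI[OF S]) (simp add: algebra_simps)
  qed
  ultimately show ?thesis by (simp add: de_rham_algebra_def)
qed

lemma de_rham_smult:
  assumes S: "open S" and closed: "closed_on S \<alpha>"
  shows "c \<odot>\<^bsub>de_rham_algebra S\<^esub> cls S \<alpha> = cls S (\<lambda>x vs. c * \<alpha> x vs)"
proof -
  let ?\<alpha> = "restrict_form S \<alpha>"
  have cl: "?\<alpha> \<in> closed_forms S"
    by (intro restrict_form_closed S closed)
  have "(\<lambda>x vs. c * ?\<alpha> x vs) = restrict_form S (\<lambda>x vs. c * \<alpha> x vs)"
    by (auto simp: fun_eq_iff restrict_form_open[OF S])
  moreover have "de_rham_class S (\<lambda>x vs. c * a x vs) = de_rham_class S (\<lambda>x vs. c * ?\<alpha> x vs)" if "a \<in> cls S \<alpha>" for a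
    using exact_forms_scale[OF S de_rham_classD(2)[OF that], of c]
    by (intro de_rham_class_eqI[OF S]) (simp add: algebra_simps)
  then have "(\<Union>a\<in>cls S \<alpha>. de_rham_class S (\<lambda>x vs. c * a x vs)) = de_rham_class S (\<lambda>x vs. c * ?\<alpha> x vs)"
    using de_rham_class_refl[OF S cl] by blast
  ultimately show ?thesis by (simp add: de_rham_algebra_def)
qed

lemma closed_on_unit_form:
  assumes S: "open S"
  shows "closed_on S unit_form"
proof -
  have u: "unit_form = zero_form (\<lambda>x. 1)"
    by (simp add: unit_form_def zero_form_def fun_eq_iff)
  show ?thesis
    unfolding closed_on_def u ambient_deriv_zero_form
    using ambient_form_on_zero_form[OF S smooth_on_const[OF S]] by (simp add: differential_def)
qed

lemma closed_on_zero: "open S \<Longrightarrow> closed_on S (\<lambda>x vs. 0)"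
  by (simp add: closed_on_def ambient_form_on_zero ambient_deriv_def)

lemma de_rham_one: "\<one>\<^bsub>de_rham_algebra S\<^esub> = cls S unit_form"
  by (simp add: de_rham_algebra_def)

lemma de_rham_zero: "\<zero>\<^bsub>de_rham_algebra S\<^esub> = cls S (\<lambda>x vs. 0)"
proof -
  have "restrict_form S (\<lambda>x vs. 0) = (\<lambda>x vs. 0)" by (simp add: restrict_form_def fun_eq_iff)
  then show ?thesis by (simp add: de_rham_algebra_def)
qed

lemma unital_subalgebra_carrier:
  assumes S: "open S"
  shows "unital_subalgebra (de_rham_algebra S) (carrier (de_rham_algebra S))"
  unfolding unital_subalgebra_def carrier_de_rham_algebra[OF S] de_rham_one de_rham_zero
  by (auto simp: de_rham_add[OF S] de_rham_mult[OF S] de_rham_smult[OF S] closed_on_unit_form[OF S] closed_on_zero[OF S]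
      intro!: imageI closed_on_add closed_on_wedge closed_on_scale S)

text \<open>Forms whose class lies in the subalgebra generated by the classes of \<open>L\<close>. For representatives, the
  restriction to a smaller open set is the identity.\<close>

inductive generated_form :: "'a::euclidean_space set \<Rightarrow> 'a form set \<Rightarrow> 'a form \<Rightarrow> bool" for S L where
  unit: "generated_form S L unit_form"
| base: "l \<in> L \<Longrightarrow> generated_form S L l"
| exact: "ambient_form_on S \<eta> \<Longrightarrow> generated_form S L (ambient_deriv \<eta>)"
| add: "generated_form S L \<alpha> \<Longrightarrow> generated_form S L \<beta> \<Longrightarrow> generated_form S L (\<lambda>x vs. \<alpha> x vs + \<beta> x vs)"
| scale: "generated_form S L \<alpha> \<Longrightarrow> generated_form S L (\<lambda>x vs. c * \<alpha> x vs)"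
| wedge: "generated_form S L \<alpha> \<Longrightarrow> generated_form S L \<beta> \<Longrightarrow> generated_form S L (wedge \<alpha> \<beta>)"
| cong: "generated_form S L \<alpha> \<Longrightarrow> (\<And>x. x \<in> S \<Longrightarrow> \<beta> x = \<alpha> x) \<Longrightarrow> generated_form S L \<beta>"

lemma generated_form_subset:
  assumes "generated_form S L \<omega>" "V \<subseteq> S" "L \<subseteq> L'"
  shows "generated_form V L' \<omega>"
  using assms(1)
proof induction
  case (exact \<eta>)
  then show ?case using assms(2) by (blast intro: generated_form.exact ambient_form_on_subset)
next
  case (cong \<alpha> \<beta>)
  then show ?case using assms(2) by (blast intro: generated_form.cong)
qed (use assms(3) in \<open>auto intro: generated_form.intros(1-6)\<close>)

lemma generated_form_closed:
  assumes S: "open S" and L: "\<And>l. l \<in> L \<Longrightarrow> closed_on S l" and "generated_form S L \<omega>"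
  shows "closed_on S \<omega>"
  using assms(3)
  by induction (auto intro: closed_on_unit_form closed_on_ambient_deriv closed_on_add closed_on_scale closed_on_wedge
      closed_on_cong S L)

text \<open>Shown for every subalgebra \<open>B\<close> that contains the generators, hence for
  their intersection, the hull.\<close>

lemma generated_form_cls:
  assumes S: "open S" and L: "\<And>l. l \<in> L \<Longrightarrow> closed_on S l" and \<omega>: "generated_form S L \<omega>"
    and B: "unital_subalgebra (de_rham_algebra S) B" "cls S ` L \<subseteq> B"
  shows "cls S \<omega> \<in> B"
  using \<omega>
proof induction
  case unit
  then show ?case using B(1) by (simp add: unital_subalgebra_def de_rham_one)
next
  case (exact \<eta>)
  have "cls S (ambient_deriv \<eta>) = cls S (\<lambda>x vs. 0)"
    by (rule cls_exact_diff[OF S exact]) simp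
  then show ?case using B(1) by (simp add: unital_subalgebra_def de_rham_zero)
next
  case (add \<alpha> \<beta>)
  then show ?case
    using B(1) generated_form_closed[OF S L] by (simp add: unital_subalgebra_def de_rham_add[OF S, symmetric])
next
  case (scale \<alpha> c)
  then show ?case
    using B(1) generated_form_closed[OF S L] by (simp add: unital_subalgebra_def de_rham_smult[OF S, symmetric])
next
  case (wedge \<alpha> \<beta>)
  then show ?case
    using B(1) generated_form_closed[OF S L] by (simp add: unital_subalgebra_def de_rham_mult[OF S, symmetric])
next
  case (cong \<alpha> \<beta>)
  have "restrict_form S \<beta> = restrict_form S \<alpha>"
    using cong by (simp add: restrict_form_open[OF S] fun_eq_iff)
  then show ?case using cong by simp
qed (use B(2) in auto)

theorem generates_algebraI:
  assumes S: "open S" and L: "\<And>l. l \<in> L \<Longrightarrow> closed_on S l"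
    and gen: "\<And>\<omega>. closed_on S \<omega> \<Longrightarrow> generated_form S L \<omega>"
  shows "generates_algebra (de_rham_algebra S) (cls S ` L)"
proof -
  have sub: "cls S ` L \<subseteq> carrier (de_rham_algebra S)"
    using L by (auto simp: carrier_de_rham_algebra[OF S])
  have "carrier (de_rham_algebra S) \<subseteq> unital_subalgebra (de_rham_algebra S) hull (cls S ` L)"
    using generated_form_cls[OF S L gen] by (auto simp: carrier_de_rham_algebra[OF S] hull_def)
  moreover have "unital_subalgebra (de_rham_algebra S) hull (cls S ` L) \<subseteq> carrier (de_rham_algebra S)"
    by (rule hull_minimal[where S = "unital_subalgebra (de_rham_algebra S)", OF sub unital_subalgebra_carrier[OF S]])
  ultimately show ?thesis using sub by (auto simp: generates_algebra_def)
qed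

text \<open>In the residue decomposition, \<open>\<xi>\<close> and \<open>\<beta>\<close> are closed
  on \<open>X\<close> and hence generated by \<open>L\<close>; the only new generator is
  \<open>log_form f\<close>.\<close>

lemma (in fibred_hypersurface) generated_form_complement:
  assumes "\<And>B. closed_on N B \<Longrightarrow> \<exists>\<beta> \<sigma>. closed_on X \<beta> \<and> ambient_form_on N \<sigma> \<and>
      (\<forall>x\<in>N. \<forall>vs. B x vs - \<beta> x vs = ambient_deriv \<sigma> x vs)"
    and gen: "\<And>\<omega>. closed_on X \<omega> \<Longrightarrow> generated_form X L \<omega>" and \<omega>: "closed_on U \<omega>"
  shows "generated_form U (insert (log_form f) L) \<omega>"
proof -
  obtain \<beta> \<xi> \<mu> where d: "closed_on X \<beta>" "closed_on X \<xi>" "ambient_form_on U \<mu>"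
    "\<And>x vs. x \<in> U \<Longrightarrow> \<omega> x vs = \<xi> x vs + wedge (log_form f) \<beta> x vs + ambient_deriv \<mu> x vs"
    using residue_decomposition[OF assms(1) \<omega>] by blast
  have g: "generated_form U (insert (log_form f) L) \<eta>" if "closed_on X \<eta>" for \<eta>
    by (rule generated_form_subset[OF gen[OF that] U_X subset_insertI])
  have "generated_form U (insert (log_form f) L) (log_form f)"
    by (rule generated_form.base) simp
  from generated_form.add[OF generated_form.add[OF g[OF d(2)] generated_form.wedge[OF this g[OF d(1)]]]
      generated_form.exact[OF d(3)]]
  show ?thesis
    by (rule generated_form.cong) (simp add: d(4) fun_eq_iff)
qed

section \<open>Restriction to the hypersurface and the use of surjectivity\<close>

context fibred_hypersurface
begin

definition K where "K = {z \<in> X. f z = 0}"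

lemma proj_K: "z \<in> N \<Longrightarrow> proj z \<in> K"
  using proj_N N_X f_proj N_T by (auto simp: K_def)

lemma K_N: "K \<subseteq> N"
  using R_X X_T by (auto simp: K_def N_def)

lemma proj_on_K: "z \<in> K \<Longrightarrow> proj z = z"
  using proj_f_zero X_T by (auto simp: K_def)

lemma smooth_proj_N: "smooth_on N proj"
  by (rule smooth_on_subset[OF smooth_proj N_T])

lemma frechet_derivative_proj_tangent: "x \<in> N \<Longrightarrow> frechet_derivative proj (at x) v \<in> tangent_space K (proj x)"
  using proj_K by (intro frechet_derivative_in_tangent_space[OF open_N _ _ smooth_proj_N]) auto

text \<open>Curves in \<open>K\<close> are fixed pointwise by \<open>proj\<close>, so their
  velocities are fixed by its derivative.\<close>

lemma frechet_derivative_proj_K: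
  assumes x: "x \<in> K" and v: "v \<in> tangent_space K x"
  shows "frechet_derivative proj (at x) v = v"
proof -
  obtain \<gamma> e where \<gamma>: "e > 0" "\<gamma> ` {-e<..<e} \<subseteq> K" "\<gamma> 0 = x" "(\<gamma> has_vector_derivative v) (at (0::real))"
    using v by (auto simp: tangent_space_def)
  have "(proj has_derivative frechet_derivative proj (at x)) (at (\<gamma> 0))"
    using smooth_on_has_derivative[OF open_N smooth_proj_N] K_N x \<gamma>(3) by auto
  note has_derivative_compose[OF \<gamma>(4)[unfolded has_vector_derivative_def] this]
  moreover have "(0::real) \<in> {-e<..<e}" using \<gamma>(1) by simp
  moreover have "proj (\<gamma> t) = \<gamma> t" if "t \<in> {-e<..<e}" for t
    using \<gamma>(2) that by (intro proj_on_K) auto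
  ultimately have "(\<gamma> has_derivative (\<lambda>s. frechet_derivative proj (at x) (s *\<^sub>R v))) (at 0)"
    using has_derivative_transform_within_open[OF _ open_greaterThanLessThan] by blast
  then have "(\<lambda>s. frechet_derivative proj (at x) (s *\<^sub>R v)) = (\<lambda>s. s *\<^sub>R v)"
    using \<gamma>(4)[unfolded has_vector_derivative_def] by (rule has_derivative_unique)
  from fun_cong[OF this, of 1] show ?thesis by simp
qed

text \<open>The derivative of \<open>proj\<close> only produces vectors tangent to \<open>K\<close>,
  on which \<open>\<tau>\<close> and a local extension agree. So both have the same pullback near
  \<open>x\<close>, and naturality of \<open>d\<close> can be applied to the extension that
  \<open>ext_deriv\<close> chooses at \<open>proj x\<close>.\<close>

lemma pullback_proj_forms:
  assumes \<tau>: "\<tau> \<in> forms K" and x: "x \<in> N"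
  shows "\<exists>V. open V \<and> x \<in> V \<and> ambient_form_on V (pullback proj \<tau>)"
    and "ambient_deriv (pullback proj \<tau>) x vs = pullback proj (ext_deriv K \<tau>) x vs"
proof -
  define \<eta> where "\<eta> = (SOME \<eta>. local_extension K \<tau> (proj x) \<eta>)"
  have "\<exists>\<eta>. local_extension K \<tau> (proj x) \<eta>"
    using \<tau> proj_K[OF x] by (auto simp: forms_def)
  then have "local_extension K \<tau> (proj x) \<eta>"
    unfolding \<eta>_def by (rule someI_ex)
  then obtain V where V: "open V" "proj x \<in> V" "ambient_form_on V \<eta>"
    "\<And>y us. y \<in> K \<inter> V \<Longrightarrow> set us \<subseteq> tangent_space K y \<Longrightarrow> \<tau> y us = \<eta> y us"
    unfolding local_extension_def by blast
  define V' where "V' = N \<inter> proj -` V"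
  have V': "open V'" "x \<in> V'" "proj ` V' \<subseteq> V" "V' \<subseteq> N"
    unfolding V'_def using x V(2) smooth_on_continuous[OF smooth_proj_N]
    by (auto intro: continuous_open_preimage open_N V(1))
  have sm: "smooth_on V' proj" by (rule smooth_on_subset[OF smooth_proj_N V'(4)])
  have eq: "pullback proj \<tau> y = pullback proj \<eta> y" if "y \<in> V'" for y
  proof
    fix us
    have yN: "y \<in> N" "proj y \<in> V" using that V'(3,4) by auto
    then show "pullback proj \<tau> y us = pullback proj \<eta> y us"
      unfolding pullback_def using proj_K[OF yN(1)] frechet_derivative_proj_tangent[OF yN(1)]
      by (intro V(4)) auto
  qed
  have "ambient_form_on V' (pullback proj \<tau>)"
    by (rule ambient_form_on_cong[OF V'(1) ambient_form_on_pullback[OF V'(1) V(1) V'(3) sm V(3)] eq])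
  with V' show "\<exists>V. open V \<and> x \<in> V \<and> ambient_form_on V (pullback proj \<tau>)" by blast
  have "ambient_deriv (pullback proj \<tau>) x vs = ambient_deriv (pullback proj \<eta>) x vs"
    using ambient_deriv_cong[OF V'(1,2) eq] by simp
  also have "\<dots> = pullback proj (ambient_deriv \<eta>) x vs"
    by (rule ambient_deriv_pullback[OF V'(1) V(1) V'(3) sm V(3) V'(2)])
  also have "\<dots> = pullback proj (ext_deriv K \<tau>) x vs"
    using proj_K[OF x] frechet_derivative_proj_tangent[OF x]
    by (auto simp: pullback_def ext_deriv_def restrict_form_def \<eta>_def)
  finally show "ambient_deriv (pullback proj \<tau>) x vs = pullback proj (ext_deriv K \<tau>) x vs" .
qed

lemma ambient_form_on_pullback_proj: "\<tau> \<in> forms K \<Longrightarrow> ambient_form_on N (pullback proj \<tau>)"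
  using pullback_proj_forms(1) by (intro ambient_form_on_local[OF open_N]) blast

lemma pullback_proj_restrict_form:
  assumes x: "x \<in> N"
  shows "pullback proj (restrict_form K \<omega>) x vs = pullback proj \<omega> x vs"
  using proj_K[OF x] frechet_derivative_proj_tangent[OF x] by (auto simp: pullback_def restrict_form_def)

text \<open>On vectors tangent to \<open>K\<close> the derivative of \<open>proj\<close> is the
  identity. So \<open>ext_deriv K\<close> can be read off after pullback to \<open>N\<close>, where
  it is \<open>d\<close> of the pullback of a closed form.\<close>

lemma restrict_form_K_closed:
  assumes \<omega>: "closed_on N \<omega>"
  shows "restrict_form K \<omega> \<in> closed_forms K"
proof -
  have "local_extension K (restrict_form K \<omega>) x \<omega>" if "x \<in> K" for x
    unfolding local_extension_def
    using that K_N open_N closed_onD(1)[OF \<omega>] by (intro exI[of _ N]) (auto simp: restrict_form_def)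
  then have f: "restrict_form K \<omega> \<in> forms K"
    by (auto simp: forms_def restrict_form_idem)
  have N: "proj ` N \<subseteq> N" using proj_N by blast
  have "ext_deriv K (restrict_form K \<omega>) x vs = 0" for x vs
  proof (cases "x \<in> K \<and> set vs \<subseteq> tangent_space K x")
    case True
    then have xN: "x \<in> N" using K_N by auto
    have "map (frechet_derivative proj (at x)) vs = vs"
      using frechet_derivative_proj_K True by (intro map_idI) auto
    then have "ext_deriv K (restrict_form K \<omega>) x vs = pullback proj (ext_deriv K (restrict_form K \<omega>)) x vs"
      using proj_on_K True by (simp add: pullback_def)
    also have "\<dots> = ambient_deriv (pullback proj (restrict_form K \<omega>)) x vs"
      using pullback_proj_forms(2)[OF f xN] by simp
    also have "\<dots> = ambient_deriv (pullback proj \<omega>) x vs"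
      by (rule fun_cong[OF ambient_deriv_cong[OF open_N xN]]) (simp add: fun_eq_iff pullback_proj_restrict_form)
    also have "\<dots> = 0"
      by (rule closed_onD(2)[OF closed_on_pullback[OF open_N open_N N smooth_proj_N \<omega>] xN])
    finally show ?thesis .
  qed (auto simp: ext_deriv_def restrict_form_def)
  with f show ?thesis by (simp add: closed_forms_def fun_eq_iff)
qed

text \<open>The choice of extensions inside \<open>ext_deriv\<close> makes this less than immediate;
  it follows from the closedness of the zero form on \<open>N\<close>.\<close>

lemma zero_exact_K: "(\<lambda>x vs. 0) \<in> exact_forms K"
proof -
  have "restrict_form K (\<lambda>x vs. 0) = (\<lambda>x vs. 0)"
    by (simp add: restrict_form_def fun_eq_iff)
  then have "(\<lambda>x vs. 0) \<in> closed_forms K"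
    using restrict_form_K_closed[OF closed_on_zero[OF open_N]] by simp
  then show ?thesis
    unfolding closed_forms_def exact_forms_def by (auto simp: image_iff intro!: bexI[of _ "\<lambda>x vs. 0"])
qed

text \<open>On the tube, \<open>B\<close> and \<open>\<beta>\<close> are cohomologous to the
  pullbacks along \<open>proj\<close> of their restrictions to \<open>K\<close>. These restrictions
  differ by \<open>ext_deriv K \<tau>\<close>, and pulling back \<open>\<tau>\<close> supplies the
  missing primitive.\<close>

lemma extension_from_surjectivity:
  assumes surj: "carrier (de_rham_algebra K) \<subseteq> inclusion_pullback K ` carrier (de_rham_algebra X)"
    and B: "closed_on N B"
  shows "\<exists>\<beta> \<sigma>. closed_on X \<beta> \<and> ambient_form_on N \<sigma> \<and> (\<forall>x\<in>N. \<forall>vs. B x vs - \<beta> x vs = ambient_deriv \<sigma> x vs)"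
proof -
  let ?B = "restrict_form K B"
  have BK: "?B \<in> closed_forms K" by (rule restrict_form_K_closed[OF B])
  then have "de_rham_class K ?B \<in> carrier (de_rham_algebra K)" by (simp add: de_rham_algebra_def)
  then obtain A where A: "A \<in> carrier (de_rham_algebra X)" "de_rham_class K ?B = inclusion_pullback K A"
    using surj by blast
  \<comment> \<open>The image of \<open>A\<close> is a union over its representatives, so membership
    of \<open>?B\<close> in that union yields a concrete form \<open>\<beta>\<close>.\<close>
  have "?B \<in> de_rham_class K ?B" using BK zero_exact_K by (simp add: de_rham_class_def)
  then obtain \<beta> where \<beta>: "\<beta> \<in> A" "?B \<in> de_rham_class K (restrict_form K \<beta>)"
    unfolding A(2) inclusion_pullback_def by blast
  have "\<beta> \<in> closed_forms X"
    using A(1) \<beta>(1) by (auto simp: de_rham_algebra_def de_rham_class_def)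
  then have \<beta>X: "closed_on X \<beta>" by (simp add: closed_forms_open_iff[OF open_X])
  have \<beta>N: "closed_on N \<beta>" by (rule closed_on_subset[OF \<beta>X N_X])
  obtain \<tau> where \<tau>: "\<tau> \<in> forms K" "(\<lambda>x vs. ?B x vs - restrict_form K \<beta> x vs) = ext_deriv K \<tau>"
    using de_rham_classD(2)[OF \<beta>(2)] by (auto simp: exact_forms_def)
  have d\<tau>: "ambient_deriv (pullback proj \<tau>) x vs = pullback proj B x vs - pullback proj \<beta> x vs" if "x \<in> N" for x vs
    unfolding pullback_proj_forms(2)[OF \<tau>(1) that] \<tau>(2)[symmetric]
      pullback_proj_restrict_form[OF that, of B, symmetric] pullback_proj_restrict_form[OF that, of \<beta>, symmetric]
    by (simp add: pullback_def)
  obtain \<sigma>1 where s1: "ambient_form_on N \<sigma>1" "\<And>x vs. x \<in> N \<Longrightarrow> B x vs - pullback proj B x vs = ambient_deriv \<sigma>1 x vs"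
    using closed_homologous_proj[OF B] by blast
  obtain \<sigma>2 where s2: "ambient_form_on N \<sigma>2" "\<And>x vs. x \<in> N \<Longrightarrow> \<beta> x vs - pullback proj \<beta> x vs = ambient_deriv \<sigma>2 x vs"
    using closed_homologous_proj[OF \<beta>N] by blast
  note p = ambient_form_on_pullback_proj[OF \<tau>(1)]
  let ?\<sigma> = "\<lambda>x vs. (\<sigma>1 x vs - \<sigma>2 x vs) + pullback proj \<tau> x vs"
  have "B x vs - \<beta> x vs = ambient_deriv ?\<sigma> x vs" if x: "x \<in> N" for x vs
    unfolding ambient_deriv_add[OF open_N ambient_form_on_diff[OF open_N s1(1) s2(1)] p x]
      ambient_deriv_diff[OF open_N s1(1) s2(1) x] s1(2)[OF x, symmetric] s2(2)[OF x, symmetric] d\<tau>[OF x]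
    by simp
  moreover have "ambient_form_on N ?\<sigma>"
    by (intro ambient_form_on_add ambient_form_on_diff open_N s1 s2 p)
  ultimately show ?thesis using \<beta>X by blast
qed

text \<open>If \<open>proj\<close> maps all of \<open>X\<close> into the tube, then
  \<open>pullback proj B\<close> is already a closed form on \<open>X\<close> of the required class.
  In this way the coordinate hyperplanes are handled without a surjectivity assumption.\<close>

lemma extension_by_projection:
  assumes "proj ` X \<subseteq> N" and B: "closed_on N B"
  shows "\<exists>\<beta> \<sigma>. closed_on X \<beta> \<and> ambient_form_on N \<sigma> \<and> (\<forall>x\<in>N. \<forall>vs. B x vs - \<beta> x vs = ambient_deriv \<sigma> x vs)"
proof -
  have "closed_on X (pullback proj B)"
    by (rule closed_on_pullback[OF open_X open_N assms(1) smooth_on_subset[OF smooth_proj X_T] B])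
  then show ?thesis
    using closed_homologous_proj[OF B] by metis
qed

end

section \<open>The torus\<close>

text \<open>Scaling joins the identity to the constant map \<open>0\<close>, whose derivative feeds
  only zero vectors to the form; so nothing but the constant \<open>\<omega> 0 []\<close>
  survives.\<close>

lemma poincare_lemma:
  fixes \<omega> :: "'a::euclidean_space form"
  assumes \<omega>: "closed_on UNIV \<omega>"
  shows "generated_form UNIV L \<omega>"
proof -
  have sm: "smooth_on UNIV (\<lambda>p::real \<times> 'a. fst p *\<^sub>R snd p)"
    by (intro smooth_on_scaleR smooth_on_fst smooth_on_snd smooth_on_ident open_UNIV)
  obtain \<tau> where \<tau>: "ambient_form_on UNIV \<tau>"
    "\<And>x vs. pullback (\<lambda>x. x) \<omega> x vs - pullback (\<lambda>x. 0) \<omega> x vs = ambient_deriv \<tau> x vs"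
    using homotopy_formula[OF open_UNIV _ open_UNIV open_UNIV _ sm \<omega>] by auto
  have "pullback (\<lambda>x::'a. 0) \<omega> x vs = \<omega> 0 [] * unit_form x vs" for x vs
  proof (cases vs)
    case (Cons v us)
    have "\<omega> 0 (0 # ws) = 0" for ws
      using linear_0[OF alt_multilinear_linear_hd[OF ambient_form_on_alt[OF closed_onD(1)[OF \<omega>]]]] by simp
    with Cons show ?thesis by (simp add: pullback_def unit_form_def)
  qed (simp add: pullback_def unit_form_def)
  then have dec: "\<omega> x vs = \<omega> 0 [] * unit_form x vs + ambient_deriv \<tau> x vs" for x vs
    using \<tau>(2)[of x vs] by (simp add: pullback_ident diff_eq_eq add.commute)
  have "generated_form UNIV L (\<lambda>x vs. \<omega> 0 [] * unit_form x vs + ambient_deriv \<tau> x vs)"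
    by (intro generated_form.add generated_form.scale generated_form.unit generated_form.exact \<tau>(1))
  then show ?thesis
    by (rule generated_form.cong) (intro ext, rule dec)
qed

lemma generated_form_coordinate_complement:
  fixes J :: "'l::finite set"
  assumes "closed_on {z :: complex ^ 'l. \<forall>j\<in>J. z $ j \<noteq> 0} \<omega>"
  shows "generated_form {z. \<forall>j\<in>J. z $ j \<noteq> 0} ((\<lambda>j. log_form (\<lambda>z. z $ j)) ` J) \<omega>"
  using finite[of J] assms
proof (induction J arbitrary: \<omega> rule: finite_induct)
  case empty
  then show ?case by (simp add: poincare_lemma)
next
  case (insert j J)
  let ?X = "{z :: complex ^ 'l. \<forall>j\<in>J. z $ j \<noteq> 0}"
  \<comment> \<open>Overwriting the \<open>j\<close>-th coordinate makes the fibres coordinate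
    lines.\<close>
  define E where "E = (\<lambda>(z :: complex ^ 'l, w). (\<chi> i. if i = j then w else z $ i) :: complex ^ 'l)"
  \<comment> \<open>Smooth, positive exactly on \<open>?X\<close> and constant along the coordinate
    lines. Each line lies entirely inside or outside \<open>?X\<close>, so positivity already keeps
    the tube in \<open>?X\<close>.\<close>
  define r where "r = (\<lambda>z :: complex ^ 'l. \<Prod>k\<in>J. (cmod (z $ k))\<^sup>2)"
  have rE: "r (E (z, w)) = r z" for z w
    unfolding r_def E_def using insert(2) by (intro prod.cong) auto
  have r_pos: "0 < r z \<longleftrightarrow> z \<in> ?X" for z
  proof -
    have "0 \<le> r z" by (simp add: r_def prod_nonneg)
    moreover have "r z = 0 \<longleftrightarrow> z \<notin> ?X" using insert(1) by (auto simp: r_def prod_zero_iff)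
    ultimately show ?thesis by auto
  qed
  interpret fibred_hypersurface UNIV UNIV "\<lambda>z. z $ j" E r ?X
  proof
    show "smooth_on (UNIV \<times> UNIV) E"
    proof -
      have "smooth_on UNIV (\<lambda>p :: (complex ^ 'l) \<times> complex. if i = j then snd p else fst p $ i)" for i
        by (cases "i = j") (simp_all add: smooth_on_vec_nth smooth_on_fst smooth_on_snd smooth_on_ident)
      then have "smooth_on UNIV (\<lambda>p :: (complex ^ 'l) \<times> complex. \<chi> i. if i = j then snd p else fst p $ i)"
        by (intro smooth_on_vec_lambda open_UNIV)
      then show ?thesis by (simp add: E_def case_prod_beta')
    qed
    show "smooth_on UNIV r"
      unfolding r_def using insert(1)
      by (intro smooth_on_prod smooth_on_cmod_power2 smooth_on_vec_nth smooth_on_ident) auto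
    show "?X = {z \<in> UNIV. 0 < r z}" using r_pos by auto
    show "0 \<le> r z" for z by (simp add: r_def prod_nonneg)
    show "E (z, w) \<in> ?X" if "cmod w < r (E (z, 0))" for z w
      unfolding r_pos[symmetric] rE using that[unfolded rE] by (rule le_less_trans[OF norm_ge_zero])
    show "smooth_on UNIV (\<lambda>z :: complex ^ 'l. z $ j)"
      by (intro smooth_on_vec_nth smooth_on_ident open_UNIV)
  qed (auto simp: E_def vec_eq_iff)
  \<comment> \<open>Setting the \<open>j\<close>-th coordinate to \<open>0\<close> leaves the radius
    positive, so the projection of every point of \<open>?X\<close> lies in the tube.\<close>
  have "proj ` ?X \<subseteq> N"
    using r_pos by (auto simp: N_def R_def proj_def rE) (simp add: E_def)
  moreover have "U = {z. \<forall>k\<in>insert j J. z $ k \<noteq> 0}" by (auto simp: U_def)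
  ultimately show ?case
    using generated_form_complement[OF extension_by_projection insert.IH] insert.prems by simp
qed

section \<open>The torus and its characters\<close>

lemma torus_eq: "torus = {z :: complex ^ 'l::finite. \<forall>j\<in>UNIV. z $ j \<noteq> 0}"
  by (simp add: torus_def)

lemma generated_form_torus:
  "closed_on (torus :: (complex ^ 'l::finite) set) \<omega> \<Longrightarrow>
    generated_form torus (range (\<lambda>j. log_form (\<lambda>z. z $ j))) \<omega>"
  unfolding torus_eq by (rule generated_form_coordinate_complement)

lemma open_torus: "open (torus :: (complex ^ 'l::finite) set)"
proof -
  have "open (\<Inter>j\<in>(UNIV :: 'l set). {z :: complex ^ 'l. z $ j \<noteq> 0})"
    by (intro open_INT ballI open_Collect_neq continuous_intros) auto
  moreover have "(\<Inter>j\<in>(UNIV :: 'l set). {z :: complex ^ 'l. z $ j \<noteq> 0}) = torus"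
    by (auto simp: torus_def)
  ultimately show ?thesis by simp
qed

lemma smooth_character: "smooth_on torus (character m)"
  unfolding character_def
  by (intro smooth_on_prod smooth_on_powi smooth_on_vec_nth smooth_on_ident open_torus finite) (auto simp: torus_def)

lemma character_nonzero: "z \<in> torus \<Longrightarrow> character m z \<noteq> 0"
  by (simp add: character_def torus_def)

text \<open>The exponents \<open>a\<close> define a one-parameter subgroup, and the pairing of
  \<open>a\<close> with \<open>m\<close> is the weight of the character along it.\<close>

lemma character_act:
  assumes "s \<noteq> 0"
  shows "character m (\<chi> j. s powi (a $ j) * z $ j) = s powi (\<Sum>j\<in>UNIV. a $ j * m $ j) * character m z"
proof -
  have "s powi (\<Sum>j\<in>I. a $ j * m $ j) = (\<Prod>j\<in>I. s powi (a $ j * m $ j))" for I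
    using finite[of I] by (induction I rule: finite_induct) (simp_all add: power_int_add assms)
  then show ?thesis
    by (simp add: character_def power_int_mult_distrib power_int_mult prod.distrib)
qed

lemma Gcd_bezout_sum:
  fixes x :: "'i \<Rightarrow> int"
  assumes "finite I"
  shows "\<exists>a. (\<Sum>i\<in>I. a i * x i) = Gcd (x ` I)"
  using assms
proof (induction I rule: finite_induct)
  case (insert i I)
  then obtain a where a: "(\<Sum>i\<in>I. a i * x i) = Gcd (x ` I)" by blast
  obtain u v where uv: "u * x i + v * Gcd (x ` I) = gcd (x i) (Gcd (x ` I))"
    using bezout_int by blast
  have "(\<Sum>k\<in>I. (if k = i then u else v * a k) * x k) = (\<Sum>k\<in>I. v * (a k * x k))"
    using insert(2) by (intro sum.cong) auto
  then have "(\<Sum>k\<in>insert i I. (if k = i then u else v * a k) * x k) = Gcd (x ` insert i I)"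
    using insert(1,2) uv by (simp add: sum_distrib_left[symmetric] a)
  then show ?case by (rule exI[of _ "\<lambda>k. if k = i then u else v * a k"])
qed simp

text \<open>The derivative is bounded on the disc of radius \<open>1/2\<close>, which stays away
  from the possible pole at \<open>u = -1\<close>.\<close>

lemma power_int_lipschitz_near_1:
  fixes b :: int
  obtains C where "0 \<le> C" "\<And>u::complex. cmod u \<le> 1/2 \<Longrightarrow> cmod ((1 + u) powi b - 1) \<le> C * cmod u"
proof -
  have nz: "1 + u \<noteq> 0" if "u \<in> cball 0 (1/2)" for u :: complex
  proof
    assume "1 + u = 0"
    then have "u = -1" by (simp add: eq_neg_iff_add_eq_0 add.commute)
    with that show False by simp
  qed
  have "continuous_on (cball 0 (1/2)) (\<lambda>u::complex. of_int b * (1 + u) powi (b - 1))"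
    using nz by (intro continuous_intros) auto
  then have "bounded ((\<lambda>u::complex. of_int b * (1 + u) powi (b - 1)) ` cball 0 (1/2))"
    by (intro compact_imp_bounded compact_continuous_image compact_cball)
  then obtain C where C: "0 < C" "\<And>u::complex. u \<in> cball 0 (1/2) \<Longrightarrow> cmod (of_int b * (1 + u) powi (b - 1)) \<le> C"
    unfolding bounded_pos by auto
  have "cmod ((1 + u) powi b - (1 + 0) powi b) \<le> C * cmod (u - 0)" if "u \<in> cball 0 (1/2)" for u :: complex
  proof (rule field_differentiable_bound[OF convex_cball _ C(2)])
    show "((\<lambda>u. (1 + u) powi b) has_field_derivative of_int b * (1 + z) powi (b - 1)) (at z within cball 0 (1/2))"
      if "z \<in> cball 0 (1/2)" for z :: complex
      using nz[OF that] by (auto intro!: derivative_eq_intros)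
  qed (use that in auto)
  then show thesis using that[of C] C(1) by auto
qed

lemma open_complement: "open (complement m c i)" and complement_torus: "complement m c i \<subseteq> torus"
proof -
  have eq: "complement m c i = torus \<inter> (\<Inter>k\<in>{1..i}. {z \<in> torus. 0 < cmod (character (m k) z - c k)})"
    by (auto simp: complement_def hypersurface_def)
  have "open {z \<in> torus. 0 < cmod (character (m k) z - c k)}" for k
    by (intro open_positive_set open_torus continuous_intros smooth_on_continuous[OF smooth_character])
  then show "open (complement m c i)"
    unfolding eq by (intro open_Int open_INT ballI open_torus finite_atLeastAtMost)
  show "complement m c i \<subseteq> torus" by (auto simp: complement_def)
qed

text \<open>In the application, \<open>d\<close> is the distance of a character value from its
  forbidden value, \<open>q\<close> the modulus of the character, and \<open>C * u\<close> bounds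
  its relative change. The contradiction rests on \<open>x \<le> 1 + x^2\<close>, used for
  \<open>d\<close> and for \<open>q\<close>.\<close>

lemma separation_bound:
  fixes d q C u :: real
  assumes "0 \<le> q" "d \<le> q * (C * u)" "C * u < d\<^sup>2 / ((1 + d\<^sup>2) * (1 + q\<^sup>2))" "0 < d"
  shows False
proof -
  have q: "0 < q"
    using assms by (cases "q = 0") auto
  have p: "0 < 1 + d\<^sup>2" "0 < 1 + q\<^sup>2" by (simp_all add: add_pos_nonneg)
  have "d < q * (d\<^sup>2 / ((1 + d\<^sup>2) * (1 + q\<^sup>2)))"
    using assms(2) mult_strict_left_mono[OF assms(3) q] by linarith
  also have "\<dots> = d * ((d / (1 + d\<^sup>2)) * (q / (1 + q\<^sup>2)))"
    using p by (simp add: field_simps power2_eq_square)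
  also have "\<dots> \<le> d * (1 * 1)"
  proof (intro mult_left_mono mult_mono)
    have "x \<le> 1 + x\<^sup>2" for x :: real
      using zero_le_power2[of "x - 1/2"] by (simp add: power2_eq_square algebra_simps)
    then show "d / (1 + d\<^sup>2) \<le> 1" "q / (1 + q\<^sup>2) \<le> 1" using p by simp_all
  qed (use assms q in auto)
  finally show False by simp
qed

text \<open>The delicate point is the radius: a point of the new hypersurface, moved along its
  orbit, must not meet the hypersurfaces already removed, although these may intersect the new one
  and the tube has to shrink towards them.\<close>

lemma fibred_hypersurface_character:
  fixes m :: "nat \<Rightarrow> int ^ 'l::finite"
  assumes prim: "primitive p" and c0: "c0 \<noteq> 0"
  shows "\<exists>W E r. fibred_hypersurface torus W (\<lambda>z. character p z - c0) E r (complement m c i)"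
proof -
  obtain a0 where "(\<Sum>j\<in>UNIV. a0 j * p $ j) = 1"
    using Gcd_bezout_sum[of UNIV "\<lambda>j. p $ j"] prim by (auto simp: primitive_def)
  then obtain a :: "int ^ 'l" where a: "(\<Sum>j\<in>UNIV. a $ j * p $ j) = 1"
    by (metis (no_types, lifting) sum.cong vec_lambda_beta)
  \<comment> \<open>The weight of the \<open>k\<close>-th character along the subgroup.\<close>
  define b where "b = (\<lambda>k. \<Sum>j\<in>UNIV. a $ j * m k $ j)"
  have "\<exists>C. 0 \<le> C \<and> (\<forall>u::complex. cmod u \<le> 1/2 \<longrightarrow> cmod ((1 + u) powi b k - 1) \<le> C * cmod u)" for k
    using power_int_lipschitz_near_1[of "b k"] by metis
  then obtain C where C: "\<And>k. 0 \<le> C k" "\<And>k u. cmod u \<le> 1/2 \<Longrightarrow> cmod ((1 + u) powi b k - 1) \<le> C k * cmod u"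
    by metis
  \<comment> \<open>The summand \<open>2\<close> forces \<open>cmod u \<le> 1/2\<close> for
    \<open>u = w / c0\<close>, the range of the Lipschitz bounds; the sum makes \<open>D\<close>
    dominate each \<open>C k\<close>.\<close>
  define D where "D = 2 + (\<Sum>k\<in>{1..i}. C k)"
  have D: "2 \<le> D" "\<And>k. k \<in> {1..i} \<Longrightarrow> C k \<le> D"
    using C(1) by (auto simp: D_def intro!: sum_nonneg add_increasing member_le_sum)
  define W where "W = {w. c0 + w \<noteq> 0}"
  define act where "act = (\<lambda>s z. (\<chi> j. s powi (a $ j) * z $ j) :: complex ^ 'l)"
  define E where "E = (\<lambda>(z, w). act ((c0 + w) / character p z) z)"
  \<comment> \<open>Smooth because it contains only squares of moduli, at most \<open>1\<close>,
    zero exactly where the \<open>k\<close>-th character takes the value \<open>c k\<close>, and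
    shaped like the bound in \<open>separation_bound\<close>.\<close>
  define g where "g = (\<lambda>k z. (cmod (character (m k) z - c k))\<^sup>2 /
    ((1 + (cmod (character (m k) z - c k))\<^sup>2) * (1 + (cmod (character (m k) z))\<^sup>2)))"
  \<comment> \<open>Moving from \<open>y\<close> with \<open>\<chi>(y) = c0\<close> to the value \<open>c0 (1 + u)\<close> multiplies \<open>\<chi>\<^sub>k(y)\<close> by \<open>(1 + u)\<close> to the power
    \<open>b k\<close>; \<open>r\<close> is a smooth function small enough to keep this away from \<open>c k\<close>, and zero outside \<open>X\<close>.\<close>
  define r where "r = (\<lambda>z. cmod c0 / D * (\<Prod>k\<in>{1..i}. g k z))"
  have act_torus: "act s z \<in> torus" if "s \<noteq> 0" "z \<in> torus" for s z
    using that by (simp add: act_def torus_def)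
  have char_act: "character p (act s z) = s * character p z" "character (m k) (act s z) = s powi b k * character (m k) z"
    if "s \<noteq> 0" for s z k
    using character_act[OF that, of _ a] by (simp_all add: act_def a b_def)
  have act_act: "act s (act t z) = act (s * t) z" for s t z
    by (simp add: act_def vec_eq_iff power_int_mult_distrib mult.assoc)
  have s0: "(c0 + w) / character p z \<noteq> 0" if "z \<in> torus" "w \<in> W" for z w
    using that character_nonzero by (auto simp: W_def)
  have E_T: "E (z, w) \<in> torus" if "z \<in> torus" "w \<in> W" for z w
    using act_torus s0 that by (simp add: E_def)
  have char_E: "character p (E (z, w)) = c0 + w" if "z \<in> torus" "w \<in> W" for z w
    using char_act(1)[OF s0[OF that]] character_nonzero[OF that(1)] by (simp add: E_def)
  have pos: "0 < (1 + x\<^sup>2) * (1 + y\<^sup>2)" for x y :: real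
    by (intro mult_pos_pos add_pos_nonneg) auto
  have g01: "0 \<le> g k z" "g k z \<le> 1" for k z
  proof -
    show "0 \<le> g k z" unfolding g_def using pos by (intro divide_nonneg_pos) auto
    have "x \<le> (1 + x) * (1 + y)" if "0 \<le> x" "0 \<le> y" for x y :: real
      using that by (simp add: algebra_simps)
    then show "g k z \<le> 1" unfolding g_def using pos by (simp add: divide_le_eq)
  qed
  have g_pos: "0 < g k z \<longleftrightarrow> character (m k) z \<noteq> c k" for k z
    unfolding g_def using pos[of "cmod (character (m k) z - c k)" "cmod (character (m k) z)"]
    by (simp add: zero_less_divide_iff zero_less_mult_iff)
  have X: "z \<in> complement m c i \<longleftrightarrow> z \<in> torus \<and> (\<forall>k\<in>{1..i}. 0 < g k z)" for z
    by (auto simp: complement_def hypersurface_def g_pos)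
  have r_pos: "0 < r z \<longleftrightarrow> (\<forall>k\<in>{1..i}. 0 < g k z)" for z
  proof
    assume "0 < r z"
    then have "(\<Prod>k\<in>{1..i}. g k z) \<noteq> 0" unfolding r_def by (metis less_irrefl mult_zero_right)
    then have "\<forall>k\<in>{1..i}. g k z \<noteq> 0" by (simp add: prod_zero_iff)
    then show "\<forall>k\<in>{1..i}. 0 < g k z" using g01(1) by (metis order_le_less)
  next
    assume "\<forall>k\<in>{1..i}. 0 < g k z"
    then show "0 < r z" using c0 D(1) by (auto simp: r_def intro!: mult_pos_pos divide_pos_pos prod_pos)
  qed
  have r0: "0 \<le> r z" for z
    unfolding r_def using D(1) g01(1) by (intro mult_nonneg_nonneg divide_nonneg_nonneg prod_nonneg) auto
  have tube: "w \<in> W \<and> E (z, w) \<in> complement m c i" if z: "z \<in> torus" and w: "cmod w < r (E (z, 0))" for z w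
  proof -
    define y where "y = E (z, 0)"
    define u where "u = w / c0"
    have W0: "0 \<in> W" using c0 by (simp add: W_def)
    have u: "cmod u < (\<Prod>k\<in>{1..i}. g k y) / D"
      using w c0 D(1) by (simp add: u_def y_def[symmetric] r_def norm_divide field_simps)
    have prod1: "(\<Prod>k\<in>{1..i}. g k y) \<le> 1"
      using g01 by (intro prod_le_1) auto
    have "(\<Prod>k\<in>{1..i}. g k y) / D \<le> 1 / 2"
      using prod1 D(1) by (intro frac_le) auto
    with u have u2: "cmod u \<le> 1/2" by linarith
    have cw: "c0 + w = c0 * (1 + u)" using c0 by (simp add: u_def field_simps)
    have "1 + u \<noteq> 0"
    proof
      assume "1 + u = 0"
      then have "u = -1" by (simp add: eq_neg_iff_add_eq_0 add.commute)
      with u2 show False by simp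
    qed
    then have wW: "w \<in> W" using c0 by (simp add: W_def cw)
    have "E (z, w) = act (1 + u) y"
      using c0 by (simp add: y_def E_def act_act cw mult.commute[of c0])
    then have char_k: "character (m k) (E (z, w)) = (1 + u) powi b k * character (m k) y" for k
      using char_act(2)[OF \<open>1 + u \<noteq> 0\<close>] by simp
    have "character (m k) (E (z, w)) \<noteq> c k" if k: "k \<in> {1..i}" for k
    proof
      assume eq: "character (m k) (E (z, w)) = c k"
      define d where "d = cmod (character (m k) y - c k)"
      define q where "q = cmod (character (m k) y)"
      have "0 < r y" using w by (auto simp: y_def intro: le_less_trans[OF norm_ge_zero])
      then have "0 < g k y" using k r_pos by auto
      then have d: "0 < d" by (simp add: d_def g_pos)
      \<comment> \<open>If the moved point met the \<open>k\<close>-th hypersurface, the character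
        would have changed by exactly its distance \<open>d\<close> from \<open>c k\<close> at
        \<open>y\<close>, more than the Lipschitz bound permits.\<close>
      have "character (m k) y - c k = - (character (m k) y * ((1 + u) powi b k - 1))"
        using eq by (simp add: char_k algebra_simps)
      then have "d = q * cmod ((1 + u) powi b k - 1)"
        by (simp add: d_def q_def norm_mult)
      also have "\<dots> \<le> q * (C k * cmod u)"
        by (intro mult_left_mono C(2) u2) (simp add: q_def)
      finally have 1: "d \<le> q * (C k * cmod u)" .
      have "(\<Prod>k\<in>{1..i}. g k y) \<le> g k y"
      proof -
        have "(\<Prod>k\<in>{1..i}. g k y) = g k y * (\<Prod>k\<in>{1..i} - {k}. g k y)"
          using k by (intro prod.remove) auto
        also have "\<dots> \<le> g k y * 1"
          using g01 by (intro mult_left_mono prod_le_1) auto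
        finally show ?thesis by simp
      qed
      then have gk: "cmod u < g k y / D"
        using u D(1) by (smt (verit) divide_right_mono)
      have "C k * cmod u \<le> D * cmod u"
        using D(2)[OF k] by (intro mult_right_mono) auto
      also have "\<dots> < g k y"
        using gk D(1) by (simp add: field_simps)
      finally have "C k * cmod u < d\<^sup>2 / ((1 + d\<^sup>2) * (1 + q\<^sup>2))"
        by (simp add: g_def d_def q_def)
      from separation_bound[OF _ 1 this d] show False by (simp add: q_def)
    qed
    then have "E (z, w) \<in> complement m c i"
      using E_T[OF z wW] by (auto simp: complement_def hypersurface_def)
    with wW show ?thesis by blast
  qed
  have oW: "open W"
    unfolding W_def by (intro open_Collect_neq continuous_intros)
  have "fibred_hypersurface torus W (\<lambda>z. character p z - c0) E r (complement m c i)"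
  proof
    show "smooth_on torus (\<lambda>z. character p z - c0)"
      by (intro smooth_on_diff smooth_character smooth_on_const open_torus)
    show "smooth_on (torus \<times> W) E"
    proof -
      note o = open_Times[OF open_torus oW]
      have "smooth_on (torus \<times> W) (\<lambda>q. character p (fst q))"
        by (rule smooth_on_compose[OF o open_torus _ _ smooth_character]) (auto intro!: smooth_on_fst smooth_on_ident o)
      then have "smooth_on (torus \<times> W) (\<lambda>q. \<chi> j. ((c0 + snd q) / character p (fst q)) powi (a $ j) * fst q $ j)"
        using s0 character_nonzero
        by (intro smooth_on_vec_lambda smooth_on_mult smooth_on_powi smooth_on_divide smooth_on_add smooth_on_const
            smooth_on_snd smooth_on_vec_nth smooth_on_fst smooth_on_ident o) auto
      then show ?thesis by (simp add: E_def act_def case_prod_beta')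
    qed
    show "smooth_on torus r"
    proof -
      have nz: "1 + x\<^sup>2 \<noteq> 0" for x :: real
        using zero_le_power2[of x] by linarith
      show ?thesis
        unfolding r_def g_def
        by (intro smooth_on_mult smooth_on_const smooth_on_prod smooth_on_divide smooth_on_add smooth_on_cmod_power2
            smooth_on_diff smooth_character open_torus) (auto simp: nz)
    qed
    show "character p z - c0 \<in> W" if "z \<in> torus" for z
      using character_nonzero[OF that] by (simp add: W_def)
    show "E (z, character p z - c0) = z" if "z \<in> torus" for z
      using character_nonzero[OF that] by (simp add: E_def act_def vec_eq_iff)
    show "character p (E (z, w)) - c0 = w" if "z \<in> torus" "w \<in> W" for z w
      using char_E[OF that] by simp
    show "E (E (z, w), w') = E (z, w')" if "z \<in> torus" "w \<in> W" "w' \<in> W" for z w w'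
    proof -
      have "E (E (z, w), w') = act ((c0 + w') / (c0 + w)) (act ((c0 + w) / character p z) z)"
        using char_E[OF that(1,2)] by (simp add: E_def)
      also have "\<dots> = E (z, w')"
        using that(2) by (simp add: act_act E_def W_def)
      finally show ?thesis .
    qed
    show "complement m c i = {z \<in> torus. 0 < r z}"
      using X r_pos by auto
  qed (use open_torus oW E_T c0 r0 tube in \<open>auto simp: W_def\<close>)
  then show ?thesis by blast
qed

text \<open>With \<open>X\<close> the complement at stage \<open>i\<close> and \<open>f\<close> the
  next equation, the set \<open>K\<close> of the fibred structure is the intersection occurring in
  the surjectivity assumption for index \<open>i + 1\<close>, and \<open>U\<close> is the complement
  at the next stage.\<close>

lemma generated_form_arrangement:
  fixes m :: "nat \<Rightarrow> int ^ 'l::finite"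
  assumes arr: "toric_arrangement n m c"
    and surj: "\<And>i. i \<in> {1..n} \<Longrightarrow>
      inclusion_pullback (complement m c (i - 1) \<inter> hypersurface (m i) (c i))
        ` carrier (de_rham_algebra (complement m c (i - 1)))
      = carrier (de_rham_algebra (complement m c (i - 1) \<inter> hypersurface (m i) (c i)))"
    and "i \<le> n" "closed_on (complement m c i) \<omega>"
  shows "generated_form (complement m c i) (range (\<lambda>j. log_form (\<lambda>z. z $ j)) \<union>
    (\<lambda>i. log_form (\<lambda>z. character (m i) z - c i)) ` {1..i}) \<omega>"
  using assms(3,4)
proof (induction i arbitrary: \<omega>)
  case 0
  then show ?case by (simp add: complement_def generated_form_torus)
next
  case (Suc i)
  let ?f = "\<lambda>z. character (m (Suc i)) z - c (Suc i)"
  have "primitive (m (Suc i))" "c (Suc i) \<noteq> 0"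
    using arr Suc.prems(1) by (auto simp: toric_arrangement_def)
  then obtain W E r where "fibred_hypersurface torus W ?f E r (complement m c i)"
    using fibred_hypersurface_character by blast
  then interpret fibred_hypersurface torus W ?f E r "complement m c i" .
  have K: "K = complement m c i \<inter> hypersurface (m (Suc i)) (c (Suc i))"
    using complement_torus by (auto simp: K_def hypersurface_def)
  have "{z \<in> complement m c i. ?f z \<noteq> 0} = complement m c (Suc i)"
    by (auto simp: complement_def hypersurface_def atLeastAtMostSuc_conv)
  then have U: "U = complement m c (Suc i)" by (simp only: U_def)
  have "carrier (de_rham_algebra K) \<subseteq> inclusion_pullback K ` carrier (de_rham_algebra (complement m c i))"
    using surj[of "Suc i"] Suc.prems(1) by (simp add: K)
  from generated_form_complement[OF extension_from_surjectivity[OF this] Suc.IH, unfolded U, OF _ _ _ Suc.prems(2)]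
  show ?case
    using Suc.prems(1) by (simp add: atLeastAtMostSuc_conv)
qed

text \<open>Identifies the generators normalised to \<open>M\<close> with the forms used in the
  induction, which do not depend on the stage.\<close>

lemma dlog_eq: "dlog M g = restrict_form M (log_form g)"
  by (auto simp: dlog_def log_form_def differential_def restrict_form_def fun_eq_iff divide_inverse)

theorem theorem3p5:
  fixes n :: nat
    and m :: "nat \<Rightarrow> int ^ 'l::finite"
    and c :: "nat \<Rightarrow> complex"
  assumes "toric_arrangement n m c"
    and "\<And>i. i \<in> {1..n} \<Longrightarrow>
      inclusion_pullback (complement m c (i - 1) \<inter> hypersurface (m i) (c i))
        ` carrier (de_rham_algebra (complement m c (i - 1)))
      = carrier (de_rham_algebra (complement m c (i - 1) \<inter> hypersurface (m i) (c i)))"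
  shows "generates_algebra (de_rham_algebra (complement m c n))
    (de_rham_class (complement m c n) `
      (range (\<lambda>j. dlog (complement m c n) (\<lambda>z. z $ j)) \<union>
       (\<lambda>i. dlog (complement m c n) (\<lambda>z. character (m i) z - c i)) ` {1..n}))"
proof -
  let ?M = "complement m c n"
  let ?L = "range (\<lambda>j. log_form (\<lambda>z. z $ j)) \<union> (\<lambda>i. log_form (\<lambda>z. character (m i) z - c i)) ` {1..n}"
  note M = open_complement[of m c n]
  have log: "closed_on ?M (log_form g)" if "smooth_on ?M g" "\<And>z. z \<in> ?M \<Longrightarrow> g z \<noteq> 0" for g
    unfolding closed_on_def
    using ambient_form_on_log_form[OF M that] ambient_deriv_log_form[OF M that] by blast
  have closed: "closed_on ?M l" if "l \<in> ?L" for l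
    using that
  proof
    assume "l \<in> range (\<lambda>j. log_form (\<lambda>z. z $ j))"
    then obtain j where "l = log_form (\<lambda>z. z $ j)" by blast
    then show ?thesis
      using complement_torus[of m c n]
      by (auto intro!: log smooth_on_vec_nth smooth_on_ident M simp: torus_def)
  next
    assume "l \<in> (\<lambda>i. log_form (\<lambda>z. character (m i) z - c i)) ` {1..n}"
    then obtain i where i: "i \<in> {1..n}" and l: "l = log_form (\<lambda>z. character (m i) z - c i)" by blast
    show ?thesis
      unfolding l
    proof (rule log)
      show "smooth_on ?M (\<lambda>z. character (m i) z - c i)"
        by (intro smooth_on_diff smooth_on_const M smooth_on_subset[OF smooth_character complement_torus])
      show "character (m i) z - c i \<noteq> 0" if "z \<in> ?M" for z
        using that i by (auto simp: complement_def hypersurface_def)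
    qed
  qed
  have "generates_algebra (de_rham_algebra ?M) (cls ?M ` ?L)"
    by (rule generates_algebraI[OF M closed generated_form_arrangement[OF assms]]) auto
  then show ?thesis
    by (simp add: image_Un image_image dlog_eq)
qed

end
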